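(* Let $n\ge 1$ and consider the system in $\mathbb R^n$ $$y'(t)+Ay(t)=F(y(t))+f(t).\qquad (\ast)$$ Assume the following. (1) $A$ is a real $n\times n$ matrix all of whose eigenvalues have positive real parts. (2) $F:\mathbb R^n\to\mathbb R^n$ is locally Lipschitz, $F(0)=0$, and one of the following holds: (H1) there are numbers $\beta_k\in(1,\infty)$, $k\in\mathbb N$, increasing strictly to infinity, and functions $F_k\in\mathcal H_{\beta_k}(\mathbb R^n)\cap C^\infty(\mathbb R^n\setminus\{0\})$ such that for every $N\in\mathbb N$, $|F(x)-\sum_{k=1}^N F_k(x)|=\mathcal O(|x|^{\beta})$ as $x\to0$ for some $\beta>\beta_N$; (H2) there are $N_*\in\mathbb N$, strictly increasing numbers $\beta_1<\dots<\beta_{N_*}$ in $(1,\infty)$ and functions $F_k\in\mathcal H_{\beta_k}(\mathbb R^n)\cap C^\infty(\mathbb R^n\setminus\{0\})$, $1\le k\le N_*$, such that $|F(x)-\sum_{k=1}^{N_*}F_k(x)|=\mathcal O(|x|^\beta)$ as $x\to 0$ for all $\beta>\beta_{N_*}$. (3) $f\in C([T,\infty),\mathbb R^n)$ for some $T\ge0$, and there is $m_*\in\mathbb Z_+$ such that one of the following holds: (f1) there are a strictly increasing, divergent sequence $(\gamma_k)_{k\ge1}$ of positive numbers, integers $\widetilde n_k\in\mathbb N\cap[m_*,\infty)$ and functions $p_k\in\mathscr P_{m_*}(\widetilde n_k,-\gamma_k,\mathbb C^n,\mathbb R^n)$, $k\in\mathbb N$, such that for every $N\in\mathbb N$ there is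 $\mu>\gamma_N$ with $|f(t)-\sum_{k=1}^N p_k(\widehat{\mathcal L}_{\widetilde n_k}(t))|=\mathcal O(L_{m_*}(t)^{-\mu})$; (f2) there are $K\in\mathbb N$, positive numbers $\gamma_1<\dots<\gamma_K$, an integer $n_*\in\mathbb N\cap[m_*,\infty)$ and functions $p_k\in\mathscr P_{m_*}(n_*,-\gamma_k,\mathbb C^n,\mathbb R^n)$, $1\le k\le K$, such that $|f(t)-\sum_{k=1}^K p_k(\widehat{\mathcal L}_{n_*}(t))|=\mathcal O(L_{m_*}(t)^{-\mu})$ for all $\mu>\gamma_K$. (4) Setting $n_1=\widetilde n_1$ in case (f1) and $n_1=n_*$ in case (f2), one has $p_1(z)=p_0(z)\,z_{m_*}^{-\gamma_1}\xi_0$ for $z\in(0,\infty)^{n_1+2}$, with some $p_0\in\mathscr P^+_{m_*}(n_1)$ and $\xi_0\in\mathbb R^n\setminus\{0\}$. Then there exist a divergent, strictly increasing sequence $(\mu_k)_{k=1}^\infty\subset(0,\infty)$, an increasing (i.e. nondecreasing) sequence $(n_k)_{k=0}^\infty\subset\mathbb Z_+\cap[m_*,\infty)$, a function $\zeta_*\in\mathscr P^+_{m_*}(n_0)$, and functions $q_k\in\widehat{\mathscr P}_{m_*}(n_k,-\mu_k,\mathbb C^n,\mathbb R^n)$ for $k\in\mathbb N$, such that every solution $y\in C^1([T_0,\infty),\mathbb R^n)$ of $(\ast)$ on $(T_0,\infty)$ (for some $T_0>0$, $T_0\ge T$) with $\lim_{t\to\infty}y(t)=0$ admits the asymptotic expansion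 $$y(t)\sim\sum_{k=1}^\infty q_k(\Xi_{n_k}(t)),\qquad \Xi_k(t)=\big(\widehat{\mathcal L}_k(t),\zeta_*(\widehat{\mathcal L}_{n_0}(t))\big),$$ meaning: for each $N\in\mathbb N$ there is $\mu>\mu_N$ such that $$\Big|y(t)-\sum_{k=1}^N q_k(\Xi_{n_k}(t))\Big|=\mathcal O(L_{m_*}(t)^{-\mu})\quad\text{as }t\to\infty.$$
   Context: Conventions: $\mathbb N=\{1,2,\dots\}$, $\mathbb Z_+=\mathbb N\cup\{0\}$; $|\cdot|$ is the Euclidean norm; $\mathcal O(\cdot)$ in $t$ means as $t\to\infty$. For $t>0$, $w\in\mathbb C$: $t^w=e^{w\ln t}$. Positively homogeneous functions: $\mathcal H_\beta(\mathbb R^n)$ is the set of $G:\mathbb R^n\to\mathbb R^n$ with $G(tx)=t^\beta G(x)$ for all $x\in\mathbb R^n$, $t>0$. Iterated exponentials and logarithms: $E_0(t)=t$, $E_{m+1}(t)=e^{E_m(t)}$; $L_{-1}(t)=e^t$, $L_0(t)=t$, $L_{m+1}(t)=\ln L_m(t)$ for $t>E_m(0)$, $m\in\mathbb Z_+$. $\widehat{\mathcal L}_k(t)=(L_{-1}(t),L_0(t),L_1(t),\dots,L_k(t))$. Powers: for $z=(z_{-1},z_0,\dots,z_k)\in(0,\infty)^{k+2}$ and $\alpha=(\alpha_{-1},\dots,\alpha_k)\in\mathbb C^{k+2}$, $z^\alpha=\prod_{j=-1}^k z_j^{\alpha_j}$. For integers $k\ge m\ge-1$ and $\mu\in\mathbb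 R$, $\mathcal E_{\mathbb C}(m,k,\mu)$ is the set of $\alpha\in\mathbb C^{k+2}$ with $\operatorname{Re}\alpha_j=0$ for $-1\le j<m$ and $\operatorname{Re}\alpha_m=\mu$. Classes: $\widehat{\mathscr P}(k,\mathbb C^d,\mathbb R^d)$ is the set of functions $p(z,\zeta)=\sum_{(\alpha,\beta)\in S}z^\alpha\zeta^\beta\xi_{\alpha,\beta}$, $z\in(0,\infty)^{k+2}$, $\zeta\in(0,\infty)$, where $S\subset\mathbb C^{k+2}\times\mathbb R$ is finite and closed under complex conjugation, $\xi_{\alpha,\beta}\in\mathbb C^d$ and $\xi_{\bar\alpha,\beta}=\overline{\xi_{\alpha,\beta}}$ (so $p$ is $\mathbb R^d$-valued). $\widehat{\mathscr P}_m(k,\mu,\mathbb C^d,\mathbb R^d)$ is the subset where $\alpha\in\mathcal E_{\mathbb C}(m,k,\mu)$ for all $(\alpha,\beta)\in S$. $\mathscr P(k,\mathbb C^d,\mathbb R^d)$ and $\mathscr P_m(k,\mu,\mathbb C^d,\mathbb R^d)$ are defined in the same way without $\zeta,\beta$ (functions $p(z)=\sum_{\alpha\in S}z^\alpha\xi_\alpha$). $\mathscr P^+(k)$ is the set of $p\in\mathscr P(k,\mathbb C,\mathbb R)$ of the form $p(z)=c\,z^{\alpha_{\max}}+q(z)$ with $\alpha_{\max}\in\mathbb R^{k+2}$, $c>0$, and $q\in\mathscr P(k,\mathbb C,\mathbb R)$ a finite sum of terms $z^\alpha\xi_\alpha$ with $\operatorname{Re}(\alpha)<\alpha_{\max}$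 in the lexicographic order. $\mathscr P_m^+(k)$ is the set of $p\in\mathscr P^+(k)\cap\mathscr P_m(k,0,\mathbb C,\mathbb R)$ all of whose power vectors $\alpha$ satisfy $\alpha_{-1}=0$. For $p\in\mathscr P^+(k)$ one has $p(\widehat{\mathcal L}_k(t))>0$ for all sufficiently large $t$, so $q_k(\Xi_{n_k}(t))$ is defined for large $t$. *)

theory Defs
  imports "HOL-Analysis.Analysis" "HOL-Library.Landau_Symbols"
begin

text \<open>
  A (k+2)-tuple indexed by -1, 0, ..., k is a function on \<^typ>\<open>int\<close> that vanishes outside
  of \<open>{-1..k}\<close>. This makes the representation of tuples unique, which matters because
  finite sets of power vectors occur below as index sets of sums.
\<close>

definition tuples :: "int \<Rightarrow> (int \<Rightarrow> 'a::zero) set" where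
  "tuples k = {x. \<forall>j. j \<notin> {-1..k} \<longrightarrow> x j = 0}"

definition pos_tuples :: "int \<Rightarrow> (int \<Rightarrow> real) set" where
  "pos_tuples k = {z \<in> tuples k. \<forall>j\<in>{-1..k}. z j > 0}"

text \<open>
  The iterated logarithm is mathematically meaningful for sufficiently large arguments only; it
  is used here only in statements about t tending to infinity, so the values of the total
  function elsewhere are irrelevant. Indices \<open>j \<le> -1\<close> all give the exponential, only
  \<open>j = -1\<close> is used.
\<close>

definition iter_log :: "int \<Rightarrow> real \<Rightarrow> real" where
  "iter_log j t = (if j < 0 then exp t else (ln ^^ nat j) t)"

definition log_tuple :: "int \<Rightarrow> real \<Rightarrow> int \<Rightarrow> real" where
  "log_tuple k t = (\<lambda>j. if j \<in> {-1..k} then iter_log j t else 0)"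

definition tuple_power :: "int \<Rightarrow> (int \<Rightarrow> real) \<Rightarrow> (int \<Rightarrow> complex) \<Rightarrow> complex" where
  "tuple_power k z \<alpha> = (\<Prod>j=-1..k. complex_of_real (z j) powr \<alpha> j)"

definition power_vectors :: "int \<Rightarrow> int \<Rightarrow> real \<Rightarrow> (int \<Rightarrow> complex) set" where
  "power_vectors m k \<mu> =
     {\<alpha> \<in> tuples k. (\<forall>j\<in>{-1..<m}. Re (\<alpha> j) = 0) \<and> Re (\<alpha> m) = \<mu>}"

definition cnj_vec :: "complex ^ 'd \<Rightarrow> complex ^ 'd" where
  "cnj_vec v = (\<chi> i. cnj (v $ i))"

definition complexify :: "real ^ 'd \<Rightarrow> complex ^ 'd" where
  "complexify v = (\<chi> i. complex_of_real (v $ i))"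

text \<open>
  Representations of a function as a finite, conjugation-invariant sum of powers: with the
  additional positive variable \<open>\<zeta>\<close> (values in R^d), without it (values in R^d), and without it
  (scalar values). The functions are constrained only on the positive orthant.
\<close>

definition hat_power_sum ::
  "int \<Rightarrow> ((int \<Rightarrow> complex) \<times> real) set \<Rightarrow> ((int \<Rightarrow> complex) \<times> real \<Rightarrow> complex ^ 'd)
    \<Rightarrow> ((int \<Rightarrow> real) \<Rightarrow> real \<Rightarrow> real ^ 'd) \<Rightarrow> bool" where
  "hat_power_sum k S \<xi> p \<longleftrightarrow>
     finite S \<and> (\<forall>(\<alpha>, \<beta>)\<in>S. \<alpha> \<in> tuples k) \<and>
     (\<forall>(\<alpha>, \<beta>)\<in>S. (cnj \<circ> \<alpha>, \<beta>) \<in> S \<and> \<xi> (cnj \<circ> \<alpha>, \<beta>) = cnj_vec (\<xi> (\<alpha>, \<beta>))) \<and>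
     (\<forall>z\<in>pos_tuples k. \<forall>\<zeta>>0.
        complexify (p z \<zeta>) =
          (\<Sum>(\<alpha>, \<beta>)\<in>S. (tuple_power k z \<alpha> * complex_of_real (\<zeta> powr \<beta>)) *s \<xi> (\<alpha>, \<beta>)))"

definition power_sum ::
  "int \<Rightarrow> (int \<Rightarrow> complex) set \<Rightarrow> ((int \<Rightarrow> complex) \<Rightarrow> complex ^ 'd)
    \<Rightarrow> ((int \<Rightarrow> real) \<Rightarrow> real ^ 'd) \<Rightarrow> bool" where
  "power_sum k S \<xi> p \<longleftrightarrow>
     finite S \<and> S \<subseteq> tuples k \<and>
     (\<forall>\<alpha>\<in>S. cnj \<circ> \<alpha> \<in> S \<and> \<xi> (cnj \<circ> \<alpha>) = cnj_vec (\<xi> \<alpha>)) \<and>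
     (\<forall>z\<in>pos_tuples k. complexify (p z) = (\<Sum>\<alpha>\<in>S. tuple_power k z \<alpha> *s \<xi> \<alpha>))"

definition scalar_power_sum ::
  "int \<Rightarrow> (int \<Rightarrow> complex) set \<Rightarrow> ((int \<Rightarrow> complex) \<Rightarrow> complex)
    \<Rightarrow> ((int \<Rightarrow> real) \<Rightarrow> real) \<Rightarrow> bool" where
  "scalar_power_sum k S \<xi> p \<longleftrightarrow>
     finite S \<and> S \<subseteq> tuples k \<and>
     (\<forall>\<alpha>\<in>S. cnj \<circ> \<alpha> \<in> S \<and> \<xi> (cnj \<circ> \<alpha>) = cnj (\<xi> \<alpha>)) \<and>
     (\<forall>z\<in>pos_tuples k. complex_of_real (p z) = (\<Sum>\<alpha>\<in>S. tuple_power k z \<alpha> * \<xi> \<alpha>))"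

definition hatP :: "int \<Rightarrow> int \<Rightarrow> real \<Rightarrow> ((int \<Rightarrow> real) \<Rightarrow> real \<Rightarrow> real ^ 'd) set" where
  "hatP m k \<mu> =
     {p. \<exists>S \<xi>. hat_power_sum k S \<xi> p \<and> (\<forall>(\<alpha>, \<beta>)\<in>S. \<alpha> \<in> power_vectors m k \<mu>)}"

definition vecP :: "int \<Rightarrow> int \<Rightarrow> real \<Rightarrow> ((int \<Rightarrow> real) \<Rightarrow> real ^ 'd) set" where
  "vecP m k \<mu> = {p. \<exists>S \<xi>. power_sum k S \<xi> p \<and> S \<subseteq> power_vectors m k \<mu>}"

definition lex_less :: "int \<Rightarrow> (int \<Rightarrow> real) \<Rightarrow> (int \<Rightarrow> real) \<Rightarrow> bool" where
  "lex_less k a b \<longleftrightarrow> (\<exists>j\<in>{-1..k}. a j < b j \<and> (\<forall>i\<in>{-1..<j}. a i = b i))"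

definition Pplus :: "int \<Rightarrow> ((int \<Rightarrow> real) \<Rightarrow> real) set" where
  "Pplus k =
     {p. (\<exists>S \<xi>. scalar_power_sum k S \<xi> p) \<and>
         (\<exists>\<alpha>max\<in>tuples k. \<exists>c>0. \<exists>q S \<xi>.
            scalar_power_sum k S \<xi> q \<and> (\<forall>\<alpha>\<in>S. lex_less k (\<lambda>j. Re (\<alpha> j)) \<alpha>max) \<and>
            (\<forall>z\<in>pos_tuples k. complex_of_real (p z) =
               complex_of_real c * tuple_power k z (\<lambda>j. complex_of_real (\<alpha>max j))
                 + complex_of_real (q z)))}"

definition Pplus_at :: "int \<Rightarrow> int \<Rightarrow> ((int \<Rightarrow> real) \<Rightarrow> real) set" where
  "Pplus_at m k =
     {p \<in> Pplus k. \<exists>S \<xi>. scalar_power_sum k S \<xi> p \<and> S \<subseteq> power_vectors m k 0 \<and>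
        (\<forall>\<alpha>\<in>S. \<alpha> (-1) = 0)}"

definition pos_homogeneous :: "real \<Rightarrow> (real ^ 'n \<Rightarrow> real ^ 'n) set" where
  "pos_homogeneous \<beta> = {G. \<forall>x. \<forall>t>0. G (t *\<^sub>R x) = (t powr \<beta>) *\<^sub>R G x}"

text \<open>Continuous differentiability of order r on an open set, by recursion on r through the
  directional derivatives.\<close>

fun Cr_on :: "nat \<Rightarrow> 'a::real_normed_vector set \<Rightarrow> ('a \<Rightarrow> 'b::real_normed_vector) \<Rightarrow> bool" where
  "Cr_on 0 S G \<longleftrightarrow> continuous_on S G"
| "Cr_on (Suc r) S G \<longleftrightarrow>
     (\<forall>x\<in>S. G differentiable (at x)) \<and>
     (\<forall>v. Cr_on r S (\<lambda>x. frechet_derivative G (at x) v))"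

definition smooth_on :: "'a::real_normed_vector set \<Rightarrow> ('a \<Rightarrow> 'b::real_normed_vector) \<Rightarrow> bool" where
  "smooth_on S G \<longleftrightarrow> (\<forall>r. Cr_on r S G)"

definition complex_eigenvalue :: "real ^ 'n ^ 'n \<Rightarrow> complex \<Rightarrow> bool" where
  "complex_eigenvalue A l \<longleftrightarrow>
     (\<exists>v::complex ^ 'n. v \<noteq> 0 \<and> map_matrix complex_of_real A *v v = l *s v)"

text \<open>All sequences indexed by positive integers are functions on \<^typ>\<open>nat\<close> whose value at 0 is
  unconstrained.\<close>

definition nonlin_H1 :: "(real ^ 'n \<Rightarrow> real ^ 'n) \<Rightarrow> bool" where
  "nonlin_H1 F \<longleftrightarrow>
     (\<exists>\<beta> :: nat \<Rightarrow> real. \<exists>Fk :: nat \<Rightarrow> real ^ 'n \<Rightarrow> real ^ 'n.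
        (\<forall>k\<ge>1. \<beta> k > 1) \<and> strict_mono_on {1..} \<beta> \<and> filterlim \<beta> at_top sequentially \<and>
        (\<forall>k\<ge>1. Fk k \<in> pos_homogeneous (\<beta> k) \<and> smooth_on (- {0}) (Fk k)) \<and>
        (\<forall>N\<ge>1. \<exists>b>\<beta> N.
           (\<lambda>x. norm (F x - (\<Sum>k=1..N. Fk k x))) \<in> O[at 0](\<lambda>x. norm x powr b)))"

definition nonlin_H2 :: "(real ^ 'n \<Rightarrow> real ^ 'n) \<Rightarrow> bool" where
  "nonlin_H2 F \<longleftrightarrow>
     (\<exists>Ns\<ge>1. \<exists>\<beta> :: nat \<Rightarrow> real. \<exists>Fk :: nat \<Rightarrow> real ^ 'n \<Rightarrow> real ^ 'n.
        (\<forall>k\<in>{1..Ns}. \<beta> k > 1) \<and> strict_mono_on {1..Ns} \<beta> \<and>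
        (\<forall>k\<in>{1..Ns}. Fk k \<in> pos_homogeneous (\<beta> k) \<and> smooth_on (- {0}) (Fk k)) \<and>
        (\<forall>b>\<beta> Ns.
           (\<lambda>x. norm (F x - (\<Sum>k=1..Ns. Fk k x))) \<in> O[at 0](\<lambda>x. norm x powr b)))"

definition forcing_f1 ::
  "(real \<Rightarrow> real ^ 'n) \<Rightarrow> nat \<Rightarrow> (nat \<Rightarrow> real) \<Rightarrow> (nat \<Rightarrow> nat)
    \<Rightarrow> (nat \<Rightarrow> (int \<Rightarrow> real) \<Rightarrow> real ^ 'n) \<Rightarrow> bool" where
  "forcing_f1 f m \<gamma> nt p \<longleftrightarrow>
     (\<forall>k\<ge>1. \<gamma> k > 0) \<and> strict_mono_on {1..} \<gamma> \<and> filterlim \<gamma> at_top sequentially \<and>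
     (\<forall>k\<ge>1. nt k \<ge> 1 \<and> nt k \<ge> m \<and> p k \<in> vecP (int m) (int (nt k)) (- \<gamma> k)) \<and>
     (\<forall>N\<ge>1. \<exists>\<mu>>\<gamma> N.
        (\<lambda>t. norm (f t - (\<Sum>k=1..N. p k (log_tuple (int (nt k)) t))))
          \<in> O[at_top](\<lambda>t. iter_log (int m) t powr (- \<mu>)))"

definition forcing_f2 ::
  "(real \<Rightarrow> real ^ 'n) \<Rightarrow> nat \<Rightarrow> nat \<Rightarrow> (nat \<Rightarrow> real) \<Rightarrow> nat
    \<Rightarrow> (nat \<Rightarrow> (int \<Rightarrow> real) \<Rightarrow> real ^ 'n) \<Rightarrow> bool" where
  "forcing_f2 f m K \<gamma> ns p \<longleftrightarrow>
     K \<ge> 1 \<and> (\<forall>k\<in>{1..K}. \<gamma> k > 0) \<and> strict_mono_on {1..K} \<gamma> \<and> ns \<ge> 1 \<and> ns \<ge> m \<and>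
     (\<forall>k\<in>{1..K}. p k \<in> vecP (int m) (int ns) (- \<gamma> k)) \<and>
     (\<forall>\<mu>>\<gamma> K.
        (\<lambda>t. norm (f t - (\<Sum>k=1..K. p k (log_tuple (int ns) t))))
          \<in> O[at_top](\<lambda>t. iter_log (int m) t powr (- \<mu>)))"

text \<open>A solution is continuously differentiable on the closed half-line (with a one-sided
  derivative at its left endpoint) and satisfies the equation on the open one.\<close>

definition is_solution ::
  "real ^ 'n ^ 'n \<Rightarrow> (real ^ 'n \<Rightarrow> real ^ 'n) \<Rightarrow> (real \<Rightarrow> real ^ 'n) \<Rightarrow> real
    \<Rightarrow> (real \<Rightarrow> real ^ 'n) \<Rightarrow> bool" where
  "is_solution A F f T0 y \<longleftrightarrow>
     (\<exists>y'. continuous_on {T0..} y' \<and>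
        (\<forall>t\<ge>T0. (y has_vector_derivative y' t) (at t within {T0..})) \<and>
        (\<forall>t>T0. y' t + A *v y t = F (y t) + f t))"

end

theory Submission
  imports Defs "HOL-Computational_Algebra.Fundamental_Theorem_Algebra"
begin

text \<open>
  Write \<open>s = \<zeta> L\<^sup>-\<^sup>\<gamma>\<close> for the scalar factor of the leading forcing term \<open>s \<xi>\<^sub>0\<close>, with \<open>L\<close> the m-th iterated logarithm
  and \<open>\<gamma>\<close> its exponent; the leading term of every decaying solution is \<open>s a\<close> with \<open>A a = \<xi>\<^sub>0\<close>. Since \<open>a \<noteq> 0\<close>,
  homogeneity gives \<open>F\<^sub>k (s (a + u)) = s\<^sup>\<beta> F\<^sub>k (a + u)\<close>, and \<open>F\<^sub>k\<close> can be expanded by Taylor's formula at \<open>a\<close>. This is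
  why real powers of \<open>\<zeta>\<close> occur in the expansion.

  Approximate solutions are improved by successive correction of the residual: if its leading block is
  a sum of terms \<open>Re (c z\<^sup>\<alpha> \<zeta>\<^sup>\<beta>) v\<close>, then solving \<open>(A + \<alpha>\<^sub>-\<^sub>1) w = - c v\<close> for each term and adding the result removes
  that block; differentiating the other factors, and the change of \<open>F\<close>, cost at least a fixed gain \<open>\<delta>\<close> in the
  exponent of \<open>L\<close>. The residual carries its whole series along, so no uniqueness of expansions is needed.
  A solution and an approximate solution differ by a function \<open>w\<close> with \<open>w' + A w\<close> equal to the residual up to
  a small multiple of \<open>w\<close>, and a Lyapunov form for \<open>A\<close> shows that \<open>w\<close> decays like the residual.
\<close>

section \<open>A Lyapunov form and linear decay\<close>

text \<open>All orders are measured on the grid \<open>\<gamma> + j * \<delta>\<close>, although the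
  true exponents need not lie on it: block j merely promises order at least that much. This gives
  one uniform gain per correction and avoids tracking the exponents generated jointly by F, f and
  the derivatives; the true orders are sorted out at the very end. Bounds are stated for every
  exponent below the nominal one, because \<zeta> and the slower logarithms may grow, though slower
  than any power of L. The obstacle is that the homogeneous parts of F are smooth only away from the
  origin while solutions tend to it. So two crude estimates come first: superlinearity of F gives y
  the decay of f, and then F along y counts as forcing, which shows that y is s (a + u) with u
  tending to 0. Only after that is F Lipschitz with a small constant along y and its approximations,
  up to an error of any prescribed order. The approximations are built from A, F and f alone, hence
  serve all decaying solutions at once.\<close>

definition cmul :: "real ^ 'n ^ 'n \<Rightarrow> complex ^ 'n \<Rightarrow> complex ^ 'n" where
  "cmul A x = map_matrix complex_of_real A *v x"

section \<open>Polynomials of the complexified matrix\<close>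

lemma cmul_add: "cmul A (x + y) = cmul A x + cmul A y"
  by (simp add: cmul_def matrix_vector_right_distrib)

lemma cmul_scale: "cmul A (c *s x) = c *s cmul A x"
  by (simp add: cmul_def vector_scalar_commute)

lemma scaleR_cvec: "r *\<^sub>R (x :: complex ^ 'n) = of_real r *s x"
  by (simp add: vec_eq_iff) (simp add: scaleR_conv_of_real)

lemma cmul_complexify: "cmul A (complexify x) = complexify (A *v x)"
  by (simp add: cmul_def complexify_def vec_eq_iff map_matrix_def matrix_vector_mult_def)

lemma linear_cmul_shift: "linear (\<lambda>x. cmul A x + l *s x)"
proof (rule linearI)
  show "cmul A (x + y) + l *s (x + y) = (cmul A x + l *s x) + (cmul A y + l *s y)" for x y
    by (simp add: cmul_add vector_add_ldistrib)
  show "cmul A (r *\<^sub>R x) + l *s (r *\<^sub>R x) = r *\<^sub>R (cmul A x + l *s x)" for r x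
    by (simp add: scaleR_cvec cmul_scale vector_add_ldistrib mult.commute vector_smult_assoc)
qed

text \<open>The first factor acts first. Hence A - l maps the kernel of the product over
  \<open>l # ls\<close> into the kernel of the product over \<open>ls\<close>, which is what the
  induction in \<open>lyapunov_list\<close> needs.\<close>

fun poly_act :: "real ^ 'n ^ 'n \<Rightarrow> complex list \<Rightarrow> complex ^ 'n \<Rightarrow> complex ^ 'n" where
  "poly_act A [] x = x"
| "poly_act A (l # ls) x = poly_act A ls (cmul A x - l *s x)"

definition poly_eval :: "real ^ 'n ^ 'n \<Rightarrow> complex poly \<Rightarrow> complex ^ 'n \<Rightarrow> complex ^ 'n" where
  "poly_eval A p x = (\<Sum>i\<le>degree p. coeff p i *s (cmul A ^^ i) x)"

lemma poly_eval_altdef: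
  assumes "degree p \<le> N"
  shows "poly_eval A p x = (\<Sum>i\<le>N. coeff p i *s (cmul A ^^ i) x)"
  unfolding poly_eval_def
  using assms by (intro sum.mono_neutral_left) (auto simp: coeff_eq_0)

lemma cmul_0: "cmul A 0 = 0"
  by (simp add: cmul_def)

lemma cmul_sum: "cmul A (\<Sum>i\<in>I. g i) = (\<Sum>i\<in>I. cmul A (g i))"
  by (induction I rule: infinite_finite_induct) (simp_all add: cmul_add cmul_0)

lemma poly_eval_pCons: "poly_eval A (pCons c p) x = c *s x + cmul A (poly_eval A p x)"
proof -
  have "poly_eval A (pCons c p) x = (\<Sum>i\<le>Suc (degree p). coeff (pCons c p) i *s (cmul A ^^ i) x)"
    by (rule poly_eval_altdef) (simp add: degree_pCons_le)
  also have "\<dots> = c *s x + (\<Sum>i\<le>degree p. coeff p i *s (cmul A ^^ Suc i) x)"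
    by (subst sum.atMost_Suc_shift) simp
  finally show ?thesis by (simp add: poly_eval_def cmul_sum cmul_scale)
qed

lemma poly_eval_0: "poly_eval A 0 x = 0"
  by (simp add: poly_eval_def)

lemma poly_eval_linear_mult:
  "poly_eval A ([:-l, 1:] * q) x = cmul A (poly_eval A q x) - l *s poly_eval A q x"
proof -
  have add: "poly_eval A (p + r) x = poly_eval A p x + poly_eval A r x" for p r
  proof -
    define N where "N = max (degree p) (degree r)"
    have "degree (p + r) \<le> N" unfolding N_def by (rule degree_add_le_max)
    then show ?thesis
      using poly_eval_altdef[of p N A x] poly_eval_altdef[of r N A x] poly_eval_altdef[of "p+r" N A x]
      by (simp add: N_def sum.distrib vector_sadd_rdistrib)
  qed
  have smult: "poly_eval A (smult c p) x = c *s poly_eval A p x" for c p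
    using poly_eval_altdef[of "smult c p" "degree p" A x]
    by (simp add: poly_eval_def degree_smult_le vec.scale_sum_right vector_smult_assoc)
  have "[:-l, 1:] * q = smult (-l) q + pCons 0 q" by simp
  then show ?thesis unfolding \<open>[:-l, 1:] * q = _\<close> add smult poly_eval_pCons
    by (simp add: vector_smult_lneg)
qed

lemma poly_eval_commute_linear:
  "poly_eval A q (cmul A x - l *s x) = cmul A (poly_eval A q x) - l *s poly_eval A q x"
proof (induction q rule: pCons_induct)
  case 0
  then show ?case by (simp add: poly_eval_0 cmul_def)
next
  case (pCons c q)
  have d: "cmul A (u - v) = cmul A u - cmul A v" for u v
    by (simp add: cmul_def matrix_vector_mult_diff_distrib)
  show ?case
    by (simp add: poly_eval_pCons pCons d cmul_add cmul_scale vec.scale_right_diff_distrib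
        vec.scale_right_distrib algebra_simps vector_smult_assoc)
qed

lemma poly_eval_annihilated:
  assumes "p \<noteq> 0"
  shows "\<exists>ls. (\<forall>l\<in>set ls. complex_eigenvalue A l) \<and> (\<forall>x. poly_eval A p x = 0 \<longrightarrow> poly_act A ls x = 0)"
  using assms
proof (induction "degree p" arbitrary: p)
  case 0
  then obtain c where c: "p = [:c:]" "c \<noteq> 0" by (metis degree_eq_zeroE pCons_0_0)
  have "poly_eval A p x = c *s x" for x
    by (simp add: c poly_eval_def)
  then show ?case using c by (intro exI[of _ "[]"]) (auto simp: vec_eq_iff)
next
  case (Suc d)
  then obtain l where "poly p l = 0"
    using fundamental_theorem_of_algebra[of p] by (metis Zero_not_Suc constant_degree)
  then obtain q where q: "p = [:-l, 1:] * q" by (metis dvdE poly_eq_0_iff_dvd)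
  have q0: "q \<noteq> 0" using Suc.prems q by auto
  have "degree p = Suc (degree q)" unfolding q using q0 by (subst degree_mult_eq) auto
  then have "d = degree q" using Suc by simp
  from Suc.hyps(1)[OF this q0] obtain ls
    where ls: "\<forall>l\<in>set ls. complex_eigenvalue A l"
      "\<And>x. poly_eval A q x = 0 \<Longrightarrow> poly_act A ls x = 0" by blast
  show ?case
  proof (cases "complex_eigenvalue A l")
    case True
    then show ?thesis using ls
      by (intro exI[of _ "l # ls"]) (auto simp: q poly_eval_linear_mult poly_eval_commute_linear
          simp del: mult_pCons_left)
  next
    case False
    then have "poly_eval A q x = 0" if "poly_eval A p x = 0" for x
      using that unfolding complex_eigenvalue_def q poly_eval_linear_mult
      by (auto simp: cmul_def)
    then show ?thesis using ls by blast
  qed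
qed

lemma exists_annihilating_poly:
  fixes A :: "real ^ 'n ^ 'n"
  shows "\<exists>p. p \<noteq> 0 \<and> (\<forall>x. poly_eval A p x = 0)"
proof -
  define M where "M = map_matrix complex_of_real A"
  define X where "X i = (((**) M) ^^ i) (mat 1)" for i
  have X: "X i *v x = (cmul A ^^ i) x" for i x
    by (induction i) (simp_all add: X_def M_def cmul_def flip: matrix_vector_mul_assoc)
  have scaled: "(r *\<^sub>R M) *v x = of_real r *s (M *v x)" for r and M :: "complex ^ 'n ^ 'n" and x
    by (simp add: vec_eq_iff matrix_vector_mult_def sum_distrib_left scaleR_conv_of_real[where 'a=complex] mult.assoc)
  show ?thesis
  \<comment> \<open>Linear dependence is a property of a set of matrices, so two coinciding powers
    must be treated on their own; they give a difference of two monomials.\<close>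
  proof (cases "inj X")
    case False
    then obtain i j where ij: "i \<noteq> j" "X i = X j" by (auto simp: inj_def)
    define p where "p = monom (1::complex) i - monom 1 j"
    have "coeff p i = 1" using ij by (simp add: p_def)
    then have "p \<noteq> 0" by auto
    moreover have "poly_eval A p x = 0" for x
    proof -
      have "degree p \<le> i + j"
        unfolding p_def by (intro degree_diff_le order.trans[OF degree_monom_le]) auto
      then have "poly_eval A p x = (\<Sum>k\<le>i+j. coeff p k *s (cmul A ^^ k) x)"
        by (rule poly_eval_altdef)
      also have "\<dots> = (\<Sum>k\<le>i+j. (if k = i then (cmul A ^^ k) x else 0) - (if k = j then (cmul A ^^ k) x else 0))"
        using ij by (intro sum.cong) (auto simp: p_def vector_smult_lneg)
      also have "\<dots> = 0" unfolding sum_subtractf using ij X[of i x] X[of j x] by simp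
      finally show ?thesis .
    qed
    ultimately show ?thesis by blast
  next
    case True
    \<comment> \<open>N + 1 distinct powers in a real space of dimension N satisfy a nontrivial
      relation with real coefficients.\<close>
    define N where "N = DIM(complex ^ 'n ^ 'n)"
    have "dependent (X ` {..N})"
    proof (rule dependent_biggerset)
      show "card (X ` {..N}) > DIM(complex ^ 'n ^ 'n)"
        using True by (subst card_image) (auto simp: N_def inj_on_def)
    qed
    then obtain S u where S: "finite S" "S \<subseteq> X ` {..N}" "(\<Sum>v\<in>S. u v *\<^sub>R v) = 0" "\<exists>v\<in>S. u v \<noteq> 0"
      unfolding dependent_explicit by auto
    define w where "w i = (if X i \<in> S then u (X i) else 0)" for i
    define p where "p = Poly (map (\<lambda>i. complex_of_real (w i)) [0..<Suc N])"
    have cp: "coeff p i = (if i \<le> N then of_real (w i) else 0)" for i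
      by (auto simp: p_def nth_default_def simp del: upt_Suc)
    have "(\<Sum>i\<le>N. w i *\<^sub>R X i) = (\<Sum>v\<in>X ` {..N}. (if v \<in> S then u v else 0) *\<^sub>R v)"
      using True by (subst sum.reindex) (auto simp: w_def inj_on_def)
    also have "\<dots> = (\<Sum>v\<in>S. u v *\<^sub>R v)"
      using S by (intro sum.mono_neutral_cong_right) auto
    finally have sum0: "(\<Sum>i\<le>N. w i *\<^sub>R X i) = 0" using S by simp
    have "p \<noteq> 0"
    proof -
      obtain i where "i \<le> N" "X i \<in> S" "u (X i) \<noteq> 0" using S by blast
      then have "coeff p i \<noteq> 0" by (simp add: cp w_def)
      then show ?thesis by auto
    qed
    moreover have "poly_eval A p x = 0" for x
    proof -
      have "degree p \<le> N" by (rule degree_le) (auto simp: cp)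
      then have "poly_eval A p x = (\<Sum>i\<le>N. coeff p i *s (cmul A ^^ i) x)"
        by (rule poly_eval_altdef)
      also have "\<dots> = (\<Sum>i\<le>N. (w i *\<^sub>R X i) *v x)"
        by (intro sum.cong) (simp_all add: cp scaled flip: X)
      also have "\<dots> = (\<Sum>i\<le>N. w i *\<^sub>R X i) *v x"
        by (induction N) (simp_all add: matrix_vector_mult_add_rdistrib)
      finally show ?thesis by (simp add: sum0)
    qed
    ultimately show ?thesis by blast
  qed
qed

lemma exists_eigenvalue_product_zero:
  "\<exists>ls. (\<forall>l\<in>set ls. complex_eigenvalue A l) \<and> (\<forall>x. poly_act A ls x = 0)"
  using exists_annihilating_poly[of A] poly_eval_annihilated[of _ A] by blast

section \<open>Lyapunov forms and decay of perturbed linear systems\<close>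

lemma bounded_bilinear_plus:
  fixes f g :: "'a::euclidean_space \<Rightarrow> 'a \<Rightarrow> real"
  assumes "bounded_bilinear f" "bounded_bilinear g"
  shows "bounded_bilinear (\<lambda>x y. f x y + g x y)"
proof -
  have "linear (\<lambda>y. f x y)" "linear (\<lambda>y. g x y)" "linear (\<lambda>x. f x y)" "linear (\<lambda>x. g x y)" for x y
    using assms unfolding bilinear_conv_bounded_bilinear[symmetric] bilinear_def by blast+
  then show ?thesis
    unfolding bilinear_conv_bounded_bilinear[symmetric] bilinear_def
    by (intro conjI allI linear_compose_add)
qed

text \<open>The weighted form built from the partial products \<open>w\<^sub>j = (A - l\<^sub>1) \<dots> (A - l\<^sub>j) x\<close>: along the flow
  each \<open>w\<^sub>j\<close> decays up to a coupling to \<open>w\<^sub>j\<^sub>+\<^sub>1\<close>, which a large weight of the latter absorbs.\<close>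

lemma lyapunov_list:
  fixes A :: "real ^ 'n ^ 'n"
  assumes "\<forall>l\<in>set ls. Re l \<ge> k" "k > 0"
  shows "\<exists>B \<kappa>. \<kappa> > 0 \<and> bounded_bilinear B \<and> (\<forall>x y. B x y = B y x) \<and>
     (\<forall>x. poly_act A ls x = 0 \<longrightarrow> B x x \<ge> (norm x)\<^sup>2 \<and> B x (cmul A x) \<ge> \<kappa> * B x x)"
  using assms(1)
proof (induction ls)
  case Nil
  show ?case
    by (intro exI[of _ "inner"] exI[of _ 1])
       (auto simp: bounded_bilinear_inner inner_commute power2_norm_eq_inner cmul_def)
next
  case (Cons l ls)
  then obtain B \<kappa> where B: "\<kappa> > 0" "bounded_bilinear B" "\<And>x y. B x y = B y x"
     "\<And>x. poly_act A ls x = 0 \<Longrightarrow> B x x \<ge> (norm x)\<^sup>2 \<and> B x (cmul A x) \<ge> \<kappa> * B x x"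
    by auto
  interpret B: bounded_bilinear B by fact
  define D where "D x = cmul A x - l *s x" for x :: "complex ^ 'n"
  \<comment> \<open>With b the old form at \<open>D x\<close>, this weight makes
    \<open>c * (\<kappa> * b)\<close> equal to 2 b / k: one half pays for the coupling term - b / k,
    the other half is the decay of the new part of the form at rate \<kappa> / 2.\<close>
  define c where "c = 2 / (k * \<kappa>)"
  have c0: "c > 0" unfolding c_def using B assms(2) by simp
  have Dlin: "linear D"
    using linear_cmul_shift[of A "-l"] by (simp add: D_def[abs_def] vector_smult_lneg)
  then have Dbl: "bounded_linear D" by (simp add: linear_conv_bounded_linear)
  define B' where "B' x y = inner x y + B (c *\<^sub>R D x) (D y)" for x y
  have bb: "bounded_bilinear (\<lambda>x y. B (c *\<^sub>R D x) (D y))"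
    using bounded_bilinear.comp[OF B(2) bounded_linear_compose[OF bounded_linear_scaleR_right Dbl] Dbl] .
  have bb': "bounded_bilinear B'"
    unfolding B'_def[abs_def]
    by (rule bounded_bilinear_plus[OF bounded_bilinear_inner bb])
  have sym: "B' x y = B' y x" for x y
    by (simp add: B'_def inner_commute B.scaleR_left B(3)[of "D x"])
  have DA: "D (cmul A x) = cmul A (D x)" for x
    by (simp add: D_def cmul_def matrix_vector_mult_diff_distrib vector_scalar_commute)
  define \<kappa>' where "\<kappa>' = min (\<kappa> / 2) (k / 2)"
  have "(norm x)\<^sup>2 \<le> B' x x \<and> \<kappa>' * B' x x \<le> B' x (cmul A x)" if x: "poly_act A (l # ls) x = 0" for x
  proof -
    have "poly_act A ls (D x) = 0" using x by (simp add: D_def)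
    from B(4)[OF this] have b1: "(norm (D x))\<^sup>2 \<le> B (D x) (D x)"
      and b2: "\<kappa> * B (D x) (D x) \<le> B (D x) (cmul A (D x))" by auto
    define b where "b = B (D x) (D x)"
    have b0: "b \<ge> 0" using b1 unfolding b_def by (smt (verit) zero_le_power2)
    have e1: "B' x x = (norm x)\<^sup>2 + c * b"
      by (simp add: B'_def power2_norm_eq_inner B.scaleR_left b_def)
    have lx: "inner x (l *s x) = Re l * (norm x)\<^sup>2"
    proof -
      have "inner (x $ i) (l * x $ i) = Re l * (norm (x $ i))\<^sup>2" for i
        unfolding cmod_power2 by (simp add: inner_complex_def power2_eq_square algebra_simps)
      then have "inner x (l *s x) = (\<Sum>i\<in>UNIV. Re l * (norm (x $ i))\<^sup>2)"
        by (simp add: inner_vec_def)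
      then show ?thesis
        by (simp add: power2_norm_eq_inner inner_vec_def flip: sum_distrib_left)
    qed
    have "inner x (cmul A x) = inner x (D x) + Re l * (norm x)\<^sup>2"
      by (simp add: D_def inner_diff_right lx)
    moreover have "inner x (D x) \<ge> - (norm x * norm (D x))"
      using Cauchy_Schwarz_ineq2[of x "D x"] by linarith
    \<comment> \<open>Young's inequality, weighted so that only a quarter of the decay
      \<open>k * (norm x)\<^sup>2\<close> is spent.\<close>
    moreover have "norm x * norm (D x) \<le> (k / 4) * (norm x)\<^sup>2 + (norm (D x))\<^sup>2 / k"
    proof -
      have "0 \<le> (k * norm x / 2 - norm (D x))\<^sup>2 / k" using assms(2) by simp
      also have "\<dots> = (k / 4) * (norm x)\<^sup>2 + (norm (D x))\<^sup>2 / k - norm x * norm (D x)"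
        using assms(2) by (simp add: power2_eq_square field_simps)
      finally show ?thesis by simp
    qed
    moreover have "Re l * (norm x)\<^sup>2 \<ge> k * (norm x)\<^sup>2"
      using Cons.prems by (intro mult_right_mono) auto
    moreover have "(norm (D x))\<^sup>2 / k \<le> b / k" using b1 assms(2) by (simp add: b_def divide_right_mono)
    moreover have "(k / 4) * (norm x)\<^sup>2 = (k * (norm x)\<^sup>2) / 4"
      "(k * 3 / 4) * (norm x)\<^sup>2 = 3 * (k * (norm x)\<^sup>2) / 4" by simp_all
    ultimately have i1: "inner x (cmul A x) \<ge> (k * 3 / 4) * (norm x)\<^sup>2 - b / k"
      by linarith
    have "B' x (cmul A x) = inner x (cmul A x) + c * B (D x) (cmul A (D x))"
      by (simp add: B'_def B.scaleR_left DA)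
    also have "\<dots> \<ge> (k * 3 / 4) * (norm x)\<^sup>2 - b / k + c * (\<kappa> * b)"
      using i1 b2 c0 by (intro add_mono mult_left_mono) (auto simp: b_def)
    finally have "B' x (cmul A x) \<ge> (k * 3 / 4) * (norm x)\<^sup>2 - b / k + c * (\<kappa> * b)" .
    moreover have "c * (\<kappa> * b) = 2 * (b / k)" using B(1) assms(2) by (simp add: c_def field_simps)
    moreover have "\<kappa> / 2 * (c * b) = b / k" using B(1) assms(2) by (simp add: c_def field_simps)
    moreover have "\<kappa>' * B' x x \<le> k / 2 * (norm x)\<^sup>2 + \<kappa> / 2 * (c * b)"
      unfolding e1 distrib_left \<kappa>'_def using b0 c0
      by (intro add_mono mult_right_mono) auto
    moreover have "k / 2 * (norm x)\<^sup>2 \<le> (k * 3 / 4) * (norm x)\<^sup>2"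
      using assms(2) by (intro mult_right_mono) auto
    ultimately have "\<kappa>' * B' x x \<le> B' x (cmul A x)" by linarith
    then show ?thesis using e1 b0 c0 by simp
  qed
  moreover have "\<kappa>' > 0" using B(1) assms(2) by (simp add: \<kappa>'_def)
  ultimately show ?case using bb' sym by blast
qed

lemma lyapunov_form:
  fixes A :: "real ^ 'n ^ 'n"
  assumes "\<And>l. complex_eigenvalue A l \<Longrightarrow> Re l > 0"
  shows "\<exists>B \<kappa>. \<kappa> > 0 \<and> bounded_bilinear B \<and> (\<forall>x y. B x y = B y x) \<and>
    (\<forall>x. B x x \<ge> (norm x)\<^sup>2 \<and> B x (A *v x) \<ge> \<kappa> * B x x)"
proof -
  obtain ls where ls: "\<forall>l\<in>set ls. complex_eigenvalue A l" "\<And>x. poly_act A ls x = 0"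
    using exists_eigenvalue_product_zero[of A] by blast
  \<comment> \<open>The inserted 1 keeps the minimum defined and positive when the list is
    empty.\<close>
  define k where "k = Min (insert 1 (Re ` set ls))"
  have k: "k > 0" "\<forall>l\<in>set ls. Re l \<ge> k"
    using ls assms by (auto simp: k_def)
  obtain B \<kappa> where B0: "\<kappa> > 0 \<and> bounded_bilinear B \<and> (\<forall>x y. B x y = B y x) \<and>
     (\<forall>x. poly_act A ls x = 0 \<longrightarrow> B x x \<ge> (norm x)\<^sup>2 \<and> B x (cmul A x) \<ge> \<kappa> * B x x)"
    using lyapunov_list[OF k(2,1), of A] by (elim exE) (rule that)
  have B: "\<kappa> > 0" "bounded_bilinear B" "\<And>x y. B x y = B y x"
     "\<And>x. B x x \<ge> (norm x)\<^sup>2 \<and> B x (cmul A x) \<ge> \<kappa> * B x x"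
    using B0 ls(2) by simp_all
  have nc: "norm (complexify x) = norm x" for x :: "real ^ 'n"
    by (simp add: norm_vec_def L2_set_def complexify_def)
  have "linear (complexify :: real ^ 'n \<Rightarrow> _)"
    by (rule linearI) (auto simp: complexify_def vec_eq_iff scaleR_conv_of_real[where 'a=complex])
  then have bl: "bounded_linear (complexify :: real ^ 'n \<Rightarrow> _)"
    by (simp add: linear_conv_bounded_linear)
  show ?thesis
  proof (rule exI[of _ "\<lambda>x y. B (complexify x) (complexify y)"], rule exI[of _ \<kappa>], intro conjI allI)
    show "bounded_bilinear (\<lambda>x y. B (complexify x) (complexify y))"
      by (rule bounded_bilinear.comp[OF B(2) bl bl])
    show "(norm x)\<^sup>2 \<le> B (complexify x) (complexify x)" for x using B(4)[of "complexify x"] by (simp add: nc)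
    show "B (complexify x) (complexify (A *v x)) \<ge> \<kappa> * B (complexify x) (complexify x)" for x
      using B(4)[of "complexify x"] by (simp add: cmul_complexify)
  qed (use B in auto)
qed

text \<open>The condition on \<open>\<phi>'\<close> says that \<open>\<phi>\<close> decays more slowly than any exponential, so that \<open>M \<phi>\<^sup>2\<close> is a
  supersolution of the differential inequality satisfied by the Lyapunov form.\<close>

lemma perturbed_linear_decay:
  fixes A :: "real ^ 'n ^ 'n"
  assumes "\<And>l. complex_eigenvalue A l \<Longrightarrow> Re l > 0"
  obtains \<epsilon> where "\<epsilon> > 0"
    "\<And>w w' \<phi> \<phi>' C. \<lbrakk>eventually (\<lambda>t. (w has_vector_derivative w' t) (at t)) at_top;
      eventually (\<lambda>t. (\<phi> has_real_derivative \<phi>' t) (at t)) at_top;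
      eventually (\<lambda>t. \<phi> t > 0) at_top;
      \<And>e. e > 0 \<Longrightarrow> eventually (\<lambda>t. \<bar>\<phi>' t\<bar> \<le> e * \<phi> t) at_top;
      eventually (\<lambda>t. norm (w' t + A *v w t) \<le> \<epsilon> * norm (w t) + C * \<phi> t) at_top\<rbrakk>
     \<Longrightarrow> \<exists>M. eventually (\<lambda>t. norm (w t) \<le> M * \<phi> t) at_top"
proof -
  obtain B \<kappa> where B0: "\<kappa> > 0 \<and> bounded_bilinear B \<and> (\<forall>x y. B x y = B y x) \<and>
    (\<forall>x. B x x \<ge> (norm x)\<^sup>2 \<and> B x (A *v x) \<ge> \<kappa> * B x x)"
  proof -
    have "\<exists>B \<kappa>. \<kappa> > 0 \<and> bounded_bilinear B \<and> (\<forall>x y. B x y = B y x) \<and>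
      (\<forall>x. B x x \<ge> (norm x)\<^sup>2 \<and> B x (A *v x) \<ge> \<kappa> * B x x)"
      by (rule lyapunov_form) (rule assms)
    then show thesis by (elim exE) (rule that)
  qed
  have B: "\<kappa> > 0" "bounded_bilinear B" "\<And>x y. B x y = B y x"
    "\<And>x. B x x \<ge> (norm x)\<^sup>2" "\<And>x. B x (A *v x) \<ge> \<kappa> * B x x"
    using B0 by simp_all
  interpret B: bounded_bilinear B by fact
  obtain K where K: "K > 0" "\<And>x y. norm (B x y) \<le> norm x * norm y * K"
    using B.pos_bounded by blast
  \<comment> \<open>K bounds the form, so a perturbation of size \<open>\<epsilon> * norm w\<close>
    changes \<open>B w w'\<close> by at most a quarter of
    \<open>\<kappa> * (norm w)\<^sup>2\<close>.\<close>
  define \<epsilon> where "\<epsilon> = \<kappa> / (4 * K)"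
  show ?thesis
  proof (rule that[of \<epsilon>])
    show "\<epsilon> > 0" using B(1) K(1) by (simp add: \<epsilon>_def)
    fix w w' :: "real \<Rightarrow> real ^ 'n" and \<phi> \<phi>' :: "real \<Rightarrow> real" and C :: real
    assume ev: "eventually (\<lambda>t. (w has_vector_derivative w' t) (at t)) at_top"
      "eventually (\<lambda>t. (\<phi> has_real_derivative \<phi>' t) (at t)) at_top"
      "eventually (\<lambda>t. \<phi> t > 0) at_top"
      "\<And>e. e > 0 \<Longrightarrow> eventually (\<lambda>t. \<bar>\<phi>' t\<bar> \<le> e * \<phi> t) at_top"
      "eventually (\<lambda>t. norm (w' t + A *v w t) \<le> \<epsilon> * norm (w t) + C * \<phi> t) at_top"
    define u where "u t = B (w t) (w t)" for t
    define C2 where "C2 = 2 * (K * C)\<^sup>2 / \<kappa>"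
    \<comment> \<open>At rate \<kappa> / 4 for \<phi>, its square varies at rate at most \<kappa> /
      2, which leaves half of the decay rate \<kappa> of u for absorbing the forcing.\<close>
    have "eventually (\<lambda>t. (w has_vector_derivative w' t) (at t) \<and> (\<phi> has_real_derivative \<phi>' t) (at t) \<and>
       \<phi> t > 0 \<and> \<bar>\<phi>' t\<bar> \<le> (\<kappa> / 4) * \<phi> t \<and>
       norm (w' t + A *v w t) \<le> \<epsilon> * norm (w t) + C * \<phi> t) at_top"
      by (intro eventually_conj ev(1-3) ev(4) ev(5)) (use B(1) in simp)
    then obtain T where T: "\<And>t. t \<ge> T \<Longrightarrow> (w has_vector_derivative w' t) (at t)"
      "\<And>t. t \<ge> T \<Longrightarrow> (\<phi> has_real_derivative \<phi>' t) (at t)"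
      "\<And>t. t \<ge> T \<Longrightarrow> \<phi> t > 0" "\<And>t. t \<ge> T \<Longrightarrow> \<bar>\<phi>' t\<bar> \<le> (\<kappa> / 4) * \<phi> t"
      "\<And>t. t \<ge> T \<Longrightarrow> norm (w' t + A *v w t) \<le> \<epsilon> * norm (w t) + C * \<phi> t"
      unfolding eventually_at_top_linorder by blast
    have du: "(u has_real_derivative 2 * B (w t) (w' t)) (at t)" if "t \<ge> T" for t
    proof -
      have "(u has_vector_derivative (B (w t) (w' t) + B (w' t) (w t))) (at t)"
        unfolding u_def by (rule B.has_vector_derivative[OF T(1) T(1)]) (use that in auto)
      then show ?thesis
        by (simp add: has_real_derivative_iff_has_vector_derivative B(3)[of "w' t"])
    qed
    have main: "2 * B (w t) (w' t) \<le> - \<kappa> * u t + C2 * (\<phi> t)\<^sup>2" if "t \<ge> T" for t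
    proof -
      define g where "g = w' t + A *v w t"
      define x where "x = norm (w t)"
      have "B (w t) (w' t) = B (w t) g - B (w t) (A *v w t)" by (simp add: g_def B.add_right)
      also have "\<dots> \<le> x * norm g * K - \<kappa> * u t"
        using K(2)[of "w t" g] B(5)[of "w t"] by (auto simp: u_def x_def)
      also have "x * norm g * K \<le> x * (\<epsilon> * x + C * \<phi> t) * K"
        using T(5)[OF that] K(1) by (intro mult_right_mono mult_left_mono) (auto simp: x_def g_def)
      also have "\<dots> = \<kappa> / 4 * x\<^sup>2 + x * (K * C * \<phi> t)"
        using K(1) by (simp add: \<epsilon>_def field_simps power2_eq_square)
      also have "x * (K * C * \<phi> t) \<le> \<kappa> / 4 * x\<^sup>2 + (K * C * \<phi> t)\<^sup>2 / \<kappa>"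
      proof -
        have "0 \<le> (\<kappa> * x / 2 - K * C * \<phi> t)\<^sup>2 / \<kappa>" using B(1) by simp
        also have "\<dots> = \<kappa> / 4 * x\<^sup>2 + (K * C * \<phi> t)\<^sup>2 / \<kappa> - x * (K * C * \<phi> t)"
          using B(1) by (simp add: power2_eq_square field_simps)
        finally show ?thesis by simp
      qed
      finally have "2 * B (w t) (w' t) \<le> \<kappa> * x\<^sup>2 + 2 * ((K * C * \<phi> t)\<^sup>2 / \<kappa>) - 2 * \<kappa> * u t"
        by (simp add: algebra_simps)
      also have "\<kappa> * x\<^sup>2 \<le> \<kappa> * u t" using B(4)[of "w t"] B(1) by (simp add: u_def x_def)
      finally show ?thesis by (simp add: C2_def power_mult_distrib algebra_simps)
    qed
    \<comment> \<open>The first entry makes \<open>M * (\<phi> t)\<^sup>2\<close> a supersolution,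
      the second puts it above u at the starting time T.\<close>
    define M where "M = max (2 * C2 / \<kappa>) (u T / (\<phi> T)\<^sup>2)"
    have C20: "C2 \<ge> 0" using B(1) by (simp add: C2_def)
    have M0: "M \<ge> 0" using C20 B(1) by (simp add: M_def le_max_iff_disj)
    have M1: "C2 \<le> M * (\<kappa> / 2)"
    proof -
      have "2 * C2 / \<kappa> \<le> M" by (simp add: M_def)
      then show ?thesis using B(1) by (simp add: field_simps)
    qed
    have M2: "u T \<le> M * (\<phi> T)\<^sup>2"
    proof -
      have "u T / (\<phi> T)\<^sup>2 \<le> M" by (simp add: M_def)
      then show ?thesis using T(3)[of T] by (simp add: field_simps)
    qed
    \<comment> \<open>Integrating factor: h is nonincreasing and not positive at T, so u stays below
      the supersolution.\<close>
    define h where "h t = exp (\<kappa> * t) * (u t - M * (\<phi> t)\<^sup>2)" for t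
    have hT: "h t \<le> h T" if t: "t \<ge> T" for t
    proof (rule DERIV_nonpos_imp_nonincreasing[OF t])
      fix x assume x: "T \<le> x" "x \<le> t"
      define d where "d = \<kappa> * exp (\<kappa> * x) * (u x - M * (\<phi> x)\<^sup>2) +
          (2 * B (w x) (w' x) - M * (2 * \<phi> x * \<phi>' x)) * exp (\<kappa> * x)"
      have "(h has_real_derivative d) (at x)"
      proof -
        have 1: "((\<lambda>t. exp (\<kappa> * t)) has_real_derivative \<kappa> * exp (\<kappa> * x)) (at x)"
          by (auto intro!: derivative_eq_intros)
        have 2: "((\<lambda>t. (\<phi> t)\<^sup>2) has_real_derivative 2 * \<phi> x * \<phi>' x) (at x)"
          using DERIV_power[OF T(2)[OF x(1)], of 2] by (simp add: mult_ac)
        show ?thesis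
          unfolding h_def[abs_def] d_def
          by (rule DERIV_mult[OF 1 DERIV_diff[OF du[OF x(1)] DERIV_cmult[OF 2]]])
      qed
      moreover have "d \<le> 0"
      proof -
        have ph: "\<phi> x > 0" using T(3) x by blast
        have "\<bar>\<phi>' x\<bar> * \<phi> x \<le> (\<kappa> / 4) * \<phi> x * \<phi> x"
          using T(4) x ph by (intro mult_right_mono) auto
        moreover have "- \<phi>' x * \<phi> x \<le> \<bar>\<phi>' x\<bar> * \<phi> x"
          using ph by (intro mult_right_mono) auto
        ultimately have "- (\<phi> x * \<phi>' x) \<le> (\<kappa> / 4) * (\<phi> x)\<^sup>2"
          by (simp add: power2_eq_square mult_ac)
        then have "M * (- (2 * \<phi> x * \<phi>' x)) \<le> M * ((\<kappa> / 2) * (\<phi> x)\<^sup>2)"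
          using M0 by (intro mult_left_mono) auto
        moreover have "C2 * (\<phi> x)\<^sup>2 \<le> M * (\<kappa> / 2) * (\<phi> x)\<^sup>2"
          using M1 by (intro mult_right_mono) auto
        ultimately have "\<kappa> * (u x - M * (\<phi> x)\<^sup>2) + (2 * B (w x) (w' x) - M * (2 * \<phi> x * \<phi>' x)) \<le> 0"
          using main[OF x(1)] by (simp add: algebra_simps)
        then have "exp (\<kappa> * x) * (\<kappa> * (u x - M * (\<phi> x)\<^sup>2) + (2 * B (w x) (w' x) - M * (2 * \<phi> x * \<phi>' x))) \<le> 0"
          by (simp add: mult_le_0_iff)
        then show ?thesis by (simp add: d_def algebra_simps)
      qed
      ultimately show "\<exists>y. (h has_real_derivative y) (at x) \<and> y \<le> 0" by blast
    qed
    have "norm (w t) \<le> sqrt M * \<phi> t" if "t \<ge> T" for t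
    proof -
      have "h t \<le> 0"
        using hT[OF that] M2 by (smt (verit) h_def exp_gt_zero mult_nonneg_nonpos)
      then have "u t \<le> M * (\<phi> t)\<^sup>2" by (simp add: h_def mult_le_0_iff not_le)
      then have "(norm (w t))\<^sup>2 \<le> M * (\<phi> t)\<^sup>2" using B(4)[of "w t"] by (simp add: u_def)
      then have "norm (w t) \<le> sqrt (M * (\<phi> t)\<^sup>2)" by (rule real_le_rsqrt)
      then show ?thesis using T(3)[OF that] by (simp add: real_sqrt_mult)
    qed
    then show "\<exists>M. eventually (\<lambda>t. norm (w t) \<le> M * \<phi> t) at_top"
      unfolding eventually_at_top_linorder by blast
  qed
qed

text \<open>Absence of resonance: -l lies on the imaginary axis, hence is no eigenvalue of A, and
  injectivity suffices in finite dimension. The case of interest is l =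
  \<open>\<alpha> (-1)\<close>, the frequency of an oscillating term.\<close>

lemma shifted_system_solvable:
  fixes A :: "real ^ 'n ^ 'n"
  assumes "\<And>l. complex_eigenvalue A l \<Longrightarrow> Re l > 0" "Re l = 0"
  obtains w where "cmul A w + l *s w = v"
proof -
  let ?f = "\<lambda>x. cmul A x + l *s x"
  have "inj ?f"
    unfolding linear_injective_0[OF linear_cmul_shift]
  proof (intro allI impI, rule ccontr)
    fix x assume "?f x = 0" "x \<noteq> 0"
    then have "map_matrix complex_of_real A *v x + l *s x = 0" by (simp add: cmul_def)
    then have "map_matrix complex_of_real A *v x = - (l *s x)" by (rule eq_neg_iff_add_eq_0[THEN iffD2])
    also have "\<dots> = (-l) *s x" by (rule vector_smult_lneg[symmetric])
    finally have "complex_eigenvalue A (-l)"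
      unfolding complex_eigenvalue_def using \<open>x \<noteq> 0\<close> by (intro exI[of _ x] conjI)
    then have "Re (-l) > 0" by (rule assms(1))
    then show False using assms(2) by simp
  qed
  then have "surj ?f" by (rule linear_inj_imp_surj[OF linear_cmul_shift])
  then obtain w where "v = ?f w" by (rule surjE)
  then show ?thesis using that[of w] by simp
qed

section \<open>Taylor expansion of smooth functions\<close>

definition partial :: "'n \<Rightarrow> (real ^ 'n \<Rightarrow> 'b::real_normed_vector) \<Rightarrow> real ^ 'n \<Rightarrow> 'b" where
  "partial i G x = frechet_derivative G (at x) (axis i 1)"

text \<open>The term of degree r of the Taylor polynomial, with 1 / r! spread over the recursion.
  Recursing through \<open>partial\<close> makes the derivative of a term along a ray a combination
  of terms one degree lower of the partial derivatives.\<close>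

fun taylor_term :: "nat \<Rightarrow> (real ^ 'n \<Rightarrow> 'b::real_normed_vector) \<Rightarrow> real ^ 'n \<Rightarrow> real ^ 'n \<Rightarrow> 'b" where
  "taylor_term 0 G a u = G a"
| "taylor_term (Suc r) G a u = (1 / real (Suc r)) *\<^sub>R (\<Sum>i\<in>UNIV. u $ i *\<^sub>R taylor_term r (partial i G) a u)"

lemma smooth_on_partial: "smooth_on S G \<Longrightarrow> smooth_on S (partial i G)"
  unfolding smooth_on_def partial_def[abs_def]
proof
  fix r assume "\<forall>r. Cr_on r S G"
  then have "Cr_on (Suc r) S G" by blast
  then show "Cr_on r S (\<lambda>x. frechet_derivative G (at x) (axis i 1))" by simp
qed

lemma smooth_on_continuous: "smooth_on S G \<Longrightarrow> continuous_on S G"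
  unfolding smooth_on_def by (metis Cr_on.simps(1))

lemma smooth_on_has_derivative:
  assumes "smooth_on S G" "x \<in> S"
  shows "(G has_derivative (\<lambda>u. \<Sum>i\<in>UNIV. u $ i *\<^sub>R partial i G x)) (at x)"
proof -
  have "Cr_on (Suc 0) S G" using assms(1) unfolding smooth_on_def by blast
  then have "G differentiable (at x)" using assms(2) by simp
  then have d: "(G has_derivative frechet_derivative G (at x)) (at x)"
    by (simp add: frechet_derivative_works)
  then have lin: "linear (frechet_derivative G (at x))"
    using has_derivative_bounded_linear bounded_linear.linear by blast
  have "frechet_derivative G (at x) u = (\<Sum>i\<in>UNIV. u $ i *\<^sub>R partial i G x)" for u
  proof -
    have "frechet_derivative G (at x) u = frechet_derivative G (at x) (\<Sum>i\<in>UNIV. u $ i *\<^sub>R axis i 1)"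
      using basis_expansion[of u] by (simp add: scalar_mult_eq_scaleR)
    also have "\<dots> = (\<Sum>i\<in>UNIV. u $ i *\<^sub>R partial i G x)"
      by (simp add: linear_sum[OF lin] linear_scale[OF lin] partial_def)
    finally show ?thesis .
  qed
  then have "frechet_derivative G (at x) = (\<lambda>u. \<Sum>i\<in>UNIV. u $ i *\<^sub>R partial i G x)" by (rule ext)
  then show ?thesis using d by simp
qed

lemma taylor_term_scale: "taylor_term r G a (c *\<^sub>R u) = c ^ r *\<^sub>R taylor_term r G a u"
  by (induction r arbitrary: G) (simp_all add: scaleR_sum_right mult_ac)

text \<open>Along the segment from a to a + u, the derivative of a remainder is the combination,
  with coefficients \<open>u $ i\<close>, of remainders one order lower of the partial derivatives.
  The mean value inequality therefore gains one power of \<open>norm u\<close>; the induction has to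
  run over all smooth G.\<close>

lemma taylor_remainder:
  fixes G :: "real ^ 'n \<Rightarrow> 'b::real_normed_vector"
  assumes "smooth_on S G" "cball a \<rho> \<subseteq> S"
  shows "\<exists>C. \<forall>u. norm u \<le> \<rho> \<longrightarrow>
    norm (G (a + u) - (\<Sum>r<N. taylor_term r G a u)) \<le> C * norm u ^ N"
  using assms(1)
proof (induction N arbitrary: G)
  case 0
  have "compact (G ` cball a \<rho>)"
    using smooth_on_continuous[OF 0] assms(2) continuous_on_subset compact_continuous_image compact_cball
    by blast
  then obtain C where C: "\<And>x. x \<in> cball a \<rho> \<Longrightarrow> norm (G x) \<le> C"
    using compact_imp_bounded bounded_iff by (metis imageI)
  have "norm (G (a + u)) \<le> C" if "norm u \<le> \<rho>" for u
    using C[of "a + u"] that by (simp add: dist_norm)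
  then show ?case by (intro exI[of _ C]) auto
next
  case (Suc N)
  have "\<forall>i. \<exists>C. \<forall>u. norm u \<le> \<rho> \<longrightarrow>
    norm (partial i G (a + u) - (\<Sum>r<N. taylor_term r (partial i G) a u)) \<le> C * norm u ^ N"
    using Suc.IH smooth_on_partial[OF Suc.prems] by blast
  then obtain C where C: "\<And>i u. norm u \<le> \<rho> \<Longrightarrow>
    norm (partial i G (a + u) - (\<Sum>r<N. taylor_term r (partial i G) a u)) \<le> C i * norm u ^ N"
    by metis
  have "norm (G (a + u) - (\<Sum>r<Suc N. taylor_term r G a u)) \<le> (\<Sum>i\<in>UNIV. \<bar>C i\<bar>) * norm u ^ Suc N"
    if u: "norm u \<le> \<rho>" for u
  proof -
    \<comment> \<open>The powers of \<theta> come from the homogeneity of the Taylor terms, so h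
      runs from 0 to the remainder at u.\<close>
    define h where "h \<theta> = G (a + \<theta> *\<^sub>R u) - (\<Sum>r<Suc N. \<theta> ^ r *\<^sub>R taylor_term r G a u)" for \<theta> :: real
    define h' where "h' \<theta> = (\<Sum>i\<in>UNIV. u $ i *\<^sub>R
        (partial i G (a + \<theta> *\<^sub>R u) - (\<Sum>r<N. taylor_term r (partial i G) a (\<theta> *\<^sub>R u))))" for \<theta> :: real
    have inS: "norm (\<theta> *\<^sub>R u) \<le> \<rho>" "a + \<theta> *\<^sub>R u \<in> S" if "\<theta> \<in> {0..1}" for \<theta>
    proof -
      have "\<bar>\<theta>\<bar> * norm u \<le> 1 * norm u" using that by (intro mult_right_mono) auto
      then show "norm (\<theta> *\<^sub>R u) \<le> \<rho>" using u by simp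
      then show "a + \<theta> *\<^sub>R u \<in> S" using assms(2) by (auto simp: dist_norm subset_iff)
    qed
    have der: "(h has_derivative (\<lambda>x. x *\<^sub>R h' \<theta>)) (at \<theta> within {0..1})" if th: "\<theta> \<in> {0..1}" for \<theta>
    proof -
      have g: "((\<lambda>\<theta>. G (a + \<theta> *\<^sub>R u)) has_vector_derivative
          (\<Sum>i\<in>UNIV. u $ i *\<^sub>R partial i G (a + \<theta> *\<^sub>R u))) (at \<theta> within {0..1})"
      proof -
        have "((\<lambda>\<theta>. a + \<theta> *\<^sub>R u) has_vector_derivative u) (at \<theta> within {0..1})"
          by (auto intro!: derivative_eq_intros)
        from vector_derivative_diff_chain_within[OF this
          has_derivative_at_withinI[OF smooth_on_has_derivative[OF Suc.prems inS(2)[OF th]]]]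
        show ?thesis by (simp add: o_def)
      qed
      have t: "((\<lambda>\<theta>. \<Sum>r<M. \<theta> ^ r *\<^sub>R taylor_term r G a u) has_vector_derivative
          (\<Sum>r<M. (real r * \<theta> ^ (r - 1)) *\<^sub>R taylor_term r G a u)) (at \<theta> within {0..1})" for M
        by (intro has_vector_derivative_sum derivative_eq_intros)
           (auto intro!: derivative_eq_intros simp: has_vector_derivative_def has_field_derivative_def)
      have "(\<Sum>r<Suc N. (real r * \<theta> ^ (r - 1)) *\<^sub>R taylor_term r G a u) =
          (\<Sum>r<N. \<theta> ^ r *\<^sub>R (\<Sum>i\<in>UNIV. u $ i *\<^sub>R taylor_term r (partial i G) a u))"
        by (subst sum.lessThan_Suc_shift) (auto intro!: sum.cong simp: field_simps)
      also have "\<dots> = (\<Sum>i\<in>UNIV. u $ i *\<^sub>R (\<Sum>r<N. taylor_term r (partial i G) a (\<theta> *\<^sub>R u)))"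
        by (simp add: taylor_term_scale scaleR_sum_right mult_ac, rule sum.swap)
      finally have "(\<Sum>i\<in>UNIV. u $ i *\<^sub>R partial i G (a + \<theta> *\<^sub>R u)) -
          (\<Sum>r<Suc N. (real r * \<theta> ^ (r - 1)) *\<^sub>R taylor_term r G a u) = h' \<theta>"
        by (simp add: h'_def sum_subtractf scaleR_diff_right)
      moreover have "(h has_vector_derivative ((\<Sum>i\<in>UNIV. u $ i *\<^sub>R partial i G (a + \<theta> *\<^sub>R u)) -
          (\<Sum>r<Suc N. (real r * \<theta> ^ (r - 1)) *\<^sub>R taylor_term r G a u))) (at \<theta> within {0..1})"
        unfolding h_def[abs_def] by (rule has_vector_derivative_diff[OF g t])
      ultimately show ?thesis by (simp add: has_vector_derivative_def)
    qed
    have bnd: "norm (h' \<theta>) \<le> (\<Sum>i\<in>UNIV. \<bar>C i\<bar>) * norm u ^ Suc N" if th: "\<theta> \<in> {0..1}" for \<theta>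
    proof -
      have "norm (h' \<theta>) \<le> (\<Sum>i\<in>UNIV. \<bar>u $ i\<bar> * (\<bar>C i\<bar> * norm u ^ N))"
        unfolding h'_def
      proof (rule sum_norm_le)
        fix i
        have "norm (partial i G (a + \<theta> *\<^sub>R u) - (\<Sum>r<N. taylor_term r (partial i G) a (\<theta> *\<^sub>R u)))
            \<le> C i * norm (\<theta> *\<^sub>R u) ^ N"
          by (rule C[OF inS(1)[OF th]])
        also have "\<dots> \<le> \<bar>C i\<bar> * norm (\<theta> *\<^sub>R u) ^ N" by (intro mult_right_mono) auto
        also have "\<dots> \<le> \<bar>C i\<bar> * norm u ^ N"
        proof -
          have "\<bar>\<theta>\<bar> * norm u \<le> 1 * norm u" using th by (intro mult_right_mono) auto
          then show ?thesis by (intro mult_left_mono power_mono) auto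
        qed
        finally show "norm (u $ i *\<^sub>R (partial i G (a + \<theta> *\<^sub>R u) -
          (\<Sum>r<N. taylor_term r (partial i G) a (\<theta> *\<^sub>R u)))) \<le> \<bar>u $ i\<bar> * (\<bar>C i\<bar> * norm u ^ N)"
          by (simp add: mult_left_mono)
      qed
      also have "\<dots> \<le> (\<Sum>i\<in>UNIV. norm u * (\<bar>C i\<bar> * norm u ^ N))"
        by (intro sum_mono mult_right_mono component_le_norm_cart) auto
      finally show ?thesis by (simp add: sum_distrib_left sum_distrib_right mult_ac)
    qed
    have "norm (h 1 - h 0) \<le> ((\<Sum>i\<in>UNIV. \<bar>C i\<bar>) * norm u ^ Suc N) * norm (1 - 0 :: real)"
    proof (rule differentiable_bound[of "{0..1}" h "\<lambda>\<theta> x. x *\<^sub>R h' \<theta>"])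
      show "onorm (\<lambda>x. x *\<^sub>R h' \<theta>) \<le> (\<Sum>i\<in>UNIV. \<bar>C i\<bar>) * norm u ^ Suc N" if "\<theta> \<in> {0..1}" for \<theta>
        by (rule onorm_le) (use bnd[OF that] in \<open>simp add: mult.commute mult_left_mono\<close>)
    qed (auto intro: der)
    moreover have "h 0 = 0"
      unfolding h_def by (subst sum.lessThan_Suc_shift) simp
    ultimately show ?thesis by (simp add: h_def)
  qed
  then show ?case by blast
qed

section \<open>Iterated logarithms and power sums\<close>

lemma iter_log_Suc: "j \<ge> -1 \<Longrightarrow> iter_log (j + 1) t = ln (iter_log j t)"
proof (cases "j = -1")
  case False
  assume "j \<ge> -1"
  then have "nat (j + 1) = Suc (nat j)" "j \<ge> 0" using False by auto
  then show ?thesis by (simp add: iter_log_def)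
qed (simp add: iter_log_def)

lemma iter_log_0: "iter_log 0 t = t"
  by (simp add: iter_log_def)

lemma iter_log_at_top: "filterlim (iter_log j) at_top at_top"
proof (cases "j < 0")
  case True
  then have "iter_log j = exp" by (auto simp: iter_log_def)
  then show ?thesis using exp_at_top by simp
next
  case False
  have "filterlim (ln ^^ n) at_top (at_top :: real filter)" for n
  proof (induction n)
    case 0
    show ?case by (simp add: filterlim_ident id_def)
  next
    case (Suc n)
    then show ?case using filterlim_compose[OF ln_at_top Suc] by (simp add: o_def)
  qed
  then show ?thesis using False by (simp add: iter_log_def[abs_def])
qed

lemma iter_log_ge: "eventually (\<lambda>t. iter_log j t \<ge> c) at_top"
  using iter_log_at_top[of j] unfolding filterlim_at_top by blast

lemma iter_log_pos: "eventually (\<lambda>t. iter_log j t > 0) at_top"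
  using iter_log_at_top[of j] unfolding filterlim_at_top_dense by blast

lemma iter_log_all_pos: "eventually (\<lambda>t. \<forall>j\<in>{i..k}. iter_log j t > 0) at_top"
  by (rule eventually_ball_finite) (auto intro: iter_log_pos)

text \<open>One logarithm supplies the arbitrarily small factor e; each further logarithm is
  eventually at most its argument.\<close>

lemma iter_log_le:
  assumes "0 \<le> i" "i < j" "e > 0"
  shows "eventually (\<lambda>t. iter_log j t \<le> e * iter_log i t) at_top"
proof -
  have ln_le: "eventually (\<lambda>x::real. ln x \<le> e * x) at_top" if "e > 0" for e
  proof -
    have "((\<lambda>x::real. ln x / x) \<longlongrightarrow> 0) at_top" by (rule ln_x_over_x_tendsto_0)
    then have "eventually (\<lambda>x::real. ln x / x < e) at_top" using that by (rule order_tendstoD)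
    then show ?thesis using eventually_gt_at_top[of 0]
      by eventually_elim (simp add: field_simps)
  qed
  define n where "n = nat (j - i - 1)"
  have j: "j = i + int n + 1" using assms by (simp add: n_def)
  have "eventually (\<lambda>t. iter_log (i + int n + 1) t \<le> e * iter_log i t) at_top" using assms(3)
  proof (induction n arbitrary: e)
    case 0
    have "iter_log (i + 1) t = ln (iter_log i t)" for t using assms by (intro iter_log_Suc) auto
    then show ?case
      using eventually_compose_filterlim[OF ln_le[OF 0] iter_log_at_top[of i]] by simp
  next
    case (Suc n)
    have "iter_log (i + int (Suc n) + 1) t = ln (iter_log (i + int n + 1) t)" for t
      using assms iter_log_Suc[of "i + int n + 1" t] by (simp add: algebra_simps)
    then have "eventually (\<lambda>t. iter_log (i + int (Suc n) + 1) t \<le> 1 * iter_log (i + int n + 1) t) at_top"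
      using eventually_compose_filterlim[OF ln_le[of 1] iter_log_at_top[of "i + int n + 1"]] by simp
    then show ?case using Suc.IH[OF Suc.prems] by eventually_elim simp
  qed
  then show ?thesis by (simp add: j)
qed

lemma iter_log_derivative:
  "eventually (\<lambda>t. (iter_log (int j) has_real_derivative (\<Prod>i=0..<j. 1 / iter_log (int i) t)) (at t)) at_top"
proof (induction j)
  case 0
  have "iter_log (int 0) = (\<lambda>t. t)" by (simp add: fun_eq_iff iter_log_0)
  then show ?case by (auto intro!: derivative_eq_intros)
next
  case (Suc j)
  have e: "iter_log (int (Suc j)) = (\<lambda>t. ln (iter_log (int j) t))"
    using iter_log_Suc[of "int j"] by (simp add: fun_eq_iff add.commute)
  have d: "((\<lambda>t. ln (iter_log (int j) t)) has_real_derivative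
      (\<Prod>i=0..<Suc j. 1 / iter_log (int i) t)) (at t)"
    if "(iter_log (int j) has_real_derivative (\<Prod>i=0..<j. 1 / iter_log (int i) t)) (at t)"
      "iter_log (int j) t > 0" for t
    using DERIV_chain2[OF DERIV_ln[OF that(2)] that(1)] by (simp add: divide_inverse mult.commute)
  show ?case using Suc.IH iter_log_pos[of "int j"]
    unfolding e by eventually_elim (rule d)
qed

text \<open>With \<open>L\<^sub>j\<^sub>+\<^sub>1 = ln L\<^sub>j\<close> the power \<open>z\<^sup>\<alpha>\<close> at the tuple of iterated logarithms becomes a single
  exponential, for which the laws of powers hold without any positivity condition.\<close>

definition log_power :: "(int \<Rightarrow> complex) \<Rightarrow> real \<Rightarrow> complex" where
  "log_power \<alpha> t = exp (\<Sum>j | \<alpha> j \<noteq> 0. \<alpha> j * of_real (iter_log (j + 1) t))"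

lemma tuples_supp: "\<alpha> \<in> tuples k \<Longrightarrow> {j. \<alpha> j \<noteq> 0} \<subseteq> {-1..k}"
  by (auto simp: tuples_def)

lemma tuples_mono: "k \<le> l \<Longrightarrow> tuples k \<subseteq> tuples l"
  by (auto simp: tuples_def)

lemma log_power_tuples:
  assumes "\<alpha> \<in> tuples k"
  shows "log_power \<alpha> t = exp (\<Sum>j=-1..k. \<alpha> j * of_real (iter_log (j + 1) t))"
  unfolding log_power_def
  using tuples_supp[OF assms] by (intro arg_cong[of _ _ exp] sum.mono_neutral_left) auto

lemma tuple_power_log_tuple:
  assumes "\<alpha> \<in> tuples k"
  shows "eventually (\<lambda>t. tuple_power k (log_tuple k t) \<alpha> = log_power \<alpha> t) at_top"
  using iter_log_all_pos[of "-1" k]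
proof eventually_elim
  case (elim t)
  have "tuple_power k (log_tuple k t) \<alpha> = (\<Prod>j=-1..k. exp (\<alpha> j * of_real (iter_log (j + 1) t)))"
    unfolding tuple_power_def
  proof (rule prod.cong[OF refl])
    fix j assume j: "j \<in> {-1..k}"
    then have "iter_log j t > 0" using elim by blast
    then show "complex_of_real (log_tuple k t j) powr \<alpha> j = exp (\<alpha> j * of_real (iter_log (j + 1) t))"
      using j iter_log_Suc[of j t] by (simp add: log_tuple_def powr_def Ln_of_real)
  qed
  then show ?case by (simp add: log_power_tuples[OF assms] exp_sum)
qed

lemma log_tuple_pos: "eventually (\<lambda>t. log_tuple k t \<in> pos_tuples k) at_top"
  using iter_log_all_pos[of "-1" k]
  by eventually_elim (auto simp: pos_tuples_def tuples_def log_tuple_def)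

lemma norm_log_power:
  assumes "\<alpha> \<in> tuples k"
  shows "norm (log_power \<alpha> t) = exp (\<Sum>j=-1..k. Re (\<alpha> j) * iter_log (j + 1) t)"
  by (simp add: log_power_tuples[OF assms])

text \<open>In the exponent of a power, the factor of index j contributes a multiple of the
  logarithm of index j + 1. All logarithms after the one of index j0 + 1 are of smaller order, so
  the first factor that is present decides.\<close>

lemma leading_log_dominates:
  assumes "j0 \<ge> -1" "e > 0"
  shows "eventually (\<lambda>t. \<bar>\<Sum>j=j0+1..k. a j * iter_log (j + 1) t\<bar> \<le> e * iter_log (j0 + 1) t) at_top"
proof -
  define N where "N = card {j0+1..k}"
  \<comment> \<open>The 1 added here and to M keeps both divisors positive when the range is empty
    or the coefficients vanish.\<close>
  define K where "K = real N + 1"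
  define M where "M = (\<Sum>j=j0+1..k. \<bar>a j\<bar>) + 1"
  have M: "M > 0" by (simp add: M_def sum_nonneg add_nonneg_pos)
  have aM: "\<bar>a j\<bar> \<le> M" if "j \<in> {j0+1..k}" for j
    using member_le_sum[of j "{j0+1..k}" "\<lambda>j. \<bar>a j\<bar>"] that by (simp add: M_def)
  have K: "K > 0" by (simp add: K_def add_nonneg_pos)
  have "eventually (\<lambda>t. \<forall>j\<in>{j0+1..k}. iter_log (j + 1) t \<le> (e / (M * K)) * iter_log (j0 + 1) t) at_top"
    using assms M K by (intro eventually_ball_finite ballI iter_log_le) auto
  then show ?thesis using iter_log_all_pos[of "j0+1" "k+1"] iter_log_pos[of "j0 + 1"]
  proof eventually_elim
    case (elim t)
    have "\<bar>\<Sum>j=j0+1..k. a j * iter_log (j + 1) t\<bar> \<le> (\<Sum>j=j0+1..k. \<bar>a j * iter_log (j + 1) t\<bar>)"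
      by (rule sum_abs)
    also have "\<dots> \<le> (\<Sum>j=j0+1..k. M * ((e / (M * K)) * iter_log (j0 + 1) t))"
    proof (rule sum_mono)
      fix j assume j: "j \<in> {j0+1..k}"
      then have "iter_log (j + 1) t > 0" using elim(2) by auto
      then show "\<bar>a j * iter_log (j + 1) t\<bar> \<le> M * ((e / (M * K)) * iter_log (j0 + 1) t)"
        unfolding abs_mult using j elim(1) M aM by (intro mult_mono) auto
    qed
    also have "\<dots> = (K - 1) * (e / K * iter_log (j0 + 1) t)"
      using M by (simp add: K_def N_def[symmetric] del: card_atLeastAtMost_int)
    also have "\<dots> \<le> K * (e / K * iter_log (j0 + 1) t)"
      using elim(3) K assms by (intro mult_right_mono) auto
    also have "\<dots> = e * iter_log (j0 + 1) t" using K by simp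
    finally show ?case .
  qed
qed

text \<open>At the first index where a and b differ, the exponent receives a negative multiple of a
  logarithm; half of it outweighs all later contributions.\<close>

lemma lex_less_exponential_vanishes:
  assumes "lex_less k a b"
  shows "((\<lambda>t. exp (\<Sum>j=-1..k. (a j - b j) * iter_log (j + 1) t)) \<longlongrightarrow> 0) at_top"
proof -
  obtain j0 where j0: "j0 \<in> {-1..k}" "a j0 < b j0" "\<And>i. i \<in> {-1..<j0} \<Longrightarrow> a i = b i"
    using assms unfolding lex_less_def by blast
  define d where "d = b j0 - a j0"
  have d: "d > 0" using j0 by (simp add: d_def)
  have split: "(\<Sum>j=-1..k. (a j - b j) * iter_log (j + 1) t) =
      - d * iter_log (j0 + 1) t + (\<Sum>j=j0+1..k. (a j - b j) * iter_log (j + 1) t)" for t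
  proof -
    have "(\<Sum>j=-1..k. (a j - b j) * iter_log (j + 1) t) = (\<Sum>j=j0..k. (a j - b j) * iter_log (j + 1) t)"
      using j0 by (intro sum.mono_neutral_right) auto
    also have "{j0..k} = insert j0 {j0+1..k}" using j0 by auto
    finally show ?thesis by (simp add: d_def algebra_simps)
  qed
  have "eventually (\<lambda>t. (\<Sum>j=-1..k. (a j - b j) * iter_log (j + 1) t) \<le> - (d / 2) * iter_log (j0 + 1) t) at_top"
    using leading_log_dominates[of j0 "d / 2" "\<lambda>j. a j - b j" k] j0(1) d
    by (simp add: split) (elim eventually_mono, auto simp: field_simps)
  moreover have "filterlim (\<lambda>t. - (d / 2) * iter_log (j0 + 1) t) at_bot at_top"
    using d by (intro filterlim_tendsto_neg_mult_at_bot[OF tendsto_const _ iter_log_at_top]) auto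
  ultimately have "filterlim (\<lambda>t. \<Sum>j=-1..k. (a j - b j) * iter_log (j + 1) t) at_bot at_top"
    by (rule filterlim_at_bot_mono[rotated])
  then show ?thesis by (rule filterlim_compose[OF exp_at_bot])
qed

section \<open>Linear independence of power functions on the positive orthant\<close>

lemma pos_tuples_mult:
  "z \<in> pos_tuples k \<Longrightarrow> w \<in> pos_tuples k \<Longrightarrow> (\<lambda>j. z j * w j) \<in> pos_tuples k"
  by (auto simp: pos_tuples_def tuples_def)

lemma tuple_power_mult:
  assumes "z \<in> pos_tuples k" "w \<in> pos_tuples k"
  shows "tuple_power k (\<lambda>j. z j * w j) \<alpha> = tuple_power k z \<alpha> * tuple_power k w \<alpha>"
  unfolding tuple_power_def prod.distrib[symmetric]
  by (rule prod.cong) (use assms in \<open>auto simp: pos_tuples_def less_imp_le intro!: powr_times_real\<close>)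

lemma tuple_power_nonzero: "z \<in> pos_tuples k \<Longrightarrow> tuple_power k z \<alpha> \<noteq> 0"
  by (auto simp: tuple_power_def pos_tuples_def)

lemma tuple_power_separates:
  assumes "\<alpha> \<in> tuples k" "\<beta> \<in> tuples k" "\<alpha> \<noteq> \<beta>"
  obtains w where "w \<in> pos_tuples k" "tuple_power k w \<alpha> \<noteq> tuple_power k w \<beta>"
proof -
  obtain j where j: "\<alpha> j \<noteq> \<beta> j" using assms(3) by blast
  then have jk: "j \<in> {-1..k}" using assms(1,2) unfolding tuples_def by force
  define \<delta> where "\<delta> = \<alpha> j - \<beta> j"
  \<comment> \<open>This gives \<open>\<delta> * of_real x\<close> modulus 1: nonzero, and too short
    to reach another multiple of \<open>2 * pi * \<i>\<close>.\<close>
  define x where "x = 1 / norm \<delta>"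
  have \<delta>: "\<delta> \<noteq> 0" using j by (simp add: \<delta>_def)
  define w where "w i = (if i = j then exp x else if i \<in> {-1..k} then 1 else 0)" for i
  have w: "w \<in> pos_tuples k" using jk by (auto simp: w_def pos_tuples_def tuples_def)
  have tp: "tuple_power k w \<gamma> = exp (\<gamma> j * of_real x)" for \<gamma>
  proof -
    have "tuple_power k w \<gamma> = (\<Prod>i=-1..k. if i = j then exp (\<gamma> j * of_real x) else 1)"
      unfolding tuple_power_def by (rule prod.cong) (auto simp: w_def powr_def Ln_of_real)
    then show ?thesis using jk by simp
  qed
  have "exp (\<delta> * of_real x) \<noteq> 1"
  proof
    assume "exp (\<delta> * of_real x) = 1"
    then obtain n where n: "Re (\<delta> * of_real x) = 0" "Im (\<delta> * of_real x) = of_int (2 * n) * pi"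
      unfolding exp_eq_1 by blast
    have nm: "norm (\<delta> * of_real x) = 1" using \<delta> by (simp add: x_def norm_mult norm_divide)
    then have "\<bar>of_int (2 * n) * pi\<bar> \<le> 1" using abs_Im_le_cmod[of "\<delta> * of_real x"] n by metis
    moreover have "\<bar>of_int (2 * n) * pi\<bar> > 1" if "n \<noteq> 0"
    proof -
      have "1 < 2 * pi" using pi_gt3 by linarith
      also have "\<dots> \<le> \<bar>of_int (2 * n)\<bar> * pi"
        using that by (intro mult_right_mono) auto
      finally show ?thesis by (simp add: abs_mult)
    qed
    ultimately have "n = 0" by linarith
    then have "\<delta> * of_real x = 0" using n by (simp add: complex_eq_iff)
    then have "norm (\<delta> * of_real x) = 0" by simp
    then show False using nm by linarith
  qed
  then have "tuple_power k w \<alpha> \<noteq> tuple_power k w \<beta>"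
    by (simp add: tp \<delta>_def exp_diff left_diff_distrib)
  then show ?thesis using w that by blast
qed

text \<open>Dedekind's argument for characters: powers are multiplicative on the positive tuples.
  Subtracting \<open>tuple_power k w \<beta>\<close> times the relation at z from the relation at z
  w removes \<beta>, and a w that separates \<alpha> from \<beta> keeps the coefficient of \<alpha>
  alive.\<close>

lemma tuple_powers_independent:
  assumes "finite S" "S \<subseteq> tuples k"
    "\<And>z. z \<in> pos_tuples k \<Longrightarrow> (\<Sum>\<alpha>\<in>S. d \<alpha> * tuple_power k z \<alpha>) = 0"
  shows "\<forall>\<alpha>\<in>S. d \<alpha> = 0"
  using assms
proof (induction S arbitrary: d rule: finite_induct)
  case (insert \<beta> S)
  have d0: "d \<alpha> = 0" if a: "\<alpha> \<in> S" for \<alpha>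
  proof -
    obtain w where w: "w \<in> pos_tuples k" "tuple_power k w \<alpha> \<noteq> tuple_power k w \<beta>"
      using tuple_power_separates[of \<alpha> k \<beta>] insert a by blast
    have "\<forall>\<alpha>\<in>S. d \<alpha> * (tuple_power k w \<alpha> - tuple_power k w \<beta>) = 0"
    proof (rule insert.IH)
      fix z assume z: "z \<in> pos_tuples k"
      have "(\<Sum>\<alpha>\<in>insert \<beta> S. d \<alpha> * tuple_power k (\<lambda>j. z j * w j) \<alpha>) = 0"
        by (rule insert.prems(2)[OF pos_tuples_mult[OF z w(1)]])
      moreover have "tuple_power k w \<beta> * (\<Sum>\<alpha>\<in>insert \<beta> S. d \<alpha> * tuple_power k z \<alpha>) = 0"
        using insert.prems(2)[OF z] by simp
      ultimately have "(\<Sum>\<alpha>\<in>insert \<beta> S. d \<alpha> * (tuple_power k z \<alpha> * tuple_power k w \<alpha>)) -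
         (\<Sum>\<alpha>\<in>insert \<beta> S. tuple_power k w \<beta> * (d \<alpha> * tuple_power k z \<alpha>)) = 0"
        by (simp only: tuple_power_mult[OF z w(1)] sum_distrib_left diff_self)
      then show "(\<Sum>\<alpha>\<in>S. d \<alpha> * (tuple_power k w \<alpha> - tuple_power k w \<beta>) * tuple_power k z \<alpha>) = 0"
        using insert.hyps unfolding sum_subtractf[symmetric] by (simp add: algebra_simps)
    qed (use insert.prems in auto)
    then show ?thesis using a w by auto
  qed
  obtain z :: "int \<Rightarrow> real" where z: "z \<in> pos_tuples k"
    by (rule that[of "\<lambda>i. if i \<in> {-1..k} then 1 else 0"]) (auto simp: pos_tuples_def tuples_def)
  then have "d \<beta> * tuple_power k z \<beta> = 0"
    using insert.prems(2)[OF z] insert.hyps d0 by simp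
  then show ?case using d0 tuple_power_nonzero[OF z] by auto
qed simp

text \<open>\<open>Pplus_at\<close> provides two representations that are not tied to each other:
  one exhibits the leading term, the other restricts the exponents. Independence of powers forces
  the leading exponent to occur in the second, so that it obeys the restrictions too.\<close>

lemma Pplus_at_leading_exponent:
  assumes "p \<in> Pplus_at m k"
  obtains S \<xi> \<alpha>max c q S' \<xi>' where
    "scalar_power_sum k S \<xi> p" "S \<subseteq> power_vectors m k 0" "\<forall>\<alpha>\<in>S. \<alpha> (-1) = 0"
    "\<alpha>max \<in> tuples k" "c > 0" "(\<lambda>j. complex_of_real (\<alpha>max j)) \<in> S"
    "scalar_power_sum k S' \<xi>' q" "\<forall>\<alpha>\<in>S'. lex_less k (\<lambda>j. Re (\<alpha> j)) \<alpha>max"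
    "\<forall>z\<in>pos_tuples k. complex_of_real (p z) =
       complex_of_real c * tuple_power k z (\<lambda>j. complex_of_real (\<alpha>max j)) + complex_of_real (q z)"
proof -
  obtain S \<xi> where S: "scalar_power_sum k S \<xi> p" "S \<subseteq> power_vectors m k 0" "\<forall>\<alpha>\<in>S. \<alpha> (-1) = 0"
    using assms unfolding Pplus_at_def by blast
  obtain \<alpha>max c q S' \<xi>' where M: "\<alpha>max \<in> tuples k" "c > 0"
    "scalar_power_sum k S' \<xi>' q" "\<forall>\<alpha>\<in>S'. lex_less k (\<lambda>j. Re (\<alpha> j)) \<alpha>max"
    "\<forall>z\<in>pos_tuples k. complex_of_real (p z) =
       complex_of_real c * tuple_power k z (\<lambda>j. complex_of_real (\<alpha>max j)) + complex_of_real (q z)"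
    using assms unfolding Pplus_at_def Pplus_def by blast
  define a where "a = (\<lambda>j. complex_of_real (\<alpha>max j))"
  have aS': "a \<notin> S'" using M(4) unfolding a_def lex_less_def by fastforce
  have "a \<in> S"
  proof (rule ccontr)
    assume aS: "a \<notin> S"
    \<comment> \<open>Coefficients of the difference of the two representations; at \<open>a\<close>
      only -c would remain.\<close>
    define d where "d \<alpha> = (if \<alpha> \<in> S then \<xi> \<alpha> else 0) - (if \<alpha> \<in> S' then \<xi>' \<alpha> else 0)
       - (if \<alpha> = a then of_real c else 0)" for \<alpha>
    define V where "V = insert a (S \<union> S')"
    have V: "finite V" "V \<subseteq> tuples k"
      using S(1) M(1,3) by (auto simp: V_def scalar_power_sum_def a_def tuples_def)
    have "\<forall>\<alpha>\<in>V. d \<alpha> = 0"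
    proof (rule tuple_powers_independent[OF V])
      fix z assume z: "z \<in> pos_tuples k"
      have "(\<Sum>\<alpha>\<in>V. d \<alpha> * tuple_power k z \<alpha>) =
         (\<Sum>\<alpha>\<in>V. if \<alpha> \<in> S then \<xi> \<alpha> * tuple_power k z \<alpha> else 0) -
         (\<Sum>\<alpha>\<in>V. if \<alpha> \<in> S' then \<xi>' \<alpha> * tuple_power k z \<alpha> else 0) -
         (\<Sum>\<alpha>\<in>V. if \<alpha> = a then of_real c * tuple_power k z \<alpha> else 0)"
        unfolding sum_subtractf[symmetric]
        by (rule sum.cong) (auto simp: d_def algebra_simps)
      also have "(\<Sum>\<alpha>\<in>V. if \<alpha> \<in> S then \<xi> \<alpha> * tuple_power k z \<alpha> else 0) = (\<Sum>\<alpha>\<in>S. tuple_power k z \<alpha> * \<xi> \<alpha>)"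
        using V(1) by (intro sum.mono_neutral_cong_right) (auto simp: V_def mult.commute)
      also have "(\<Sum>\<alpha>\<in>V. if \<alpha> \<in> S' then \<xi>' \<alpha> * tuple_power k z \<alpha> else 0) = (\<Sum>\<alpha>\<in>S'. tuple_power k z \<alpha> * \<xi>' \<alpha>)"
        using V(1) by (intro sum.mono_neutral_cong_right) (auto simp: V_def mult.commute)
      also have "(\<Sum>\<alpha>\<in>V. if \<alpha> = a then of_real c * tuple_power k z \<alpha> else 0) = of_real c * tuple_power k z a"
        using V(1) by (simp add: V_def)
      also have "(\<Sum>\<alpha>\<in>S. tuple_power k z \<alpha> * \<xi> \<alpha>) = of_real (p z)"
        using S(1) z by (auto simp: scalar_power_sum_def)
      also have "(\<Sum>\<alpha>\<in>S'. tuple_power k z \<alpha> * \<xi>' \<alpha>) = of_real (q z)"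
        using M(3) z by (auto simp: scalar_power_sum_def)
      also have "complex_of_real (p z) = of_real c * tuple_power k z a + of_real (q z)"
        using M(5) z by (auto simp: a_def)
      finally show "(\<Sum>\<alpha>\<in>V. d \<alpha> * tuple_power k z \<alpha>) = 0" by simp
    qed
    then have "d a = 0" by (simp add: V_def)
    then show False using aS aS' M(2) by (simp add: d_def)
  qed
  then show ?thesis using that[OF S M(1,2) _ M(3,4,5)] by (simp add: a_def)
qed

text \<open>Along the logarithms \<zeta> is \<open>exp (r t) * (c + h t)\<close> with h tending to
  0, since the other terms are lexicographically smaller. The leading exponent vanishes up to index
  m, so r contains only logarithms of index at least m + 2, all of smaller order than that of index
  m + 1.\<close>

lemma Pplus_at_log_tuple:
  assumes p: "p \<in> Pplus_at (int m) (int k)" and mk: "m \<le> k"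
  defines "\<zeta> \<equiv> \<lambda>t. p (log_tuple (int k) t)"
  shows "eventually (\<lambda>t. \<zeta> t > 0) at_top" (is ?A)
    and "e > 0 \<Longrightarrow> eventually (\<lambda>t. \<bar>ln (\<zeta> t)\<bar> \<le> e * iter_log (int m + 1) t) at_top" (is "_ \<Longrightarrow> ?B")
    and "\<exists>S \<xi>. finite S \<and> S \<subseteq> power_vectors (int m) (int k) 0 \<and> (\<forall>\<alpha>\<in>S. \<alpha> (-1) = 0) \<and>
      eventually (\<lambda>t. complex_of_real (\<zeta> t) = (\<Sum>\<alpha>\<in>S. \<xi> \<alpha> * log_power \<alpha> t)) at_top" (is ?C)
proof -
  obtain S \<xi> \<alpha>max c q S' \<xi>' where P:
    "scalar_power_sum (int k) S \<xi> p" "S \<subseteq> power_vectors (int m) (int k) 0" "\<forall>\<alpha>\<in>S. \<alpha> (-1) = 0"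
    "\<alpha>max \<in> tuples (int k)" "c > 0" "(\<lambda>j. complex_of_real (\<alpha>max j)) \<in> S"
    "scalar_power_sum (int k) S' \<xi>' q" "\<forall>\<alpha>\<in>S'. lex_less (int k) (\<lambda>j. Re (\<alpha> j)) \<alpha>max"
    "\<forall>z\<in>pos_tuples (int k). complex_of_real (p z) =
       complex_of_real c * tuple_power (int k) z (\<lambda>j. complex_of_real (\<alpha>max j)) + complex_of_real (q z)"
    by (rule Pplus_at_leading_exponent[OF p])
  have S: "finite S" "S \<subseteq> tuples (int k)" using P(1) by (auto simp: scalar_power_sum_def)
  have S': "finite S'" "S' \<subseteq> tuples (int k)" using P(7) by (auto simp: scalar_power_sum_def)
  have a0: "\<alpha>max j = 0" if "j \<in> {-1..int m}" for j
    using P(2,6) that by (force simp: power_vectors_def)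
  have cm: "(\<lambda>j. complex_of_real (\<alpha>max j)) \<in> tuples (int k)" using P(4) by (simp add: tuples_def)
  have allS: "eventually (\<lambda>t. \<forall>\<alpha>\<in>S. tuple_power (int k) (log_tuple (int k) t) \<alpha> = log_power \<alpha> t) at_top"
    using S by (intro eventually_ball_finite) (auto intro: tuple_power_log_tuple)
  have allS': "eventually (\<lambda>t. \<forall>\<alpha>\<in>S'. tuple_power (int k) (log_tuple (int k) t) \<alpha> = log_power \<alpha> t) at_top"
    using S' by (intro eventually_ball_finite) (auto intro: tuple_power_log_tuple)
  show ?C
    using allS log_tuple_pos[of "int k"]
    by (intro exI[of _ S] exI[of _ \<xi>] conjI S(1) P(2,3), eventually_elim)
       (use P(1) in \<open>auto simp: scalar_power_sum_def \<zeta>_def mult.commute intro!: sum.cong\<close>)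
  define r where "r t = (\<Sum>j=-1..int k. \<alpha>max j * iter_log (j + 1) t)" for t
  define h where "h t = q (log_tuple (int k) t) / exp (r t)" for t
  have h0: "(h \<longlongrightarrow> 0) at_top"
  proof (rule Lim_null_comparison)
    show "((\<lambda>t. \<Sum>\<alpha>\<in>S'. norm (\<xi>' \<alpha>) * exp (\<Sum>j=-1..int k. (Re (\<alpha> j) - \<alpha>max j) * iter_log (j + 1) t)) \<longlongrightarrow> 0) at_top"
      using P(8) by (intro tendsto_null_sum tendsto_mult_right_zero lex_less_exponential_vanishes) auto
    show "eventually (\<lambda>t. norm (h t) \<le>
        (\<Sum>\<alpha>\<in>S'. norm (\<xi>' \<alpha>) * exp (\<Sum>j=-1..int k. (Re (\<alpha> j) - \<alpha>max j) * iter_log (j + 1) t))) at_top"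
      using allS' log_tuple_pos[of "int k"]
    proof eventually_elim
      case (elim t)
      have "norm (q (log_tuple (int k) t)) = norm (complex_of_real (q (log_tuple (int k) t)))" by simp
      also have "complex_of_real (q (log_tuple (int k) t)) = (\<Sum>\<alpha>\<in>S'. log_power \<alpha> t * \<xi>' \<alpha>)"
        using P(7) elim by (auto simp: scalar_power_sum_def)
      also have "norm \<dots> \<le> (\<Sum>\<alpha>\<in>S'. norm (\<xi>' \<alpha>) * exp (\<Sum>j=-1..int k. Re (\<alpha> j) * iter_log (j + 1) t))"
        using S' by (intro sum_norm_le) (auto simp: norm_mult norm_log_power mult.commute)
      finally have "norm (h t) \<le> (\<Sum>\<alpha>\<in>S'. norm (\<xi>' \<alpha>) * exp (\<Sum>j=-1..int k. Re (\<alpha> j) * iter_log (j + 1) t)) / exp (r t)"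
        by (simp add: h_def divide_right_mono)
      also have "\<dots> = (\<Sum>\<alpha>\<in>S'. norm (\<xi>' \<alpha>) * exp (\<Sum>j=-1..int k. (Re (\<alpha> j) - \<alpha>max j) * iter_log (j + 1) t))"
        by (simp add: sum_divide_distrib r_def left_diff_distrib sum_subtractf exp_diff)
      finally show ?case .
    qed
  qed
  have "eventually (\<lambda>t. \<bar>h t\<bar> < c / 2) at_top"
    using h0 P(5) tendstoD[of h 0 at_top "c / 2"] by (simp add: dist_real_def)
  moreover have "eventually (\<lambda>t. \<zeta> t = exp (r t) * (c + h t)) at_top"
    using tuple_power_log_tuple[OF cm] log_tuple_pos[of "int k"]
  proof eventually_elim
    case (elim t)
    have "complex_of_real (\<zeta> t) = complex_of_real (c * exp (r t) + q (log_tuple (int k) t))"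
      using P(9) elim by (simp add: \<zeta>_def log_power_tuples[OF cm] r_def flip: exp_of_real)
    then show ?case unfolding of_real_eq_iff by (simp add: h_def field_simps)
  qed
  ultimately have bd: "eventually (\<lambda>t. \<zeta> t \<ge> c / 2 * exp (r t) \<and> \<zeta> t \<le> 2 * c * exp (r t)) at_top"
  proof eventually_elim
    case (elim t)
    have "exp (r t) * (c / 2) \<le> exp (r t) * (c + h t)" "exp (r t) * (c + h t) \<le> exp (r t) * (2 * c)"
      using elim(1) P(5) by (intro mult_left_mono; simp add: abs_less_iff)+
    then show ?case using elim(2) by (simp add: mult_ac)
  qed
  have pos: "c / 2 * exp (r t) > 0" for t using P(5) by simp
  show ?A using bd
  proof eventually_elim
    case (elim t)
    then show ?case using pos[of t] by linarith
  qed
  show ?B if e: "e > 0"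
  proof -
    define K where "K = max \<bar>ln (c / 2)\<bar> \<bar>ln (2 * c)\<bar>"
    have r: "r t = (\<Sum>j=int m + 1..int k. \<alpha>max j * iter_log (j + 1) t)" for t
      unfolding r_def using mk by (intro sum.mono_neutral_right) (auto simp: a0)
    have "eventually (\<lambda>t. \<bar>r t\<bar> \<le> e / 2 * iter_log (int m + 1) t) at_top"
      unfolding r using e by (intro leading_log_dominates) auto
    moreover have "eventually (\<lambda>t. K \<le> e / 2 * iter_log (int m + 1) t) at_top"
      using iter_log_ge[of "2 * K / e" "int m + 1"]
      by eventually_elim (use e in \<open>simp add: field_simps\<close>)
    ultimately show ?thesis using bd
    proof eventually_elim
      case (elim t)
      have "ln (c / 2 * exp (r t)) \<le> ln (\<zeta> t)" "ln (\<zeta> t) \<le> ln (2 * c * exp (r t))"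
        using elim(3) pos[of t] by (subst ln_le_cancel_iff; linarith)+
      moreover have "ln (c / 2 * exp (r t)) = ln (c / 2) + r t" "ln (2 * c * exp (r t)) = ln (2 * c) + r t"
        using P(5) by (subst ln_mult_pos; simp)+
      ultimately have "ln (c / 2) + r t \<le> ln (\<zeta> t)" "ln (\<zeta> t) \<le> ln (2 * c) + r t"
        by simp_all
      then show ?case using elim(1,2) unfolding K_def by linarith
    qed
  qed
qed

section \<open>Orders of decay and functions with a series\<close>

text \<open>For large t the derivative of \<open>iter_log (j + 1)\<close>; at j = -1 the empty
  product is the derivative 1 of \<open>iter_log 0\<close>.\<close>

definition log_weight :: "int \<Rightarrow> real \<Rightarrow> real" where
  "log_weight j t = (\<Prod>i=0..<nat (j + 1). 1 / iter_log (int i) t)"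

lemma eventually_has_vector_derivative_cong:
  fixes f g :: "real \<Rightarrow> 'a::real_normed_vector"
  assumes "eventually (\<lambda>t. f t = g t) at_top" "eventually (\<lambda>t. (f has_vector_derivative f' t) (at t)) at_top"
  shows "eventually (\<lambda>t. (g has_vector_derivative f' t) (at t)) at_top"
proof -
  obtain T where T: "\<And>t. t \<ge> T \<Longrightarrow> f t = g t" "\<And>t. t \<ge> T \<Longrightarrow> (f has_vector_derivative f' t) (at t)"
    using eventually_conj[OF assms] unfolding eventually_at_top_linorder by blast
  have "(g has_vector_derivative f' t) (at t)" if "t > T" for t
    by (rule has_vector_derivative_transform_within_open[of f _ _ "{T<..}"]) (use T that in auto)
  then show ?thesis by (rule eventually_mono[OF eventually_gt_at_top[of T]])
qed

lemma log_power_derivative: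
  assumes "\<alpha> \<in> tuples k"
  shows "eventually (\<lambda>t. (log_power \<alpha> has_vector_derivative
     log_power \<alpha> t * (\<Sum>j=-1..k. \<alpha> j * of_real (log_weight j t))) (at t)) at_top"
proof -
  have "eventually (\<lambda>t. \<forall>j\<in>{-1..k}. (iter_log (j + 1) has_real_derivative log_weight j t) (at t)) at_top"
  proof (intro eventually_ball_finite ballI)
    fix j assume "j \<in> {-1..k}"
    then have "int (nat (j + 1)) = j + 1" by simp
    then show "eventually (\<lambda>t. (iter_log (j + 1) has_real_derivative log_weight j t) (at t)) at_top"
      using iter_log_derivative[of "nat (j + 1)"] by (simp add: log_weight_def)
  qed simp
  then show ?thesis
  proof eventually_elim
    case (elim t)
    have 1: "((\<lambda>t. complex_of_real (iter_log (j + 1) t)) has_vector_derivative of_real (log_weight j t)) (at t)"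
      if "j \<in> {-1..k}" for j
      using elim that by (intro has_vector_derivative_of_real) (auto simp: has_real_derivative_iff_has_vector_derivative)
    have "((\<lambda>t. \<Sum>j=-1..k. \<alpha> j * complex_of_real (iter_log (j + 1) t)) has_vector_derivative
        (\<Sum>j=-1..k. \<alpha> j * of_real (log_weight j t))) (at t)"
      by (intro has_vector_derivative_sum has_vector_derivative_mult_right 1)
    from field_vector_diff_chain_at[OF this DERIV_exp]
    show ?case by (simp add: log_power_tuples[OF assms] o_def mult.commute fun_eq_iff[of "log_power \<alpha>"]
          log_power_tuples[OF assms, abs_def])
  qed
qed

lemma log_power_add:
  assumes "\<alpha> \<in> tuples k" "\<beta> \<in> tuples l"
  shows "log_power (\<lambda>j. \<alpha> j + \<beta> j) t = log_power \<alpha> t * log_power \<beta> t"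
proof -
  define n where "n = max k l"
  have "\<alpha> \<in> tuples n" "\<beta> \<in> tuples n"
    using assms tuples_mono[of k n] tuples_mono[of l n] by (auto simp: n_def)
  moreover from this have "(\<lambda>j. \<alpha> j + \<beta> j) \<in> tuples n"
    by (auto simp: tuples_def)
  ultimately show ?thesis
    by (simp add: log_power_tuples distrib_right sum.distrib exp_add)
qed

lemma log_power_cnj: "cnj (log_power \<alpha> t) = log_power (cnj \<circ> \<alpha>) t"
  by (simp add: log_power_def exp_cnj)

text \<open>What the calculus of orders needs to know about \<zeta>: it is slower than any power of
  L in both directions, and its derivative can be computed because it is a sum of powers without an
  exponential factor. \<delta> is the grid spacing of all series; it may not exceed 1, the order
  that differentiating a logarithmic factor is sure to gain.\<close>

locale log_scale =
  fixes m :: nat and \<zeta> :: "real \<Rightarrow> real" and \<delta> :: real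
  assumes \<zeta>_pos: "eventually (\<lambda>t. \<zeta> t > 0) at_top"
    and \<zeta>_small: "e > 0 \<Longrightarrow> eventually (\<lambda>t. \<bar>ln (\<zeta> t)\<bar> \<le> e * iter_log (int m + 1) t) at_top"
    and \<zeta>_sum: "\<exists>k S \<xi>. finite S \<and> S \<subseteq> power_vectors (int m) k 0 \<and> (\<forall>\<alpha>\<in>S. \<alpha> (-1) = 0) \<and>
      eventually (\<lambda>t. complex_of_real (\<zeta> t) = (\<Sum>\<alpha>\<in>S. \<xi> \<alpha> * log_power \<alpha> t)) at_top"
    and \<delta>_pos: "\<delta> > 0" and \<delta>_le: "\<delta> \<le> 1"
begin

abbreviation L :: "real \<Rightarrow> real" where "L \<equiv> iter_log (int m)"

lemma L_powr: "eventually (\<lambda>t. L t powr b = exp (b * iter_log (int m + 1) t)) at_top"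
  using iter_log_pos[of "int m"]
proof eventually_elim
  case (elim t)
  then show ?case using iter_log_Suc[of "int m" t] by (simp add: powr_def)
qed

text \<open>Functions that are \<open>O(L\<^sup>-\<^sup>b)\<close> for every \<open>b < a\<close>; the slack absorbs powers of the slower logarithms
  and of \<open>\<zeta>\<close>.\<close>

definition small :: "real \<Rightarrow> (real \<Rightarrow> 'b::real_normed_vector) set" where
  "small a = {g. \<forall>b<a. \<exists>C. eventually (\<lambda>t. norm (g t) \<le> C * L t powr (-b)) at_top}"

lemma smallE:
  assumes "g \<in> small a" "b < a"
  obtains C where "C > 0" "eventually (\<lambda>t. norm (g t) \<le> C * L t powr (-b)) at_top"
proof -
  obtain C where C: "eventually (\<lambda>t. norm (g t) \<le> C * L t powr (-b)) at_top"
    using assms by (auto simp: small_def)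
  have "eventually (\<lambda>t. norm (g t) \<le> (\<bar>C\<bar> + 1) * L t powr (-b)) at_top"
    using C
  proof eventually_elim
    case (elim t)
    have "C * L t powr (-b) \<le> (\<bar>C\<bar> + 1) * L t powr (-b)" by (intro mult_right_mono) auto
    then show ?case using elim by linarith
  qed
  then show ?thesis by (intro that[of "\<bar>C\<bar> + 1"]) auto
qed

lemma small_mono: "a \<le> b \<Longrightarrow> g \<in> small b \<Longrightarrow> g \<in> small a"
  by (auto simp: small_def)

lemma small_dominated:
  assumes "h \<in> small a" "eventually (\<lambda>t. norm (g t) \<le> C * norm (h t)) at_top"
  shows "g \<in> small a"
  unfolding small_def
proof (intro CollectI allI impI)
  fix b assume "b < a"
  obtain D where D: "D > 0" "eventually (\<lambda>t. norm (h t) \<le> D * L t powr (-b)) at_top"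
    using smallE[OF assms(1) \<open>b < a\<close>] .
  have "eventually (\<lambda>t. norm (g t) \<le> (\<bar>C\<bar> * D) * L t powr (-b)) at_top"
    using D(2) assms(2)
  proof eventually_elim
    case (elim t)
    have "C * norm (h t) \<le> \<bar>C\<bar> * norm (h t)" by (intro mult_right_mono) auto
    also have "\<dots> \<le> \<bar>C\<bar> * (D * L t powr (-b))" using elim by (intro mult_left_mono) auto
    finally show ?case using elim by (simp add: mult.assoc)
  qed
  then show "\<exists>C. eventually (\<lambda>t. norm (g t) \<le> C * L t powr (-b)) at_top" by blast
qed

lemma small_cong:
  assumes "h \<in> small a" "eventually (\<lambda>t. g t = h t) at_top"
  shows "g \<in> small a"
proof (rule small_dominated[OF assms(1)])
  show "eventually (\<lambda>t. norm (g t) \<le> 1 * norm (h t)) at_top"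
    using assms(2) by eventually_elim simp
qed

lemma small_zero: "(\<lambda>t. 0) \<in> small a"
  by (auto simp: small_def intro!: exI[of _ 0])

lemma small_add:
  assumes "g \<in> small a" "h \<in> small a"
  shows "(\<lambda>t. g t + h t) \<in> small a"
  unfolding small_def
proof (intro CollectI allI impI)
  fix b assume "b < a"
  obtain C where C: "C > 0" "eventually (\<lambda>t. norm (g t) \<le> C * L t powr (-b)) at_top"
    using smallE[OF assms(1) \<open>b < a\<close>] .
  obtain D where D: "D > 0" "eventually (\<lambda>t. norm (h t) \<le> D * L t powr (-b)) at_top"
    using smallE[OF assms(2) \<open>b < a\<close>] .
  have "eventually (\<lambda>t. norm (g t + h t) \<le> (C + D) * L t powr (-b)) at_top"
    using C(2) D(2)
  proof eventually_elim
    case (elim t)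
    then show ?case using norm_triangle_ineq[of "g t" "h t"] by (simp add: algebra_simps)
  qed
  then show "\<exists>C. eventually (\<lambda>t. norm (g t + h t) \<le> C * L t powr (-b)) at_top" by blast
qed

lemma small_bounded_linear:
  assumes "g \<in> small a" "bounded_linear h"
  shows "(\<lambda>t. h (g t)) \<in> small a"
proof -
  obtain K where "\<And>x. norm (h x) \<le> norm x * K" using bounded_linear.bounded[OF assms(2)] by blast
  then show ?thesis by (intro small_dominated[OF assms(1), of _ K]) (simp add: mult.commute)
qed

lemma small_minus: "g \<in> small a \<Longrightarrow> (\<lambda>t. - g t) \<in> small a"
  by (rule small_dominated[of g a _ 1]) auto

lemma small_diff: "g \<in> small a \<Longrightarrow> h \<in> small a \<Longrightarrow> (\<lambda>t. g t - h t) \<in> small a"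
  using small_add[of g a "\<lambda>t. - h t"] small_minus[of h a] by simp

lemma small_sum: "(\<And>i. i \<in> I \<Longrightarrow> g i \<in> small a) \<Longrightarrow> (\<lambda>t. \<Sum>i\<in>I. g i t) \<in> small a"
  by (induction I rule: infinite_finite_induct) (auto intro: small_zero small_add)

lemma small_bilinear:
  assumes "g \<in> small a" "h \<in> small b" "bounded_bilinear p"
  shows "(\<lambda>t. p (g t) (h t)) \<in> small (a + b)"
  unfolding small_def
proof (intro CollectI allI impI)
  fix c assume c: "c < a + b"
  define e where "e = (a + b - c) / 2"
  have e: "a - e < a" "b - e < b" "c = (a - e) + (b - e)" using c by (auto simp: e_def field_simps)
  obtain C where C: "C > 0" "eventually (\<lambda>t. norm (g t) \<le> C * L t powr (-(a - e))) at_top"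
    using smallE[OF assms(1) e(1)] .
  obtain D where D: "D > 0" "eventually (\<lambda>t. norm (h t) \<le> D * L t powr (-(b - e))) at_top"
    using smallE[OF assms(2) e(2)] .
  obtain K where K: "K > 0" "\<And>x y. norm (p x y) \<le> norm x * norm y * K"
    using bounded_bilinear.pos_bounded[OF assms(3)] by blast
  have "eventually (\<lambda>t. norm (p (g t) (h t)) \<le> (C * D * K) * L t powr (-c)) at_top"
    using C(2) D(2)
  proof eventually_elim
    case (elim t)
    have "norm (p (g t) (h t)) \<le> norm (g t) * norm (h t) * K" by (rule K)
    also have "\<dots> \<le> (C * L t powr (-(a - e))) * (D * L t powr (-(b - e))) * K"
      using elim K(1) C(1) D(1) by (intro mult_mono) auto
    also have "\<dots> = (C * D * K) * (L t powr (-(a - e)) * L t powr (-(b - e)))" by (simp add: mult_ac)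
    also have "L t powr (-(a - e)) * L t powr (-(b - e)) = L t powr (-c)"
    proof -
      have "-(a - e) + -(b - e) = -c" using e(3) by simp
      then show ?thesis unfolding powr_add[symmetric] by simp
    qed
    finally show ?case .
  qed
  then show "\<exists>C. eventually (\<lambda>t. norm (p (g t) (h t)) \<le> C * L t powr (-c)) at_top" by blast
qed

lemma small_powr:
  assumes "g \<in> small a" "\<beta> > 0"
  shows "(\<lambda>t. norm (g t) powr \<beta>) \<in> small (\<beta> * a)"
  unfolding small_def
proof (intro CollectI allI impI)
  fix b assume "b < \<beta> * a"
  then have "b / \<beta> < a" using assms(2) by (simp add: field_simps)
  then obtain C where C: "C > 0" "eventually (\<lambda>t. norm (g t) \<le> C * L t powr (-(b / \<beta>))) at_top"
    using smallE[OF assms(1)] by blast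
  have "eventually (\<lambda>t. norm (norm (g t) powr \<beta>) \<le> C powr \<beta> * L t powr (-b)) at_top"
    using C(2)
  proof eventually_elim
    case (elim t)
    have "norm (g t) powr \<beta> \<le> (C * L t powr (-(b / \<beta>))) powr \<beta>"
      using elim assms(2) by (intro powr_mono2) auto
    also have "\<dots> = C powr \<beta> * L t powr (-b)"
      using C(1) assms(2) by (simp add: powr_mult powr_powr)
    finally show ?case by simp
  qed
  then show "\<exists>C. eventually (\<lambda>t. norm (norm (g t) powr \<beta>) \<le> C * L t powr (-b)) at_top" by blast
qed

lemma small_tendsto_zero:
  assumes "g \<in> small a" "a > 0"
  shows "(g \<longlongrightarrow> 0) at_top"
proof -
  obtain C where C: "C > 0" "eventually (\<lambda>t. norm (g t) \<le> C * L t powr (-(a/2))) at_top"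
    using smallE[OF assms(1), of "a / 2"] assms(2) by auto
  have "((\<lambda>t. L t powr (-(a/2))) \<longlongrightarrow> 0) at_top"
    using assms(2) by (intro tendsto_neg_powr iter_log_at_top) auto
  then have "((\<lambda>t. C * L t powr (-(a/2))) \<longlongrightarrow> 0) at_top" by (rule tendsto_mult_right_zero)
  with C(2) show ?thesis by (rule Lim_null_comparison)
qed

text \<open>The exponent of L is bounded by an inequality so that a block may mix orders; the length
  of the tuple is left open because it may grow from block to block.\<close>

definition exps :: "real \<Rightarrow> (int \<Rightarrow> complex) set" where
  "exps a = {\<alpha>. (\<exists>k. \<alpha> \<in> tuples k) \<and> (\<forall>j\<in>{-1..<int m}. Re (\<alpha> j) = 0) \<and> Re (\<alpha> (int m)) \<le> -a}"

text \<open>The power of \<zeta> is written as an exponential so that the laws of exponents hold for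
  all t and not just where \<zeta> is positive.\<close>

definition mon :: "(int \<Rightarrow> complex) \<Rightarrow> real \<Rightarrow> real \<Rightarrow> complex" where
  "mon \<alpha> \<beta> t = log_power \<alpha> t * of_real (exp (\<beta> * ln (\<zeta> t)))"

lemma exps_mono: "a \<le> b \<Longrightarrow> exps b \<subseteq> exps a"
  by (auto simp: exps_def)

lemma exps_add: "\<alpha> \<in> exps a \<Longrightarrow> \<beta> \<in> exps b \<Longrightarrow> (\<lambda>j. \<alpha> j + \<beta> j) \<in> exps (a + b)"
proof -
  assume \<alpha>: "\<alpha> \<in> exps a" and \<beta>: "\<beta> \<in> exps b"
  obtain k l where "\<alpha> \<in> tuples k" "\<beta> \<in> tuples l" using \<alpha> \<beta> by (auto simp: exps_def)
  then have "\<alpha> \<in> tuples (max k l)" "\<beta> \<in> tuples (max k l)"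
    using tuples_mono[of k "max k l"] tuples_mono[of l "max k l"] by auto
  then have "(\<lambda>j. \<alpha> j + \<beta> j) \<in> tuples (max k l)" by (simp add: tuples_def)
  then show ?thesis using \<alpha> \<beta> by (auto simp: exps_def)
qed

lemma exps_cnj: "\<alpha> \<in> exps a \<Longrightarrow> (cnj \<circ> \<alpha>) \<in> exps a"
  by (auto simp: exps_def tuples_def)

lemma mon_mult:
  assumes "\<alpha> \<in> exps a" "\<alpha>' \<in> exps b"
  shows "mon \<alpha> \<beta> t * mon \<alpha>' \<beta>' t = mon (\<lambda>j. \<alpha> j + \<alpha>' j) (\<beta> + \<beta>') t"
proof -
  obtain k l where "\<alpha> \<in> tuples k" "\<alpha>' \<in> tuples l" using assms by (auto simp: exps_def)
  from log_power_add[OF this] show ?thesis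
    by (simp add: mon_def distrib_right exp_add mult_ac)
qed

lemma mon_cnj: "cnj (mon \<alpha> \<beta> t) = mon (cnj \<circ> \<alpha>) \<beta> t"
  by (simp add: mon_def log_power_cnj)

lemma norm_mon_le:
  assumes "\<alpha> \<in> exps a" "e > 0"
  shows "eventually (\<lambda>t. norm (mon \<alpha> \<beta> t) \<le> exp ((e - a) * iter_log (int m + 1) t)) at_top"
proof -
  obtain k where k0: "\<alpha> \<in> tuples k" using assms(1) by (auto simp: exps_def)
  \<comment> \<open>Enlarged so that index m lies in the range of summation even if the tuple is
    shorter.\<close>
  define l where "l = max k (int m)"
  have k: "\<alpha> \<in> tuples l" using k0 tuples_mono[of k l] by (auto simp: l_def)
  \<comment> \<open>Half of the slack e goes to \<zeta>, half to the logarithmic factors after L;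
    the added 1 covers \<beta> = 0.\<close>
  define d where "d = e / 2 / (\<bar>\<beta>\<bar> + 1)"
  have d: "d > 0" "\<bar>\<beta>\<bar> * d \<le> e / 2" using assms(2) by (auto simp: d_def field_simps)
  have sp: "(\<Sum>j=-1..l. Re (\<alpha> j) * iter_log (j + 1) t) = Re (\<alpha> (int m)) * iter_log (int m + 1) t +
      (\<Sum>j=int m + 1..l. Re (\<alpha> j) * iter_log (j + 1) t)" for t
  proof -
    have "(\<Sum>j=-1..l. Re (\<alpha> j) * iter_log (j + 1) t) = (\<Sum>j=int m..l. Re (\<alpha> j) * iter_log (j + 1) t)"
      using assms(1) by (intro sum.mono_neutral_right) (auto simp: exps_def)
    also have "{int m..l} = insert (int m) {int m + 1..l}" by (auto simp: l_def)
    finally show ?thesis by simp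
  qed
  have "eventually (\<lambda>t. \<bar>\<Sum>j=int m + 1..l. Re (\<alpha> j) * iter_log (j + 1) t\<bar> \<le> e / 2 * iter_log (int m + 1) t) at_top"
    using assms(2) by (intro leading_log_dominates) auto
  then show ?thesis using \<zeta>_small[OF d(1)] iter_log_pos[of "int m + 1"]
  proof eventually_elim
    case (elim t)
    have "norm (mon \<alpha> \<beta> t) = exp ((\<Sum>j=-1..l. Re (\<alpha> j) * iter_log (j + 1) t) + \<beta> * ln (\<zeta> t))"
      by (simp add: mon_def norm_mult norm_log_power[OF k] exp_add)
    also have "\<dots> \<le> exp ((e - a) * iter_log (int m + 1) t)"
    proof (subst exp_le_cancel_iff)
      have "Re (\<alpha> (int m)) * iter_log (int m + 1) t \<le> - a * iter_log (int m + 1) t"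
        using assms(1) elim(3) by (intro mult_right_mono) (auto simp: exps_def)
      moreover have "\<beta> * ln (\<zeta> t) \<le> e / 2 * iter_log (int m + 1) t"
      proof -
        have "\<beta> * ln (\<zeta> t) \<le> \<bar>\<beta>\<bar> * \<bar>ln (\<zeta> t)\<bar>" by (metis abs_ge_self abs_mult)
        also have "\<dots> \<le> \<bar>\<beta>\<bar> * (d * iter_log (int m + 1) t)" using elim by (intro mult_left_mono) auto
        also have "\<dots> \<le> e / 2 * iter_log (int m + 1) t"
          unfolding mult.assoc[symmetric] using d elim by (intro mult_right_mono) auto
        finally show ?thesis .
      qed
      ultimately have "(\<Sum>j=-1..l. Re (\<alpha> j) * iter_log (j + 1) t) + \<beta> * ln (\<zeta> t) \<le>
          - a * iter_log (int m + 1) t + e / 2 * iter_log (int m + 1) t + e / 2 * iter_log (int m + 1) t"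
        unfolding sp using elim(1) by linarith
      then show "(\<Sum>j=-1..l. Re (\<alpha> j) * iter_log (j + 1) t) + \<beta> * ln (\<zeta> t) \<le> (e - a) * iter_log (int m + 1) t"
        by (simp add: algebra_simps)
    qed
    finally show ?case .
  qed
qed

lemma mon_small:
  assumes "\<alpha> \<in> exps a"
  shows "mon \<alpha> \<beta> \<in> small a"
  unfolding small_def
proof (intro CollectI allI impI)
  fix b assume "b < a"
  then have "eventually (\<lambda>t. norm (mon \<alpha> \<beta> t) \<le> exp (((a - b) - a) * iter_log (int m + 1) t)) at_top"
    by (intro norm_mon_le assms) auto
  then have "eventually (\<lambda>t. norm (mon \<alpha> \<beta> t) \<le> 1 * L t powr (-b)) at_top"
    using L_powr[of "-b"] by eventually_elim simp
  then show "\<exists>C. eventually (\<lambda>t. norm (mon \<alpha> \<beta> t) \<le> C * L t powr (-b)) at_top" by blast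
qed


text \<open>Taking real parts in the generators builds conjugation invariance into the class and
  lets the values lie in any real vector space; complex monomials are included with the complex
  numbers as value space (\<open>mon_U\<close>).\<close>

inductive_set U :: "real \<Rightarrow> (real \<Rightarrow> 'b::real_vector) set" for a where
  gen: "\<alpha> \<in> exps a \<Longrightarrow> (\<lambda>t. Re (c * mon \<alpha> \<beta> t) *\<^sub>R v) \<in> U a"
| zero: "(\<lambda>t. 0) \<in> U a"
| add: "g \<in> U a \<Longrightarrow> h \<in> U a \<Longrightarrow> (\<lambda>t. g t + h t) \<in> U a"

lemma U_mono: "g \<in> U b \<Longrightarrow> a \<le> b \<Longrightarrow> g \<in> U a"
proof (induction rule: U.induct)
  case (gen \<alpha> c \<beta> v)
  then have "\<alpha> \<in> exps a" using exps_mono by blast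
  then show ?case by (rule U.gen)
qed (auto intro: U.zero U.add)

lemma U_linear: "g \<in> U a \<Longrightarrow> linear h \<Longrightarrow> (\<lambda>t. h (g t)) \<in> U a"
proof (induction rule: U.induct)
  case (gen \<alpha> c \<beta> v)
  then show ?case using U.gen[OF gen(1), of c \<beta> "h v"] by (simp only: linear_scale)
next
  case (add g h')
  then show ?case by (simp add: linear_add U.add)
qed (simp add: linear_0 U.zero)

lemma U_sum: "(\<And>i. i \<in> I \<Longrightarrow> g i \<in> U a) \<Longrightarrow> (\<lambda>t. \<Sum>i\<in>I. g i t) \<in> U a"
  by (induction I rule: infinite_finite_induct) (auto intro: U.zero U.add)

text \<open>Real and imaginary part of a monomial are generators, with c = 1 and c =
  \<open>- \<i>\<close>.\<close>

lemma mon_U: "\<alpha> \<in> exps a \<Longrightarrow> mon \<alpha> \<beta> \<in> U a"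
proof -
  assume "\<alpha> \<in> exps a"
  then have "(\<lambda>t. Re (1 * mon \<alpha> \<beta> t) *\<^sub>R (1::complex) + Re (- \<i> * mon \<alpha> \<beta> t) *\<^sub>R \<i>) \<in> U a"
    by (intro U.intros)
  moreover have "(\<lambda>t. Re (1 * mon \<alpha> \<beta> t) *\<^sub>R (1::complex) + Re (- \<i> * mon \<alpha> \<beta> t) *\<^sub>R \<i>) = mon \<alpha> \<beta>"
    by (auto simp: fun_eq_iff complex_eq_iff)
  ultimately show ?thesis by simp
qed

lemma U_small: "g \<in> U a \<Longrightarrow> (g :: real \<Rightarrow> 'b::real_normed_vector) \<in> small a"
proof (induction rule: U.induct)
  case (gen \<alpha> c \<beta> v)
  show ?case
  proof (rule small_dominated[OF mon_small[OF gen, of \<beta>], where C = "norm c * norm v"], intro always_eventually allI)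
    fix t
    have "\<bar>Re (c * mon \<alpha> \<beta> t)\<bar> * norm v \<le> norm (c * mon \<alpha> \<beta> t) * norm v"
      by (intro mult_right_mono abs_Re_le_cmod) auto
    then show "norm (Re (c * mon \<alpha> \<beta> t) *\<^sub>R v) \<le> norm c * norm v * norm (mon \<alpha> \<beta> t)"
      by (simp add: norm_mult mult_ac)
  qed
qed (auto intro: small_zero small_add)

text \<open>The product of Re x and Re y is half of Re (x y) + Re (x \<open>cnj y\<close>), and both
  products are again multiples of monomials since \<open>exps\<close> is closed under
  conjugation.\<close>

lemma U_bilinear:
  assumes "g \<in> U a" "h \<in> U b" "bounded_bilinear p"
  shows "(\<lambda>t. p (g t) (h t)) \<in> U (a + b)"
proof -
  interpret bounded_bilinear p by fact
  show ?thesis using assms(1)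
  proof (induction rule: U.induct)
    case (gen \<alpha> c \<beta> v)
    show ?case using assms(2)
    proof (induction rule: U.induct)
      case (gen \<alpha>' d \<beta>' w)
      note \<alpha> = \<open>\<alpha> \<in> exps a\<close> and \<alpha>' = \<open>\<alpha>' \<in> exps b\<close>
      have "(\<lambda>t. Re ((c * d / 2) * mon (\<lambda>j. \<alpha> j + \<alpha>' j) (\<beta> + \<beta>') t) *\<^sub>R p v w +
          Re ((c * cnj d / 2) * mon (\<lambda>j. \<alpha> j + (cnj \<circ> \<alpha>') j) (\<beta> + \<beta>') t) *\<^sub>R p v w) \<in> U (a + b)"
        using exps_add[OF \<alpha> \<alpha>'] exps_add[OF \<alpha> exps_cnj[OF \<alpha>']] by (intro U.intros)
      moreover have "Re ((c * d / 2) * mon (\<lambda>j. \<alpha> j + \<alpha>' j) (\<beta> + \<beta>') t) *\<^sub>R p v w +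
          Re ((c * cnj d / 2) * mon (\<lambda>j. \<alpha> j + (cnj \<circ> \<alpha>') j) (\<beta> + \<beta>') t) *\<^sub>R p v w =
          p (Re (c * mon \<alpha> \<beta> t) *\<^sub>R v) (Re (d * mon \<alpha>' \<beta>' t) *\<^sub>R w)" for t
      proof -
        have "Re (x * y / 2) + Re (x * cnj y / 2) = Re x * Re y" for x y :: complex
          by (simp add: field_simps)
        from this[of "c * mon \<alpha> \<beta> t" "d * mon \<alpha>' \<beta>' t"]
        have "Re ((c * d / 2) * (mon \<alpha> \<beta> t * mon \<alpha>' \<beta>' t)) + Re ((c * cnj d / 2) * (mon \<alpha> \<beta> t * mon (cnj \<circ> \<alpha>') \<beta>' t))
          = Re (c * mon \<alpha> \<beta> t) * Re (d * mon \<alpha>' \<beta>' t)"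
          by (simp add: mon_cnj mult_ac)
        then show ?thesis
          unfolding mon_mult[OF \<alpha> \<alpha>'] mon_mult[OF \<alpha> exps_cnj[OF \<alpha>']]
          by (simp add: scaleR_left scaleR_right flip: scaleR_add_left)
      qed
      ultimately show ?case by simp
    qed (auto intro: U.zero U.add simp: add_right zero_right)
  qed (auto intro: U.zero U.add simp: add_left zero_left)
qed

text \<open>Functions with an asymptotic series whose j-th block consists of terms of order at least \<open>a + j \<delta>\<close>.
  Such a series is not claimed to be unique; all constructions below carry one along.\<close>

definition W :: "real \<Rightarrow> (real \<Rightarrow> 'b::real_normed_vector) set" where
  "W a = {g. \<exists>G. (\<forall>j. G j \<in> U (a + real j * \<delta>)) \<and>
       (\<forall>N. (\<lambda>t. g t - (\<Sum>j<N. G j t)) \<in> small (a + real N * \<delta>))}"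

lemma W_small: "g \<in> W a \<Longrightarrow> g \<in> small a"
  unfolding W_def by (force dest: spec[of _ 0])

lemma W_U: "g \<in> U a \<Longrightarrow> g \<in> W a"
  unfolding W_def
proof (intro CollectI exI[of _ "\<lambda>j. if j = 0 then g else (\<lambda>t. 0)"] conjI allI)
  assume g: "g \<in> U a"
  show "(if j = 0 then g else (\<lambda>t. 0)) \<in> U (a + real j * \<delta>)" for j using g by (auto intro: U.intros)
  fix N :: nat
  have "(\<Sum>j<N. (if j = 0 then g else (\<lambda>t. 0)) t) = (if N = 0 then 0 else g t)" for t
    by (induction N) auto
  then have "(\<lambda>t. g t - (\<Sum>j<N. (if j = 0 then g else (\<lambda>t. 0)) t)) = (if N = 0 then g else (\<lambda>t. 0))"
    by (auto simp: fun_eq_iff)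
  then show "(\<lambda>t. g t - (\<Sum>j<N. (if j = 0 then g else (\<lambda>t. 0)) t)) \<in> small (a + real N * \<delta>)"
    using U_small[OF g] by (simp add: small_zero)
qed

lemma W_mono: "g \<in> W b \<Longrightarrow> a \<le> b \<Longrightarrow> g \<in> W a"
proof -
  assume g: "g \<in> W b" and ab: "a \<le> b"
  obtain G where G: "\<And>j. G j \<in> U (b + real j * \<delta>)"
    "\<And>N. (\<lambda>t. g t - (\<Sum>j<N. G j t)) \<in> small (b + real N * \<delta>)"
    using g unfolding W_def by blast
  have "G j \<in> U (a + real j * \<delta>)" for j using U_mono[OF G(1)[of j]] ab by simp
  moreover have "(\<lambda>t. g t - (\<Sum>j<N. G j t)) \<in> small (a + real N * \<delta>)" for N
    using small_mono[OF _ G(2)[of N]] ab by simp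
  ultimately show ?thesis unfolding W_def by blast
qed

lemma W_cong:
  assumes "h \<in> W a" "eventually (\<lambda>t. g t = h t) at_top"
  shows "g \<in> W a"
proof -
  obtain G where G: "\<And>j. G j \<in> U (a + real j * \<delta>)"
    "\<And>N. (\<lambda>t. h t - (\<Sum>j<N. G j t)) \<in> small (a + real N * \<delta>)"
    using assms(1) unfolding W_def by blast
  have "eventually (\<lambda>t. g t - (\<Sum>j<N. G j t) = h t - (\<Sum>j<N. G j t)) at_top" for N
    using assms(2) by eventually_elim simp
  then have "(\<lambda>t. g t - (\<Sum>j<N. G j t)) \<in> small (a + real N * \<delta>)" for N
    by (rule small_cong[OF G(2)])
  then show ?thesis using G(1) unfolding W_def by blast
qed

text \<open>The zero series does it. This disposes of the derivatives of the logarithms when m > 0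
  and of the remainder in the finite case of the forcing.\<close>

lemma W_negligible: "(\<And>b. g \<in> small b) \<Longrightarrow> g \<in> W a"
  unfolding W_def by (intro CollectI exI[of _ "\<lambda>_ _. 0"]) (auto intro: U.zero)

lemma W_zero: "(\<lambda>t. 0) \<in> W a"
  by (rule W_negligible) (rule small_zero)

lemma W_add:
  assumes "g \<in> W a" "h \<in> W a"
  shows "(\<lambda>t. g t + h t) \<in> W a"
proof -
  obtain G where G: "\<And>j. G j \<in> U (a + real j * \<delta>)"
    "\<And>N. (\<lambda>t. g t - (\<Sum>j<N. G j t)) \<in> small (a + real N * \<delta>)"
    using assms(1) unfolding W_def by blast
  obtain H where H: "\<And>j. H j \<in> U (a + real j * \<delta>)"
    "\<And>N. (\<lambda>t. h t - (\<Sum>j<N. H j t)) \<in> small (a + real N * \<delta>)"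
    using assms(2) unfolding W_def by blast
  show ?thesis unfolding W_def
  proof (intro CollectI exI[of _ "\<lambda>j t. G j t + H j t"] conjI allI)
    show "(\<lambda>t. G j t + H j t) \<in> U (a + real j * \<delta>)" for j by (intro U.add G H)
    show "(\<lambda>t. g t + h t - (\<Sum>j<N. G j t + H j t)) \<in> small (a + real N * \<delta>)" for N
      using small_add[OF G(2)[of N] H(2)[of N]] by (simp add: sum.distrib algebra_simps)
  qed
qed

lemma W_bounded_linear:
  assumes "g \<in> W a" "bounded_linear h"
  shows "(\<lambda>t. h (g t)) \<in> W a"
proof -
  have lin: "linear h" by (rule bounded_linear.linear[OF assms(2)])
  obtain G where G: "\<And>j. G j \<in> U (a + real j * \<delta>)"
    "\<And>N. (\<lambda>t. g t - (\<Sum>j<N. G j t)) \<in> small (a + real N * \<delta>)"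
    using assms(1) unfolding W_def by blast
  show ?thesis unfolding W_def
  proof (intro CollectI exI[of _ "\<lambda>j t. h (G j t)"] conjI allI)
    show "(\<lambda>t. h (G j t)) \<in> U (a + real j * \<delta>)" for j by (rule U_linear[OF G(1) lin])
    show "(\<lambda>t. h (g t) - (\<Sum>j<N. h (G j t))) \<in> small (a + real N * \<delta>)" for N
      using small_bounded_linear[OF G(2)[of N] assms(2)] by (simp add: linear_diff[OF lin] linear_sum[OF lin])
  qed
qed

lemma W_minus: "g \<in> W a \<Longrightarrow> (\<lambda>t. - g t) \<in> W a"
  using W_bounded_linear[OF _ bounded_linear_minus[OF bounded_linear_ident]] .

lemma W_diff: "g \<in> W a \<Longrightarrow> h \<in> W a \<Longrightarrow> (\<lambda>t. g t - h t) \<in> W a"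
  using W_add[of g a "\<lambda>t. - h t"] W_minus[of h a] by simp

lemma W_sum: "(\<And>i. i \<in> I \<Longrightarrow> g i \<in> W a) \<Longrightarrow> (\<lambda>t. \<Sum>i\<in>I. g i t) \<in> W a"
  by (induction I rule: infinite_finite_induct) (auto intro: W_zero W_add)

lemma W_leading_block:
  assumes "g \<in> W a"
  obtains G where "G \<in> U a" "(\<lambda>t. g t - G t) \<in> W (a + \<delta>)"
proof -
  obtain G where G: "\<And>j. G j \<in> U (a + real j * \<delta>)"
    "\<And>N. (\<lambda>t. g t - (\<Sum>j<N. G j t)) \<in> small (a + real N * \<delta>)"
    using assms(1) unfolding W_def by blast
  show ?thesis
  proof (rule that[of "G 0"])
    show "G 0 \<in> U a" using G(1)[of 0] by simp
    show "(\<lambda>t. g t - G 0 t) \<in> W (a + \<delta>)" unfolding W_def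
    proof (intro CollectI exI[of _ "\<lambda>j. G (Suc j)"] conjI allI)
      show "G (Suc j) \<in> U (a + \<delta> + real j * \<delta>)" for j using G(1)[of "Suc j"] by (simp add: algebra_simps)
      show "(\<lambda>t. g t - G 0 t - (\<Sum>j<N. G (Suc j) t)) \<in> small (a + \<delta> + real N * \<delta>)" for N
        using G(2)[of "Suc N"] by (simp add: sum.lessThan_Suc_shift algebra_simps del: sum.lessThan_Suc)
    qed
  qed
qed

text \<open>Block j of the series of \<open>d i\<close> has order a + (i + j) \<delta>, so the
  double series is summed along antidiagonals. The triangle i + j < N contains N - i blocks of
  \<open>d i\<close>, and the remainder after these again has order a + N \<delta>.\<close>

lemma W_series:
  assumes "\<And>N. d N \<in> W (a + real N * \<delta>)" "\<And>N. (\<lambda>t. g t - (\<Sum>i<N. d i t)) \<in> small (a + real N * \<delta>)"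
  shows "g \<in> W a"
proof -
  have "\<forall>i. \<exists>H. (\<forall>j. H j \<in> U (a + real i * \<delta> + real j * \<delta>)) \<and>
    (\<forall>N. (\<lambda>t. d i t - (\<Sum>j<N. H j t)) \<in> small (a + real i * \<delta> + real N * \<delta>))"
    using assms(1) unfolding W_def by blast
  from choice[OF this] obtain H where "\<forall>i. (\<forall>j. H i j \<in> U (a + real i * \<delta> + real j * \<delta>)) \<and>
    (\<forall>N. (\<lambda>t. d i t - (\<Sum>j<N. H i j t)) \<in> small (a + real i * \<delta> + real N * \<delta>))" ..
  then have H: "\<And>i j. H i j \<in> U (a + real i * \<delta> + real j * \<delta>)"
    "\<And>i N. (\<lambda>t. d i t - (\<Sum>j<N. H i j t)) \<in> small (a + real i * \<delta> + real N * \<delta>)"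
    by blast+
  show ?thesis unfolding W_def
  proof (intro CollectI exI[of _ "\<lambda>n t. \<Sum>i\<le>n. H i (n - i) t"] conjI allI)
    show "(\<lambda>t. \<Sum>i\<le>n. H i (n - i) t) \<in> U (a + real n * \<delta>)" for n
    proof (rule U_sum)
      fix i assume "i \<in> {..n}"
      then show "H i (n - i) \<in> U (a + real n * \<delta>)"
        using H(1)[of i "n - i"] by (simp add: of_nat_diff algebra_simps)
    qed
    fix N
    have tri: "(\<Sum>n<N. \<Sum>i\<le>n. H i (n - i) t) = (\<Sum>i<N. \<Sum>j<N - i. H i j t)" for t
    proof -
      have "(\<Sum>n<N. \<Sum>i\<le>n. H i (n - i) t) = (\<Sum>(i, j)\<in>{(i, j). i + j < N}. H i j t)"
        by (rule sum.triangle_reindex[symmetric])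
      also have "{(i, j). i + j < N} = (SIGMA i:{..<N}. {..<N - i})" by auto
      finally show ?thesis by (simp add: sum.Sigma)
    qed
    have "(\<lambda>t. (g t - (\<Sum>i<N. d i t)) + (\<Sum>i<N. d i t - (\<Sum>j<N - i. H i j t))) \<in> small (a + real N * \<delta>)"
    proof (intro small_add assms(2) small_sum)
      fix i assume "i \<in> {..<N}"
      then show "(\<lambda>t. d i t - (\<Sum>j<N - i. H i j t)) \<in> small (a + real N * \<delta>)"
        using H(2)[of i "N - i"] by (simp add: of_nat_diff algebra_simps)
    qed
    then show "(\<lambda>t. g t - (\<Sum>n<N. \<Sum>i\<le>n. H i (n - i) t)) \<in> small (a + real N * \<delta>)"
      by (simp add: tri sum_subtractf)
  qed
qed

text \<open>\<open>h N\<close> plays the part of a partial sum through block N, that is of N + 1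
  blocks; hence \<open>Suc N\<close> in the order of the remainder. Telescoping reduces this to
  \<open>W_series\<close>.\<close>

lemma W_limit:
  assumes "h 0 \<in> W a" "\<And>N. (\<lambda>t. h (Suc N) t - h N t) \<in> W (a + real (Suc N) * \<delta>)"
    "\<And>N. (\<lambda>t. g t - h N t) \<in> small (a + real (Suc N) * \<delta>)"
  shows "g \<in> W a"
proof (rule W_series[where d = "\<lambda>N. case N of 0 \<Rightarrow> h 0 | Suc n \<Rightarrow> (\<lambda>t. h (Suc n) t - h n t)"])
  let ?d = "\<lambda>N. case N of 0 \<Rightarrow> h 0 | Suc n \<Rightarrow> (\<lambda>t. h (Suc n) t - h n t)"
  show "?d N \<in> W (a + real N * \<delta>)" for N
    using assms(1,2) by (cases N) auto
  have tel: "(\<Sum>i<Suc N. ?d i t) = h N t" for N t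
    by (induction N) auto
  show "(\<lambda>t. g t - (\<Sum>i<N. ?d i t)) \<in> small (a + real N * \<delta>)" for N
  proof (cases N)
    case 0
    have "(\<lambda>t. (g t - h 0 t) + h 0 t) \<in> small a"
      using \<delta>_pos by (intro small_add W_small[OF assms(1)] small_mono[OF _ assms(3)]) auto
    then show ?thesis using 0 by simp
  next
    case (Suc n)
    then show ?thesis using assms(3)[of n] tel[of _ n] by (simp del: sum.lessThan_Suc)
  qed
qed

text \<open>\<open>W_series\<close> is applied twice: for a finite sum as first argument the series
  of h is expanded; then the series of g is expanded with h kept whole.\<close>

lemma W_bilinear:
  assumes "g \<in> W a" "h \<in> W b" "bounded_bilinear p"
  shows "(\<lambda>t. p (g t) (h t)) \<in> W (a + b)"
proof -
  interpret bounded_bilinear p by fact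
  obtain G where G: "\<And>j. G j \<in> U (a + real j * \<delta>)"
    "\<And>N. (\<lambda>t. g t - (\<Sum>j<N. G j t)) \<in> small (a + real N * \<delta>)"
    using assms(1) unfolding W_def by blast
  obtain H where H: "\<And>j. H j \<in> U (b + real j * \<delta>)"
    "\<And>N. (\<lambda>t. h t - (\<Sum>j<N. H j t)) \<in> small (b + real N * \<delta>)"
    using assms(2) unfolding W_def by blast
  have 1: "(\<lambda>t. p (u t) (h t)) \<in> W (c + b)" if u: "u \<in> U c" for u c
  proof (rule W_series[where d = "\<lambda>j t. p (u t) (H j t)"])
    show "(\<lambda>t. p (u t) (H N t)) \<in> W (c + b + real N * \<delta>)" for N
      using W_U[OF U_bilinear[OF u H(1)[of N] assms(3)]] by (simp add: add.assoc)
    show "(\<lambda>t. p (u t) (h t) - (\<Sum>j<N. p (u t) (H j t))) \<in> small (c + b + real N * \<delta>)" for N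
      using small_bilinear[OF U_small[OF u] H(2)[of N] assms(3)] by (simp add: diff_right sum_right add.assoc)
  qed
  show ?thesis
  proof (rule W_series[where d = "\<lambda>j t. p (G j t) (h t)"])
    show "(\<lambda>t. p (G N t) (h t)) \<in> W (a + b + real N * \<delta>)" for N
      using 1[OF G(1)[of N]] by (simp add: algebra_simps)
    show "(\<lambda>t. p (g t) (h t) - (\<Sum>j<N. p (G j t) (h t))) \<in> small (a + b + real N * \<delta>)" for N
      using small_bilinear[OF G(2)[of N] W_small[OF assms(2)] assms(3)] by (simp add: diff_left sum_left algebra_simps)
  qed
qed

end

section \<open>Derivatives of monomials and the homological equation\<close>

lemma log_weight_exp:
  "eventually (\<lambda>t. log_weight j t = exp (- (\<Sum>i=0..<nat (j + 1). iter_log (int i + 1) t))) at_top"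
  using iter_log_all_pos[of 0 j]
proof eventually_elim
  case (elim t)
  have "log_weight j t = (\<Prod>i=0..<nat (j + 1). exp (- iter_log (int i + 1) t))"
    unfolding log_weight_def
  proof (rule prod.cong[OF refl])
    fix i assume "i \<in> {0..<nat (j + 1)}"
    then have "iter_log (int i) t > 0" using elim by auto
    then show "1 / iter_log (int i) t = exp (- iter_log (int i + 1) t)"
      using iter_log_Suc[of "int i" t] by (simp add: exp_minus inverse_eq_divide)
  qed
  then show ?case by (simp add: exp_sum sum_negf[symmetric])
qed

lemma log_weight_minus_one: "log_weight (-1) t = 1"
  by (simp add: log_weight_def)

lemma log_power_single: "log_power (\<lambda>i. if i = j then c else 0) t = exp (c * of_real (iter_log (j + 1) t))"
proof (cases "c = 0")
  case False
  then have "{i. (if i = j then c else 0) \<noteq> 0} = {j}" by auto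
  then show ?thesis by (simp add: log_power_def)
qed (simp add: log_power_def)

context log_scale
begin

lemma small_all:
  assumes "\<And>b. \<exists>C. eventually (\<lambda>t. norm (g t) \<le> C * L t powr (-b)) at_top"
  shows "g \<in> small a"
  using assms by (auto simp: small_def)

text \<open>The weight is eventually at most 1 / t. If m = 0, then L is t and the weight is itself a
  monomial of exponent -1 in L; if m > 0, then L is a logarithm and 1 / t beats all its
  powers.\<close>

lemma log_weight_W:
  assumes "j \<ge> 0"
  shows "log_weight j \<in> W 1"
proof (cases "m = 0")
  case True
  define \<alpha> where "\<alpha> i = (if i \<in> {0..j} then -1 else 0 :: complex)" for i
  have e: "\<alpha> \<in> exps 1" unfolding exps_def using True assms by (auto simp: \<alpha>_def tuples_def intro!: exI[of _ j])
  have lp: "log_power \<alpha> t = of_real (exp (- (\<Sum>i=0..<nat (j + 1). iter_log (int i + 1) t)))" for t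
  proof -
    have "{i. \<alpha> i \<noteq> 0} = {0..j}" by (auto simp: \<alpha>_def)
    then have "log_power \<alpha> t = exp (\<Sum>i\<in>{0..j}. - of_real (iter_log (i + 1) t))"
      by (simp add: log_power_def \<alpha>_def)
    also have "(\<Sum>i\<in>{0..j}. - complex_of_real (iter_log (i + 1) t)) =
        (\<Sum>i=0..<nat (j + 1). - complex_of_real (iter_log (int i + 1) t))"
      by (rule sum.reindex_bij_witness[where i = int and j = nat]) auto
    finally show ?thesis by (simp add: sum_negf exp_of_real[symmetric])
  qed
  have "(\<lambda>t. Re (1 * mon \<alpha> 0 t) *\<^sub>R (1::real)) \<in> W 1"
    by (intro W_U U.gen e)
  then show ?thesis
  proof (rule W_cong)
    show "eventually (\<lambda>t. log_weight j t = Re (1 * mon \<alpha> 0 t) *\<^sub>R 1) at_top"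
      using log_weight_exp[of j] by eventually_elim (simp add: mon_def lp)
  qed
next
  case False
  show ?thesis
  proof (intro W_negligible small_all)
    fix b
    have "eventually (\<lambda>t. iter_log (int m + 1) t \<le> (1 / (\<bar>b\<bar> + 1)) * iter_log 1 t) at_top"
      using False by (intro iter_log_le) auto
    then have "eventually (\<lambda>t. norm (log_weight j t) \<le> 1 * L t powr (-b)) at_top"
      using log_weight_exp[of j] L_powr[of "-b"] iter_log_all_pos[of 0 "j + 1"] iter_log_pos[of "int m + 1"]
    proof eventually_elim
      case (elim t)
      have nn: "0 \<le> iter_log (int i + 1) t" if "i \<in> {0..<nat (j + 1)}" for i
      proof -
        have "int i + 1 \<in> {0..j + 1}" using that by auto
        then show ?thesis using elim(4) less_imp_le by blast
      qed
      have "iter_log (int 0 + 1) t \<le> (\<Sum>i=0..<nat (j + 1). iter_log (int i + 1) t)"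
        by (rule member_le_sum[of 0 "{0..<nat (j + 1)}" "\<lambda>i. iter_log (int i + 1) t"])
           (use nn assms in auto)
      then have "iter_log 1 t \<le> (\<Sum>i=0..<nat (j + 1). iter_log (int i + 1) t)" by simp
      moreover have "b * iter_log (int m + 1) t \<le> (\<bar>b\<bar> + 1) * iter_log (int m + 1) t"
        using elim(5) by (intro mult_right_mono) auto
      moreover have "(\<bar>b\<bar> + 1) * iter_log (int m + 1) t \<le> iter_log 1 t"
        using elim(1) by (simp add: field_simps)
      ultimately show ?case using elim(2,3) by simp
    qed
    then show "\<exists>C. eventually (\<lambda>t. norm (log_weight j t) \<le> C * L t powr (-b)) at_top"
      by blast
  qed
qed

text \<open>The logarithmic derivative of a power without the constant \<open>\<alpha> (-1)\<close>
  contributed by the exponential factor; what is left decays.\<close>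

definition drift :: "(int \<Rightarrow> complex) \<Rightarrow> int \<Rightarrow> real \<Rightarrow> complex" where
  "drift \<alpha> k t = (\<Sum>j=0..k. \<alpha> j * of_real (log_weight j t))"

lemma drift_W: "drift \<alpha> k \<in> W 1"
proof -
  have "(\<lambda>t. \<alpha> j * of_real (log_weight j t)) \<in> W 1" if "j \<in> {0..k}" for j
    by (rule W_bounded_linear[OF log_weight_W
          bounded_linear_compose[OF bounded_linear_mult_right bounded_linear_of_real]])
      (use that in simp)
  then show ?thesis unfolding drift_def[abs_def] by (rule W_sum)
qed

lemma log_power_derivative_drift:
  assumes "\<alpha> \<in> tuples k" "k \<ge> -1"
  shows "eventually (\<lambda>t. (log_power \<alpha> has_vector_derivative
     log_power \<alpha> t * (\<alpha> (-1) + drift \<alpha> k t)) (at t)) at_top"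
proof -
  have "{-1..k} = insert (-1) {0..k}" using assms(2) by auto
  then have "(\<Sum>j=-1..k. \<alpha> j * of_real (log_weight j t)) = \<alpha> (-1) + drift \<alpha> k t" for t
    by (simp add: drift_def log_weight_minus_one)
  then show ?thesis using log_power_derivative[OF assms(1)] by simp
qed

text \<open>Since \<zeta> has no exponential factor, differentiating its powers leaves only drift
  terms, and division by \<zeta> is multiplication by a monomial with \<beta> = -1.\<close>

lemma zeta_log_derivative:
  obtains z' where "eventually (\<lambda>t. (\<zeta> has_real_derivative z' t) (at t)) at_top"
    "(\<lambda>t. z' t / \<zeta> t) \<in> W 1"
proof -
  obtain k0 S \<xi> where S: "finite S" "S \<subseteq> power_vectors (int m) k0 0" "\<And>\<alpha>. \<alpha> \<in> S \<Longrightarrow> \<alpha> (-1) = 0"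
      "eventually (\<lambda>t. complex_of_real (\<zeta> t) = (\<Sum>\<alpha>\<in>S. \<xi> \<alpha> * log_power \<alpha> t)) at_top"
    using \<zeta>_sum by blast
  define k where "k = max k0 (-1)"
  have tk: "\<alpha> \<in> tuples k" if "\<alpha> \<in> S" for \<alpha>
    using S(2) that tuples_mono[of k0 k] by (auto simp: power_vectors_def k_def)
  have ex: "\<alpha> \<in> exps 0" if "\<alpha> \<in> S" for \<alpha>
    using S(2) that by (auto simp: power_vectors_def exps_def)
  define z' where "z' t = Re (\<Sum>\<alpha>\<in>S. \<xi> \<alpha> * (log_power \<alpha> t * drift \<alpha> k t))" for t
  have "eventually (\<lambda>t. \<forall>\<alpha>\<in>S. (log_power \<alpha> has_vector_derivative log_power \<alpha> t * (\<alpha> (-1) + drift \<alpha> k t)) (at t)) at_top"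
    using S(1) tk by (intro eventually_ball_finite ballI log_power_derivative_drift) (auto simp: k_def)
  then have "eventually (\<lambda>t. ((\<lambda>t. Re (\<Sum>\<alpha>\<in>S. \<xi> \<alpha> * log_power \<alpha> t)) has_vector_derivative z' t) (at t)) at_top"
  proof eventually_elim
    case (elim t)
    have "(log_power \<alpha> has_vector_derivative log_power \<alpha> t * drift \<alpha> k t) (at t)" if "\<alpha> \<in> S" for \<alpha>
      using elim that S(3)[OF that] by force
    then show ?case unfolding z'_def
      by (intro bounded_linear.has_vector_derivative[OF bounded_linear_Re] has_vector_derivative_sum
          has_vector_derivative_mult_right)
  qed
  moreover have "eventually (\<lambda>t. Re (\<Sum>\<alpha>\<in>S. \<xi> \<alpha> * log_power \<alpha> t) = \<zeta> t) at_top"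
    using S(4)
  proof eventually_elim
    case (elim t)
    then show ?case by (metis Re_complex_of_real)
  qed
  ultimately have "eventually (\<lambda>t. (\<zeta> has_vector_derivative z' t) (at t)) at_top"
    by (rule eventually_has_vector_derivative_cong[rotated])
  then have 1: "eventually (\<lambda>t. (\<zeta> has_real_derivative z' t) (at t)) at_top"
    by (simp add: has_real_derivative_iff_has_vector_derivative)
  have "(\<lambda>t. Re (\<Sum>\<alpha>\<in>S. \<xi> \<alpha> * (mon \<alpha> (-1) t * drift \<alpha> k t))) \<in> W (0 + 1)"
  proof (rule W_bounded_linear[OF _ bounded_linear_Re], rule W_sum)
    fix \<alpha> assume "\<alpha> \<in> S"
    then have "(\<lambda>t. mon \<alpha> (-1) t * drift \<alpha> k t) \<in> W (0 + 1)"
      by (intro W_bilinear[OF W_U[OF mon_U] drift_W bounded_bilinear_mult] ex)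
    then show "(\<lambda>t. \<xi> \<alpha> * (mon \<alpha> (-1) t * drift \<alpha> k t)) \<in> W (0 + 1)"
      by (rule W_bounded_linear[OF _ bounded_linear_mult_right])
  qed
  then have 2: "(\<lambda>t. z' t / \<zeta> t) \<in> W 1"
    unfolding add_0
  proof (rule W_cong)
    show "eventually (\<lambda>t. z' t / \<zeta> t = Re (\<Sum>\<alpha>\<in>S. \<xi> \<alpha> * (mon \<alpha> (-1) t * drift \<alpha> k t))) at_top"
      using \<zeta>_pos
    proof eventually_elim
      case (elim t)
      then have "exp (- 1 * ln (\<zeta> t)) = 1 / \<zeta> t" by (simp add: exp_minus inverse_eq_divide)
      then have "\<xi> \<alpha> * (mon \<alpha> (-1) t * drift \<alpha> k t) = (\<xi> \<alpha> * (log_power \<alpha> t * drift \<alpha> k t)) / of_real (\<zeta> t)" for \<alpha>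
        by (simp add: mon_def mult_ac)
      then show ?case by (simp add: z'_def flip: sum_divide_distrib)
    qed
  qed
  show ?thesis using that[OF 1 2] .
qed

lemma mon_derivative:
  assumes "\<alpha> \<in> exps a"
  obtains \<rho> where "\<rho> \<in> W 1" "eventually (\<lambda>t. (mon \<alpha> \<beta> has_vector_derivative
     mon \<alpha> \<beta> t * (\<alpha> (-1) + \<rho> t)) (at t)) at_top"
proof -
  obtain z' where z': "eventually (\<lambda>t. (\<zeta> has_real_derivative z' t) (at t)) at_top"
    "(\<lambda>t. z' t / \<zeta> t) \<in> W 1" using zeta_log_derivative .
  obtain k0 where "\<alpha> \<in> tuples k0" using assms by (auto simp: exps_def)
  then have k: "\<alpha> \<in> tuples (max k0 (-1))" using tuples_mono[of k0 "max k0 (-1)"] by auto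
  define \<rho> where "\<rho> t = drift \<alpha> (max k0 (-1)) t + of_real (\<beta> * (z' t / \<zeta> t))" for t
  show ?thesis
  proof (rule that[of \<rho>])
    have "(\<lambda>t. complex_of_real (\<beta> * (z' t / \<zeta> t))) \<in> W 1"
      by (rule W_bounded_linear[OF z'(2) bounded_linear_compose[OF bounded_linear_of_real bounded_linear_mult_right]])
    then show "\<rho> \<in> W 1" unfolding \<rho>_def[abs_def] by (rule W_add[OF drift_W])
    have "max k0 (-1) \<ge> -1" by simp
    from log_power_derivative_drift[OF k this] z'(1) \<zeta>_pos
    show "eventually (\<lambda>t. (mon \<alpha> \<beta> has_vector_derivative mon \<alpha> \<beta> t * (\<alpha> (-1) + \<rho> t)) (at t)) at_top"
    proof eventually_elim
      case (elim t)
      have "((\<lambda>t. exp (\<beta> * ln (\<zeta> t))) has_real_derivative exp (\<beta> * ln (\<zeta> t)) * (\<beta> * (z' t / \<zeta> t))) (at t)"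
        using elim(2,3) by (auto intro!: derivative_eq_intros simp: field_simps)
      then have "((\<lambda>t. complex_of_real (exp (\<beta> * ln (\<zeta> t)))) has_vector_derivative
          of_real (exp (\<beta> * ln (\<zeta> t)) * (\<beta> * (z' t / \<zeta> t)))) (at t)"
        by (intro has_vector_derivative_of_real) (simp add: has_real_derivative_iff_has_vector_derivative)
      from has_vector_derivative_mult[OF elim(1) this]
      show ?case unfolding mon_def[abs_def] \<rho>_def by (simp add: algebra_simps)
    qed
  qed
qed

lemma homological_equation_mod:
  fixes A :: "real ^ 'n ^ 'n"
  assumes A: "\<And>l. complex_eigenvalue A l \<Longrightarrow> Re l > 0" and G: "G \<in> U a"
  shows "\<exists>Q Q'. Q \<in> U a \<and> eventually (\<lambda>t. (Q has_vector_derivative Q' t) (at t)) at_top \<and>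
    (\<lambda>t. Q' t + A *v Q t + G t) \<in> W (a + \<delta>)"
  using G
proof (induction rule: U.induct)
  case (gen \<alpha> c \<beta> v)
  have "Re (\<alpha> (-1)) = 0" using gen by (auto simp: exps_def)
  then obtain w where w: "cmul A w + \<alpha> (-1) *s w = (-c) *s complexify v"
    by (rule shifted_system_solvable[OF A, rotated]) 
  obtain \<rho> where \<rho>: "\<rho> \<in> W 1" "eventually (\<lambda>t. (mon \<alpha> \<beta> has_vector_derivative
     mon \<alpha> \<beta> t * (\<alpha> (-1) + \<rho> t)) (at t)) at_top"
    using mon_derivative[OF gen] .
  \<comment> \<open>A is real and commutes with taking real parts, so the complex amplitude w yields
    a real correction.\<close>
  define \<psi> where "\<psi> x = (\<chi> i. Re (x * w $ i))" for x :: complex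
  have "linear \<psi>" by (rule linearI) (auto simp: \<psi>_def vec_eq_iff algebra_simps)
  then have bl: "bounded_linear \<psi>" by (simp add: linear_conv_bounded_linear)
  show ?case
  proof (intro exI conjI)
    show "(\<lambda>t. \<psi> (mon \<alpha> \<beta> t)) \<in> U a" by (rule U_linear[OF mon_U[OF gen] \<open>linear \<psi>\<close>])
    show "eventually (\<lambda>t. ((\<lambda>t. \<psi> (mon \<alpha> \<beta> t)) has_vector_derivative \<psi> (mon \<alpha> \<beta> t * (\<alpha> (-1) + \<rho> t))) (at t)) at_top"
      using \<rho>(2) by eventually_elim (rule bounded_linear.has_vector_derivative[OF bl])
    \<comment> \<open>The decaying part \<rho> of the logarithmic derivative is all that the choice
      of w leaves over.\<close>
    have "(\<lambda>t. mon \<alpha> \<beta> t * \<rho> t) \<in> W (a + 1)"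
      by (rule W_bilinear[OF W_U[OF mon_U[OF gen]] \<rho>(1) bounded_bilinear_mult])
    then have "(\<lambda>t. \<psi> (mon \<alpha> \<beta> t * \<rho> t)) \<in> W (a + 1)" by (rule W_bounded_linear[OF _ bl])
    then have "(\<lambda>t. \<psi> (mon \<alpha> \<beta> t * \<rho> t)) \<in> W (a + \<delta>)" by (rule W_mono) (use \<delta>_le in simp)
    moreover have "\<psi> (mon \<alpha> \<beta> t * (\<alpha> (-1) + \<rho> t)) + A *v \<psi> (mon \<alpha> \<beta> t) + Re (c * mon \<alpha> \<beta> t) *\<^sub>R v
      = \<psi> (mon \<alpha> \<beta> t * \<rho> t)" for t
    proof -
      define x where "x = mon \<alpha> \<beta> t"
      have "(\<psi> (x * (\<alpha> (-1) + \<rho> t)) + A *v \<psi> x + Re (c * x) *\<^sub>R v) $ i = \<psi> (x * \<rho> t) $ i" for i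
      proof -
        have 1: "(A *v \<psi> x) $ i = Re (x * cmul A w $ i)"
          by (simp add: \<psi>_def matrix_vector_mult_def cmul_def map_matrix_def sum_distrib_left
              sum_subtractf[symmetric] algebra_simps)
        have 2: "cmul A w $ i = - c * of_real (v $ i) - \<alpha> (-1) * w $ i"
          using arg_cong[OF w, of "\<lambda>u. u $ i"] by (simp add: complexify_def eq_diff_eq)
        have "(\<psi> (x * (\<alpha> (-1) + \<rho> t)) + A *v \<psi> x + Re (c * x) *\<^sub>R v) $ i =
            Re (x * (\<alpha> (-1) + \<rho> t) * w $ i) + Re (x * cmul A w $ i) + Re (c * x * of_real (v $ i))"
          by (simp only: vector_add_component 1) (simp add: \<psi>_def)
        also have "\<dots> = Re (x * (\<alpha> (-1) + \<rho> t) * w $ i + x * cmul A w $ i + c * x * of_real (v $ i))"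
          by simp
        also have "x * (\<alpha> (-1) + \<rho> t) * w $ i + x * cmul A w $ i + c * x * of_real (v $ i) = x * \<rho> t * w $ i"
          unfolding 2 by (simp add: algebra_simps)
        finally show ?thesis by (simp add: \<psi>_def)
      qed
      then show ?thesis unfolding x_def[symmetric] by (simp add: vec_eq_iff)
    qed
    ultimately show "(\<lambda>t. \<psi> (mon \<alpha> \<beta> t * (\<alpha> (-1) + \<rho> t)) + A *v \<psi> (mon \<alpha> \<beta> t) + Re (c * mon \<alpha> \<beta> t) *\<^sub>R v) \<in> W (a + \<delta>)"
      by simp
  qed
next
  case zero
  show ?case by (intro exI[of _ "\<lambda>t. 0"] conjI) (auto intro: U.zero W_zero)
next
  case (add g h)
  obtain Q Q' where Q: "Q \<in> U a" "eventually (\<lambda>t. (Q has_vector_derivative Q' t) (at t)) at_top"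
    "(\<lambda>t. Q' t + A *v Q t + g t) \<in> W (a + \<delta>)" using add.IH(1) by blast
  obtain R R' where R: "R \<in> U a" "eventually (\<lambda>t. (R has_vector_derivative R' t) (at t)) at_top"
    "(\<lambda>t. R' t + A *v R t + h t) \<in> W (a + \<delta>)" using add.IH(2) by blast
  show ?case
  proof (intro exI conjI)
    show "(\<lambda>t. Q t + R t) \<in> U a" by (rule U.add[OF Q(1) R(1)])
    show "eventually (\<lambda>t. ((\<lambda>t. Q t + R t) has_vector_derivative Q' t + R' t) (at t)) at_top"
      using Q(2) R(2) by eventually_elim (rule has_vector_derivative_add)
    show "(\<lambda>t. Q' t + R' t + A *v (Q t + R t) + (g t + h t)) \<in> W (a + \<delta>)"
      using W_add[OF Q(3) R(3)] by (simp add: matrix_vector_right_distrib algebra_simps)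
  qed
qed

section \<open>Smooth functions of functions with a series\<close>

lemma taylor_term_W:
  fixes \<Phi> :: "real ^ 'n \<Rightarrow> real ^ 'k"
  assumes "u \<in> W \<delta>"
  shows "(\<lambda>t. taylor_term r \<Phi> a (u t)) \<in> W (real r * \<delta>)"
proof (induction r arbitrary: \<Phi>)
  case 0
  have e: "(\<lambda>_. 0) \<in> exps 0" by (auto simp: exps_def tuples_def)
  have "(\<lambda>t. Re (1 * mon (\<lambda>_. 0) 0 t) *\<^sub>R \<Phi> a) \<in> W 0" by (intro W_U U.gen e)
  then show ?case by (simp add: mon_def log_power_def)
next
  case (Suc r)
  have "(\<lambda>t. u t $ i *\<^sub>R taylor_term r (partial i \<Phi>) a (u t)) \<in> W (\<delta> + real r * \<delta>)" for i
    by (rule W_bilinear[OF W_bounded_linear[OF assms bounded_linear_vec_nth] Suc bounded_bilinear_scaleR])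
  then have "(\<lambda>t. \<Sum>i\<in>UNIV. u t $ i *\<^sub>R taylor_term r (partial i \<Phi>) a (u t)) \<in> W (\<delta> + real r * \<delta>)"
    by (rule W_sum)
  then have "(\<lambda>t. (1 / real (Suc r)) *\<^sub>R (\<Sum>i\<in>UNIV. u t $ i *\<^sub>R taylor_term r (partial i \<Phi>) a (u t))) \<in> W (\<delta> + real r * \<delta>)"
    by (rule W_bounded_linear[OF _ bounded_linear_scaleR_right])
  then show ?case by (simp add: algebra_simps)
qed

text \<open>The difference of a form of degree r + 1 at u + v and at u has in each of its terms a
  factor v and r further factors of order at least \<delta>. Degree 0 is constant and has no such
  factor, hence \<open>Suc r\<close>.\<close>

lemma taylor_term_diff_W:
  fixes \<Phi> :: "real ^ 'n \<Rightarrow> real ^ 'k"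
  assumes u: "u \<in> W \<delta>" and v: "v \<in> W (real p * \<delta>)" and p: "p \<ge> 1"
  shows "(\<lambda>t. taylor_term (Suc r) \<Phi> a (u t + v t) - taylor_term (Suc r) \<Phi> a (u t)) \<in> W (real (p + r) * \<delta>)"
proof (induction r arbitrary: \<Phi>)
  have uv: "(\<lambda>t. u t + v t) \<in> W \<delta>"
    using p \<delta>_pos by (intro W_add[OF u] W_mono[OF v]) simp
  have split: "taylor_term (Suc r) \<Phi> a (u t + v t) - taylor_term (Suc r) \<Phi> a (u t) =
     (1 / real (Suc r)) *\<^sub>R (\<Sum>i\<in>UNIV.
        (u t + v t) $ i *\<^sub>R (taylor_term r (partial i \<Phi>) a (u t + v t) - taylor_term r (partial i \<Phi>) a (u t))
        + v t $ i *\<^sub>R taylor_term r (partial i \<Phi>) a (u t))" for r t and \<Phi> :: "real ^ 'n \<Rightarrow> real ^ 'k"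
    by (simp add: scaleR_diff_right[symmetric] sum_subtractf[symmetric] algebra_simps)
  have second: "(\<lambda>t. v t $ i *\<^sub>R taylor_term r (partial i \<Phi>) a (u t)) \<in> W (real (p + r) * \<delta>)" for i r and \<Phi> :: "real ^ 'n \<Rightarrow> real ^ 'k"
  proof -
    have "(\<lambda>t. v t $ i *\<^sub>R taylor_term r (partial i \<Phi>) a (u t)) \<in> W (real p * \<delta> + real r * \<delta>)"
      by (rule W_bilinear[OF W_bounded_linear[OF v bounded_linear_vec_nth] taylor_term_W[OF u] bounded_bilinear_scaleR])
    then show ?thesis by (simp add: distrib_right)
  qed
  {
    case 0
    show ?case unfolding split
      by (intro W_bounded_linear[OF _ bounded_linear_scaleR_right] W_sum)
         (use second[of _ 0] in simp)
  next
    case (Suc r)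
    have "(\<lambda>t. (u t + v t) $ i *\<^sub>R (taylor_term (Suc r) (partial i \<Phi>) a (u t + v t) -
        taylor_term (Suc r) (partial i \<Phi>) a (u t))) \<in> W (real (p + Suc r) * \<delta>)" for i
      using W_bilinear[OF W_bounded_linear[OF uv bounded_linear_vec_nth] Suc bounded_bilinear_scaleR]
      by (simp only: of_nat_Suc of_nat_add distrib_right mult_1 add_ac)
    then show ?case unfolding split[of "Suc r"]
      by (intro W_bounded_linear[OF _ bounded_linear_scaleR_right] W_sum W_add second)
  }
qed

text \<open>Taylor expansion at \<open>a\<close> of both terms; the degree-0 terms cancel and every further one contains a
  factor \<open>v\<close>.\<close>

lemma smooth_difference_W:
  fixes \<Phi> :: "real ^ 'n \<Rightarrow> real ^ 'k"
  assumes \<Phi>: "smooth_on S \<Phi>" "cball a \<rho> \<subseteq> S" "\<rho> > 0"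
    and u: "u \<in> W \<delta>" and v: "v \<in> W (real p * \<delta>)" and p: "p \<ge> 1"
  shows "(\<lambda>t. \<Phi> (a + u t + v t) - \<Phi> (a + u t)) \<in> W (real p * \<delta>)"
\<comment> \<open>Expanding to degree N + p makes the Taylor remainders at both points, of order (N
  + p + 1) \<delta>, match the required order p \<delta> + (N + 1) \<delta>.\<close>
proof (rule W_limit[where h = "\<lambda>N t. \<Sum>r<Suc (N + p). taylor_term r \<Phi> a (u t + v t) - taylor_term r \<Phi> a (u t)"])
  let ?\<Delta> = "\<lambda>r t. taylor_term r \<Phi> a (u t + v t) - taylor_term r \<Phi> a (u t)"
  have uv: "(\<lambda>t. u t + v t) \<in> W \<delta>"
    using p \<delta>_pos by (intro W_add[OF u] W_mono[OF v]) simp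
  have \<Delta>: "?\<Delta> r \<in> W (real p * \<delta>)" for r
  proof (cases r)
    case (Suc q)
    show ?thesis unfolding Suc
      by (rule W_mono[OF taylor_term_diff_W[OF u v p]]) (use \<delta>_pos in \<open>simp add: mult_right_mono\<close>)
  qed (simp add: W_zero)
  show "(\<lambda>t. \<Sum>r<Suc (0 + p). ?\<Delta> r t) \<in> W (real p * \<delta>)" by (intro W_sum \<Delta>)
  show "(\<lambda>t. (\<Sum>r<Suc (Suc N + p). ?\<Delta> r t) - (\<Sum>r<Suc (N + p). ?\<Delta> r t)) \<in> W (real p * \<delta> + real (Suc N) * \<delta>)" for N
  proof -
    have "?\<Delta> (Suc (N + p)) \<in> W (real p * \<delta> + real (Suc N) * \<delta>)"
    proof (rule W_mono[OF taylor_term_diff_W[OF u v p]])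
      have "real (p + Suc N) * \<delta> \<le> real (p + (N + p)) * \<delta>"
        using p \<delta>_pos by (intro mult_right_mono) auto
      then show "real p * \<delta> + real (Suc N) * \<delta> \<le> real (p + (N + p)) * \<delta>" by (simp add: distrib_right)
    qed
    then show ?thesis by simp
  qed
  show "(\<lambda>t. \<Phi> (a + u t + v t) - \<Phi> (a + u t) - (\<Sum>r<Suc (N + p). ?\<Delta> r t)) \<in> small (real p * \<delta> + real (Suc N) * \<delta>)" for N
  proof -
    obtain C where C: "\<And>x. norm x \<le> \<rho> \<Longrightarrow>
       norm (\<Phi> (a + x) - (\<Sum>r<Suc (N + p). taylor_term r \<Phi> a x)) \<le> C * norm x ^ Suc (N + p)"
      using taylor_remainder[OF \<Phi>(1,2), of "Suc (N + p)"] by blast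
    have rem: "(\<lambda>t. \<Phi> (a + x t) - (\<Sum>r<Suc (N + p). taylor_term r \<Phi> a (x t))) \<in> small (real p * \<delta> + real (Suc N) * \<delta>)"
      if x: "x \<in> W \<delta>" for x
    proof -
      have xs: "x \<in> small \<delta>" by (rule W_small[OF x])
      have "(\<lambda>t. norm (x t) powr real (Suc (N + p))) \<in> small (real (Suc (N + p)) * \<delta>)"
        by (rule small_powr[OF xs]) simp
      moreover have "eventually (\<lambda>t. norm (x t) < \<rho>) at_top"
        using tendstoD[OF small_tendsto_zero[OF xs \<delta>_pos] \<Phi>(3)] by (simp add: dist_norm)
      then have "eventually (\<lambda>t. norm (\<Phi> (a + x t) - (\<Sum>r<Suc (N + p). taylor_term r \<Phi> a (x t)))
          \<le> C * norm (norm (x t) powr real (Suc (N + p)))) at_top"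
      proof eventually_elim
        case (elim t)
        have "norm (norm (x t) powr real (Suc (N + p))) = norm (x t) ^ Suc (N + p)"
          by (simp add: powr_realpow' del: of_nat_Suc)
        then show ?case using C[of "x t"] elim by simp
      qed
      ultimately have "(\<lambda>t. \<Phi> (a + x t) - (\<Sum>r<Suc (N + p). taylor_term r \<Phi> a (x t))) \<in> small (real (Suc (N + p)) * \<delta>)"
        by (rule small_dominated)
      then show ?thesis by (simp add: algebra_simps)
    qed
    show ?thesis using small_diff[OF rem[OF uv] rem[OF u]]
      by (simp add: sum_subtractf algebra_simps del: sum.lessThan_Suc)
  qed
qed

text \<open>As an exponential the leading factor is positive for all t, so homogeneity applies
  without restriction on t.\<close>

definition scale :: "real \<Rightarrow> real \<Rightarrow> real" where
  "scale \<gamma> t = exp (ln (\<zeta> t) - \<gamma> * iter_log (int m + 1) t)"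

lemma scale_pos: "scale \<gamma> t > 0"
  by (simp add: scale_def)

lemma scale_eq: "eventually (\<lambda>t. scale \<gamma> t = \<zeta> t * L t powr (-\<gamma>)) at_top"
  using \<zeta>_pos L_powr[of "-\<gamma>"] by eventually_elim (simp add: scale_def exp_diff exp_minus field_simps)

definition scale_exp :: "real \<Rightarrow> int \<Rightarrow> complex" where
  "scale_exp \<gamma> = (\<lambda>j. if j = int m then of_real (- \<gamma>) else 0)"

lemma scale_exp_exps: "scale_exp \<gamma> \<in> exps \<gamma>"
  by (auto simp: scale_exp_def exps_def tuples_def intro!: exI[of _ "int m"])

lemma scale_powr_mon: "of_real (scale \<gamma> t powr \<beta>) = mon (scale_exp (\<beta> * \<gamma>)) \<beta> t"
proof -
  have "scale \<gamma> t powr \<beta> = exp (- (\<beta> * \<gamma>) * iter_log (int m + 1) t) * exp (\<beta> * ln (\<zeta> t))"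
    by (simp add: scale_def powr_def algebra_simps flip: exp_add)
  then show ?thesis
    unfolding mon_def scale_exp_def log_power_single by (simp flip: exp_of_real)
qed

lemma scale_powr_U: "(\<lambda>t. scale \<gamma> t powr \<beta> *\<^sub>R v) \<in> U (\<beta> * \<gamma>)"
proof -
  have "(\<lambda>t. Re (1 * mon (scale_exp (\<beta> * \<gamma>)) \<beta> t) *\<^sub>R v) \<in> U (\<beta> * \<gamma>)"
    by (intro U.gen scale_exp_exps)
  then show ?thesis by (simp flip: scale_powr_mon)
qed

lemma scale_derivative:
  obtains s' where "eventually (\<lambda>t. (scale \<gamma> has_real_derivative s' t) (at t)) at_top" "s' \<in> W (\<gamma> + 1)"
proof -
  have s: "complex_of_real (scale \<gamma> t) = mon (scale_exp \<gamma>) 1 t" for t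
    using scale_powr_mon[of \<gamma> t 1] scale_pos[of \<gamma> t] by simp
  obtain \<rho> where \<rho>: "\<rho> \<in> W 1" "eventually (\<lambda>t. (mon (scale_exp \<gamma>) 1 has_vector_derivative
     mon (scale_exp \<gamma>) 1 t * (scale_exp \<gamma> (-1) + \<rho> t)) (at t)) at_top"
    using mon_derivative[OF scale_exp_exps] .
  have z: "scale_exp \<gamma> (-1) = 0" by (simp add: scale_exp_def)
  have re: "scale \<gamma> = (\<lambda>t. Re (mon (scale_exp \<gamma>) 1 t))" by (simp add: fun_eq_iff flip: s)
  show ?thesis
  proof (rule that[of "\<lambda>t. Re (mon (scale_exp \<gamma>) 1 t * \<rho> t)"])
    show "eventually (\<lambda>t. (scale \<gamma> has_real_derivative Re (mon (scale_exp \<gamma>) 1 t * \<rho> t)) (at t)) at_top"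
      using \<rho>(2) unfolding z add_0 has_real_derivative_iff_has_vector_derivative re
      by eventually_elim (rule bounded_linear.has_vector_derivative[OF bounded_linear_Re])
    show "(\<lambda>t. Re (mon (scale_exp \<gamma>) 1 t * \<rho> t)) \<in> W (\<gamma> + 1)"
      by (intro W_bounded_linear[OF _ bounded_linear_Re] W_bilinear[OF W_U[OF mon_U] \<rho>(1) bounded_bilinear_mult] scale_exp_exps)
  qed
qed

end

section \<open>Nonlinearities with homogeneous expansions\<close>

text \<open>Common form of the infinite and the finite case: every order B is reached by all
  sufficiently long partial sums. The bound holds on a full ball, so that it can be used along
  functions which may vanish.\<close>

definition hom_expansion ::
  "(real ^ 'n \<Rightarrow> real ^ 'n) \<Rightarrow> (nat \<Rightarrow> real) \<Rightarrow> (nat \<Rightarrow> real ^ 'n \<Rightarrow> real ^ 'n) \<Rightarrow> bool" where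
  "hom_expansion F \<beta> Fk \<longleftrightarrow>
     (\<forall>k\<ge>1. \<beta> k > 1) \<and> strict_mono_on {1..} \<beta> \<and> filterlim \<beta> at_top sequentially \<and>
     (\<forall>k\<ge>1. Fk k \<in> pos_homogeneous (\<beta> k) \<and> smooth_on (- {0}) (Fk k)) \<and>
     (\<forall>B>0. \<exists>N0. \<forall>N\<ge>N0. \<exists>C r. r > 0 \<and> (\<forall>x. norm x < r \<longrightarrow>
        norm (F x - (\<Sum>k=1..N. Fk k x)) \<le> C * norm x powr B))"

section \<open>Homogeneous functions and the two forms of the hypothesis on F\<close>

lemma pos_homogeneous_scale: "G \<in> pos_homogeneous \<beta> \<Longrightarrow> t > 0 \<Longrightarrow> G (t *\<^sub>R x) = (t powr \<beta>) *\<^sub>R G x"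
  by (auto simp: pos_homogeneous_def)

lemma pos_homogeneous_zero:
  assumes "G \<in> pos_homogeneous \<beta>" "\<beta> > 0"
  shows "G 0 = 0"
proof -
  have "G (2 *\<^sub>R 0) = (2 powr \<beta>) *\<^sub>R G 0" by (rule pos_homogeneous_scale[OF assms(1)]) simp
  then have "(2 powr \<beta> - 1) *\<^sub>R G 0 = 0" by (simp add: scaleR_diff_left)
  moreover have "2 powr \<beta> \<noteq> 1" using assms(2) by (simp add: powr_eq_one_iff)
  ultimately show ?thesis by simp
qed

lemma pos_homogeneous_bound:
  fixes G :: "real ^ 'n \<Rightarrow> real ^ 'n"
  assumes "G \<in> pos_homogeneous \<beta>" "\<beta> > 0" "smooth_on (- {0}) G"
  obtains C where "C \<ge> 0" "\<And>x. norm (G x) \<le> C * norm x powr \<beta>"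
proof -
  have "compact (G ` sphere 0 1)"
    using smooth_on_continuous[OF assms(3)]
    by (intro compact_continuous_image compact_sphere) (auto intro: continuous_on_subset)
  then obtain C where C: "\<And>x. norm x = 1 \<Longrightarrow> norm (G x) \<le> C"
    using compact_imp_bounded bounded_iff by (metis imageI mem_sphere_0)
  have "norm (G x) \<le> \<bar>C\<bar> * norm x powr \<beta>" for x
  proof (cases "x = 0")
    case False
    have "G x = G (norm x *\<^sub>R (x /\<^sub>R norm x))" using False by simp
    also have "\<dots> = (norm x powr \<beta>) *\<^sub>R G (x /\<^sub>R norm x)"
      using False by (intro pos_homogeneous_scale[OF assms(1)]) simp
    finally have "norm (G x) = norm x powr \<beta> * norm (G (x /\<^sub>R norm x))" by simp
    also have "\<dots> \<le> norm x powr \<beta> * \<bar>C\<bar>"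
      using C[of "x /\<^sub>R norm x"] False by (intro mult_left_mono) auto
    finally show ?thesis by (simp add: mult.commute)
  qed (use pos_homogeneous_zero[OF assms(1,2)] in simp)
  then show ?thesis by (intro that[of "\<bar>C\<bar>"]) auto
qed

text \<open>The filter \<open>at 0\<close> omits the origin, so the value there has to be supplied.
  Cutting the radius at 1 permits lowering the exponent to B.\<close>

lemma bigo_norm_powrD:
  fixes G :: "real ^ 'n \<Rightarrow> real ^ 'n"
  assumes "(\<lambda>x. norm (G x)) \<in> O[at 0](\<lambda>x. norm x powr b)" "B \<le> b" "G 0 = 0"
  shows "\<exists>C r. r > 0 \<and> (\<forall>x. norm x < r \<longrightarrow> norm (G x) \<le> C * norm x powr B)"
proof -
  obtain C where C: "C > 0" "eventually (\<lambda>x. norm (norm (G x)) \<le> C * norm (norm x powr b)) (at 0)"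
    using landau_o.bigE[OF assms(1)] by blast
  then obtain d where d: "d > 0" "\<And>x. x \<noteq> 0 \<Longrightarrow> dist x 0 < d \<Longrightarrow> norm (G x) \<le> C * norm x powr b"
    unfolding eventually_at by auto
  have "norm (G x) \<le> C * norm x powr B" if x: "norm x < min d 1" for x
  proof (cases "x = 0")
    case False
    have "norm (G x) \<le> C * norm x powr b" using d(2)[OF False] x by (simp add: dist_norm)
    also have "\<dots> \<le> C * norm x powr B"
      using C(1) x False assms(2) by (intro mult_left_mono powr_mono') auto
    finally show ?thesis .
  qed (use assms(3) in simp)
  then show ?thesis using d(1) by (intro exI[of _ C] exI[of _ "min d 1"]) auto
qed

lemma nonlin_H1_hom_expansion:
  assumes "nonlin_H1 F" "F 0 = 0"
  shows "\<exists>\<beta> Fk. hom_expansion F \<beta> Fk"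
proof -
  obtain \<beta> Fk where H: "\<forall>k\<ge>1. \<beta> k > 1" "strict_mono_on {1..} \<beta>" "filterlim \<beta> at_top sequentially"
        "\<forall>k\<ge>1. Fk k \<in> pos_homogeneous (\<beta> k) \<and> smooth_on (- {0}) (Fk k)"
        "\<forall>N\<ge>1. \<exists>b>\<beta> N. (\<lambda>x. norm (F x - (\<Sum>k=1..N. Fk k x))) \<in> O[at 0](\<lambda>x. norm x powr b)"
    using assms(1) unfolding nonlin_H1_def by blast
  have z: "F 0 - (\<Sum>k=1..N. Fk k 0) = 0" for N
  proof -
    have "Fk k 0 = 0" if "k \<in> {1..N}" for k
      using H(1,4) that by (intro pos_homogeneous_zero[of "Fk k" "\<beta> k"]) (auto intro: less_trans[OF zero_less_one])
    then show ?thesis using assms(2) by simp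
  qed
  have "\<exists>N0. \<forall>N\<ge>N0. \<exists>C r. r > 0 \<and> (\<forall>x. norm x < r \<longrightarrow>
        norm (F x - (\<Sum>k=1..N. Fk k x)) \<le> C * norm x powr B)" for B
  proof -
    obtain N1 where N1: "\<And>N. N \<ge> N1 \<Longrightarrow> \<beta> N \<ge> B"
      using H(3) unfolding filterlim_at_top eventually_sequentially by blast
    show ?thesis
    proof (intro exI[of _ "max N1 1"] allI impI)
      fix N assume N: "N \<ge> max N1 1"
      then obtain b where b: "b > \<beta> N" "(\<lambda>x. norm (F x - (\<Sum>k=1..N. Fk k x))) \<in> O[at 0](\<lambda>x. norm x powr b)"
        using H(5) by (meson max.boundedE)
      have "\<beta> N \<ge> B" using N1 N by simp
      with b(1) have "B \<le> b" by linarith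
      from bigo_norm_powrD[OF b(2) this z]
      show "\<exists>C r. r > 0 \<and> (\<forall>x. norm x < r \<longrightarrow> norm (F x - (\<Sum>k=1..N. Fk k x)) \<le> C * norm x powr B)" .
    qed
  qed
  then show ?thesis using H(1-4) unfolding hom_expansion_def by blast
qed

lemma smooth_on_const: "smooth_on S (\<lambda>x. c :: 'c::real_normed_vector)"
proof -
  have "Cr_on r S (\<lambda>x. c)" for r and c :: "'c::real_normed_vector"
    by (induction r arbitrary: c) (auto simp: frechet_derivative_const)
  then show ?thesis by (simp add: smooth_on_def)
qed

lemma nonlin_H2_hom_expansion:
  assumes "nonlin_H2 F" "F 0 = 0"
  shows "\<exists>\<beta> Fk. hom_expansion F \<beta> Fk"
proof -
  obtain M :: nat and \<beta> Fk where H: "M \<ge> 1" "\<forall>k\<in>{1..M}. \<beta> k > 1" "strict_mono_on {1..M} \<beta>"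
        "\<forall>k\<in>{1..M}. Fk k \<in> pos_homogeneous (\<beta> k) \<and> smooth_on (- {0}) (Fk k)"
        "\<forall>b>\<beta> M. (\<lambda>x. norm (F x - (\<Sum>k=1..M. Fk k x))) \<in> O[at 0](\<lambda>x. norm x powr b)"
    using assms(1) unfolding nonlin_H2_def by blast
  \<comment> \<open>The finite family is continued by zero functions, which are homogeneous of every
    degree, with exponents \<open>\<beta> M + 1\<close>, \<open>\<beta> M + 2\<close> and so
    on.\<close>
  define \<beta>' where "\<beta>' k = (if k \<le> M then \<beta> k else \<beta> M + real (k - M))" for k
  define Gk where "Gk k = (if k \<le> M then Fk k else (\<lambda>x. 0))" for k
  have M1: "\<beta> M > 1" using H(1,2) by simp
  have z: "F 0 - (\<Sum>k=1..M. Fk k 0) = 0"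
  proof -
    have "Fk k 0 = 0" if "k \<in> {1..M}" for k
      using H(2,4) that by (intro pos_homogeneous_zero[of "Fk k" "\<beta> k"]) (auto intro: less_trans[OF zero_less_one])
    then show ?thesis using assms(2) by simp
  qed
  have "\<beta>' k > 1" if "k \<ge> 1" for k using H(2) M1 that by (auto simp: \<beta>'_def)
  moreover have "strict_mono_on {1..} \<beta>'"
  proof (rule strict_mono_onI)
    fix i j :: nat assume ij: "i \<in> {1..}" "j \<in> {1..}" "i < j"
    consider "j \<le> M" | "i \<le> M" "M < j" | "M < i" by linarith
    then show "\<beta>' i < \<beta>' j"
    proof cases
      case 1
      then show ?thesis using strict_mono_onD[OF H(3), of i j] ij by (simp add: \<beta>'_def)
    next
      case 2
      then have "\<beta> i \<le> \<beta> M" using strict_mono_on_leD[OF H(3), of i M] ij H(1) by simp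
      then show ?thesis using 2 by (simp add: \<beta>'_def)
    next
      case 3
      then show ?thesis using ij by (simp add: \<beta>'_def)
    qed
  qed
  moreover have "filterlim \<beta>' at_top sequentially"
  proof (rule filterlim_at_top_mono)
    show "filterlim (\<lambda>k. (\<beta> M - real M) + real k) at_top sequentially"
      by (rule filterlim_tendsto_add_at_top[OF tendsto_const filterlim_real_sequentially])
    show "eventually (\<lambda>k. (\<beta> M - real M) + real k \<le> \<beta>' k) sequentially"
      using eventually_gt_at_top[of M] by eventually_elim (simp add: \<beta>'_def)
  qed
  moreover have "Gk k \<in> pos_homogeneous (\<beta>' k) \<and> smooth_on (- {0}) (Gk k)" if "k \<ge> 1" for k
    using H(4) that smooth_on_const[of "- {0}" "0 :: real ^ 'a"] by (auto simp: Gk_def \<beta>'_def pos_homogeneous_def)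
  moreover have "\<exists>N0. \<forall>N\<ge>N0. \<exists>C r. r > 0 \<and> (\<forall>x. norm x < r \<longrightarrow>
        norm (F x - (\<Sum>k=1..N. Gk k x)) \<le> C * norm x powr B)" for B
  proof (intro exI[of _ M] allI impI)
    fix N assume N: "N \<ge> M"
    have "(\<Sum>k=1..N. Gk k x) = (\<Sum>k=1..M. Fk k x)" for x
      using N by (intro sum.mono_neutral_cong_right) (auto simp: Gk_def)
    moreover have "(\<lambda>x. norm (F x - (\<Sum>k=1..M. Fk k x))) \<in> O[at 0](\<lambda>x. norm x powr (max B (\<beta> M + 1)))"
      using H(5) by (auto simp: less_max_iff_disj)
    from bigo_norm_powrD[OF this _ z, of B]
    have "\<exists>C r. r > 0 \<and> (\<forall>x. norm x < r \<longrightarrow> norm (F x - (\<Sum>k=1..M. Fk k x)) \<le> C * norm x powr B)" by simp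
    ultimately show "\<exists>C r. r > 0 \<and> (\<forall>x. norm x < r \<longrightarrow> norm (F x - (\<Sum>k=1..N. Gk k x)) \<le> C * norm x powr B)"
      by simp
  qed
  ultimately show ?thesis unfolding hom_expansion_def by blast
qed

lemma hom_expansion_bound:
  assumes "hom_expansion F \<beta> Fk"
  shows "\<exists>C r. r > 0 \<and> (\<forall>x. norm x < r \<longrightarrow> norm (F x) \<le> C * norm x powr (\<beta> 1))"
proof -
  have \<beta>1: "\<beta> 1 > 0" using assms unfolding hom_expansion_def by (auto intro: less_trans[OF zero_less_one])
  obtain N C r where C: "r > 0" "\<And>x. norm x < r \<Longrightarrow> norm (F x - (\<Sum>k=1..N. Fk k x)) \<le> C * norm x powr (\<beta> 1)"
    using assms \<beta>1 unfolding hom_expansion_def by blast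
  have "\<exists>D. D \<ge> 0 \<and> (\<forall>x. norm (Fk k x) \<le> D * norm x powr \<beta> k)" if "k \<in> {1..N}" for k
  proof -
    have "Fk k \<in> pos_homogeneous (\<beta> k)" "smooth_on (- {0}) (Fk k)" "\<beta> k > 0"
      using assms that unfolding hom_expansion_def by (auto intro: less_trans[OF zero_less_one])
    then show ?thesis using pos_homogeneous_bound by blast
  qed
  then obtain D where D: "\<And>k. k \<in> {1..N} \<Longrightarrow> D k \<ge> 0" "\<And>k x. k \<in> {1..N} \<Longrightarrow> norm (Fk k x) \<le> D k * norm x powr \<beta> k"
    by metis
  have "norm (F x) \<le> (C + (\<Sum>k=1..N. D k)) * norm x powr (\<beta> 1)" if x: "norm x < min r 1" for x
  proof -
    have "norm (Fk k x) \<le> D k * norm x powr \<beta> 1" if k: "k \<in> {1..N}" for k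
    proof -
      have "\<beta> 1 \<le> \<beta> k"
        using assms k strict_mono_on_leD[of "{1..}" \<beta> 1 k] unfolding hom_expansion_def by auto
      then have "norm x powr \<beta> k \<le> norm x powr \<beta> 1" using x
        by (cases "x = 0") (auto intro: powr_mono')
      then show ?thesis using D[OF k] by (meson mult_left_mono order_trans)
    qed
    then have "norm (\<Sum>k=1..N. Fk k x) \<le> (\<Sum>k=1..N. D k * norm x powr \<beta> 1)" by (rule sum_norm_le)
    moreover have "norm (F x) \<le> norm (F x - (\<Sum>k=1..N. Fk k x)) + norm (\<Sum>k=1..N. Fk k x)"
      using norm_triangle_ineq[of "F x - (\<Sum>k=1..N. Fk k x)" "\<Sum>k=1..N. Fk k x"] by simp
    ultimately show ?thesis using C(2)[of x] x by (simp add: distrib_right sum_distrib_right)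
  qed
  then show ?thesis using C(1) by (intro exI[of _ "C + (\<Sum>k=1..N. D k)"] exI[of _ "min r 1"]) auto
qed

lemma smooth_on_locally_lipschitz:
  fixes G :: "real ^ 'n \<Rightarrow> real ^ 'k"
  assumes "smooth_on S G" "cball a \<rho> \<subseteq> S"
  obtains C where "\<And>x y. x \<in> cball a \<rho> \<Longrightarrow> y \<in> cball a \<rho> \<Longrightarrow> norm (G x - G y) \<le> C * norm (x - y)"
proof -
  have "\<exists>C. \<forall>x\<in>cball a \<rho>. norm (partial i G x) \<le> C" for i
  proof -
    have "compact (partial i G ` cball a \<rho>)"
      using smooth_on_continuous[OF smooth_on_partial[OF assms(1)]] assms(2)
      by (intro compact_continuous_image compact_cball) (auto intro: continuous_on_subset)
    then show ?thesis using compact_imp_bounded bounded_iff by (metis imageI)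
  qed
  then have "\<forall>i. \<exists>C. \<forall>x\<in>cball a \<rho>. norm (partial i G x) \<le> C" ..
  from choice[OF this] obtain C where "\<forall>i. \<forall>x\<in>cball a \<rho>. norm (partial i G x) \<le> C i" ..
  then have C: "\<And>i x. x \<in> cball a \<rho> \<Longrightarrow> norm (partial i G x) \<le> C i" by blast
  show ?thesis
  proof (rule that[of "\<Sum>i\<in>UNIV. C i"])
    fix x y assume xy: "x \<in> cball a \<rho>" "y \<in> cball a \<rho>"
    show "norm (G x - G y) \<le> (\<Sum>i\<in>UNIV. C i) * norm (x - y)"
    proof (rule differentiable_bound[of "cball a \<rho>" G "\<lambda>x u. \<Sum>i\<in>UNIV. u $ i *\<^sub>R partial i G x"])
      fix z assume z: "z \<in> cball a \<rho>"
      show "(G has_derivative (\<lambda>u. \<Sum>i\<in>UNIV. u $ i *\<^sub>R partial i G z)) (at z within cball a \<rho>)"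
        by (rule has_derivative_at_withinI[OF smooth_on_has_derivative[OF assms(1)]]) (use z assms(2) in blast)
      show "onorm (\<lambda>u. \<Sum>i\<in>UNIV. u $ i *\<^sub>R partial i G z) \<le> (\<Sum>i\<in>UNIV. C i)"
      proof (rule onorm_le)
        fix u :: "real ^ 'n"
        have "norm (\<Sum>i\<in>UNIV. u $ i *\<^sub>R partial i G z) \<le> (\<Sum>i\<in>UNIV. C i * norm u)"
        proof (rule sum_norm_le)
          fix i
          have "\<bar>u $ i\<bar> * norm (partial i G z) \<le> norm u * C i"
            using C[OF z, of i] by (intro mult_mono component_le_norm_cart) auto
          then show "norm (u $ i *\<^sub>R partial i G z) \<le> C i * norm u" by (simp add: mult.commute)
        qed
        then show "norm (\<Sum>i\<in>UNIV. u $ i *\<^sub>R partial i G z) \<le> (\<Sum>i\<in>UNIV. C i) * norm u"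
          by (simp add: sum_distrib_right)
      qed
    qed (use xy in auto)
  qed
qed

section \<open>The nonlinearity along multiples of the leading factor\<close>

context log_scale
begin

text \<open>Passage from a sum whose terms have arbitrary orders tending to infinity to the grid of
  spacing \<delta>: beyond the cut \<open>K n\<close> every term, and the remainder, has order at
  least a + (n + 1) \<delta>.\<close>

lemma W_asymptotic_sum:
  assumes E: "\<And>k. k \<ge> 1 \<Longrightarrow> E k \<in> W (e k)" "\<And>k. k \<ge> 1 \<Longrightarrow> e k \<ge> a" "filterlim e at_top sequentially"
    and g: "\<And>B. B > 0 \<Longrightarrow> \<exists>N0. \<forall>N\<ge>N0. (\<lambda>t. g t - (\<Sum>k=1..N. E k t)) \<in> small B"
  shows "g \<in> W a"
proof -
  have "\<exists>N0. \<forall>N\<ge>N0. e N \<ge> a + real (Suc n) * \<delta> \<and> (\<lambda>t. g t - (\<Sum>k=1..N. E k t)) \<in> small (a + real (Suc n) * \<delta>)" for n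
  proof -
    obtain N1 where N1: "\<And>N. N \<ge> N1 \<Longrightarrow> e N \<ge> a + real (Suc n) * \<delta>"
      using E(3) unfolding filterlim_at_top eventually_sequentially by blast
    have "max 1 (a + real (Suc n) * \<delta>) > 0" by simp
    then obtain N2 where N2: "\<And>N. N \<ge> N2 \<Longrightarrow> (\<lambda>t. g t - (\<Sum>k=1..N. E k t)) \<in> small (max 1 (a + real (Suc n) * \<delta>))"
      using g by blast
    show ?thesis
      using N1 small_mono[OF _ N2] by (intro exI[of _ "max N1 N2"]) auto
  qed
  then have "\<forall>n. \<exists>N0. \<forall>N\<ge>N0. e N \<ge> a + real (Suc n) * \<delta> \<and> (\<lambda>t. g t - (\<Sum>k=1..N. E k t)) \<in> small (a + real (Suc n) * \<delta>)"
    by blast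
  from choice[OF this] obtain K0 where
    "\<forall>n. \<forall>N\<ge>K0 n. e N \<ge> a + real (Suc n) * \<delta> \<and> (\<lambda>t. g t - (\<Sum>k=1..N. E k t)) \<in> small (a + real (Suc n) * \<delta>)" ..
  then have K0: "\<And>n N. N \<ge> K0 n \<Longrightarrow> e N \<ge> a + real (Suc n) * \<delta>"
    "\<And>n N. N \<ge> K0 n \<Longrightarrow> (\<lambda>t. g t - (\<Sum>k=1..N. E k t)) \<in> small (a + real (Suc n) * \<delta>)" by blast+
  \<comment> \<open>Summation makes the cuts nondecreasing and keeps each at least
    \<open>K0 n\<close>.\<close>
  define K where "K n = (\<Sum>i\<le>n. K0 i)" for n
  have KK0: "K0 n \<le> K n" for n unfolding K_def by (rule member_le_sum) auto
  have KS: "K n \<le> K (Suc n)" for n by (simp add: K_def)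
  show ?thesis
  proof (rule W_limit[where h = "\<lambda>n t. \<Sum>k=1..K n. E k t"])
    show "(\<lambda>t. \<Sum>k=1..K 0. E k t) \<in> W a"
      using W_mono[OF E(1) E(2)] by (intro W_sum) auto
    show "(\<lambda>t. g t - (\<Sum>k=1..K n. E k t)) \<in> small (a + real (Suc n) * \<delta>)" for n
      by (rule K0(2)[OF KK0])
    fix n
    have "(\<Sum>k=1..K (Suc n). E k t) - (\<Sum>k=1..K n. E k t) = (\<Sum>k\<in>{K n + 1..K (Suc n)}. E k t)" for t
    proof -
      have "{1..K (Suc n)} = {1..K n} \<union> {K n + 1..K (Suc n)}" using KS[of n] by auto
      then show ?thesis by (simp add: sum.union_disjoint)
    qed
    moreover have "(\<lambda>t. \<Sum>k\<in>{K n + 1..K (Suc n)}. E k t) \<in> W (a + real (Suc n) * \<delta>)"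
    proof (rule W_sum)
      fix k assume k: "k \<in> {K n + 1..K (Suc n)}"
      then have "e k \<ge> a + real (Suc n) * \<delta>" using K0(1)[of n k] KK0[of n] by auto
      then show "E k \<in> W (a + real (Suc n) * \<delta>)" using W_mono[OF E(1)] k by auto
    qed
    ultimately show "(\<lambda>t. (\<Sum>k=1..K (Suc n). E k t) - (\<Sum>k=1..K n. E k t)) \<in> W (a + real (Suc n) * \<delta>)"
      by simp
  qed
qed

lemma scale_powr_W:
  "g \<in> W a \<Longrightarrow> (\<lambda>t. scale \<gamma> t powr \<beta> *\<^sub>R g t) \<in> W (\<beta> * \<gamma> + a)"
proof -
  assume g: "g \<in> W a"
  have "(\<lambda>t. scale \<gamma> t powr \<beta> *\<^sub>R (1::real)) \<in> W (\<beta> * \<gamma>)" by (rule W_U[OF scale_powr_U])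
  from W_bilinear[OF this g bounded_bilinear_scaleR] show ?thesis by simp
qed

lemma small_W_scale: "x \<in> small a \<Longrightarrow> (\<lambda>t. scale \<gamma> t powr \<beta> *\<^sub>R x t) \<in> small (\<beta> * \<gamma> + a)"
proof -
  assume x: "x \<in> small a"
  have "(\<lambda>t. scale \<gamma> t powr \<beta> *\<^sub>R (1::real)) \<in> small (\<beta> * \<gamma>)" by (rule U_small[OF scale_powr_U])
  from small_bilinear[OF this x bounded_bilinear_scaleR] show ?thesis by simp
qed

lemma hom_expansion_remainder_small:
  assumes F: "hom_expansion F \<beta> Fk" and x: "x \<in> small \<gamma>" "\<gamma> > 0" and B: "B > 0"
  shows "\<exists>N0. \<forall>N\<ge>N0. (\<lambda>t. F (x t) - (\<Sum>k=1..N. Fk k (x t))) \<in> small B"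
proof -
  \<comment> \<open>As x has order \<gamma>, the power B / \<gamma> of its norm has order B.\<close>
  obtain N0 where N0: "\<And>N. N \<ge> N0 \<Longrightarrow> \<exists>C r. r > 0 \<and> (\<forall>x. norm x < r \<longrightarrow>
        norm (F x - (\<Sum>k=1..N. Fk k x)) \<le> C * norm x powr (B / \<gamma>))"
    using F B x(2) unfolding hom_expansion_def by (meson divide_pos_pos)
  have "(\<lambda>t. F (x t) - (\<Sum>k=1..N. Fk k (x t))) \<in> small B" if N: "N \<ge> N0" for N
  proof -
    obtain C r where C: "r > 0" "\<And>x. norm x < r \<Longrightarrow> norm (F x - (\<Sum>k=1..N. Fk k x)) \<le> C * norm x powr (B / \<gamma>)"
      using N0[OF N] by blast
    have "(\<lambda>t. norm (x t) powr (B / \<gamma>)) \<in> small (B / \<gamma> * \<gamma>)"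
      using B x(2) by (intro small_powr[OF x(1)]) simp
    then have "(\<lambda>t. norm (x t) powr (B / \<gamma>)) \<in> small B" using x(2) by simp
    moreover have "eventually (\<lambda>t. norm (x t) < r) at_top"
      using tendstoD[OF small_tendsto_zero[OF x] C(1)] by (simp add: dist_norm)
    then have "eventually (\<lambda>t. norm (F (x t) - (\<Sum>k=1..N. Fk k (x t))) \<le> C * norm (norm (x t) powr (B / \<gamma>))) at_top"
      by eventually_elim (use C(2) in simp)
    ultimately show ?thesis by (rule small_dominated)
  qed
  then show ?thesis by blast
qed

lemma hom_expansion_tendsto:
  assumes "hom_expansion F \<beta> Fk" "\<gamma> > 0"
  shows "filterlim (\<lambda>k. \<beta> k * \<gamma> + c) at_top sequentially"
proof -
  have "filterlim (\<lambda>k. \<beta> k * \<gamma>) at_top sequentially"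
    using assms(1) unfolding hom_expansion_def
    by (intro filterlim_at_top_mult_tendsto_pos[OF tendsto_const assms(2)]) simp
  from filterlim_tendsto_add_at_top[OF tendsto_const[of c] this] show ?thesis by (simp add: add.commute)
qed

text \<open>At a multiple of the fixed vector a, homogeneity alone turns each \<open>Fk k\<close>
  into a single monomial term; no Taylor expansion enters yet.\<close>

lemma nonlinearity_leading_W:
  assumes F: "hom_expansion F \<beta> Fk" and \<gamma>: "\<gamma> > 0" "\<gamma> + \<delta> \<le> \<beta> 1 * \<gamma>"
  shows "(\<lambda>t. F (scale \<gamma> t *\<^sub>R a)) \<in> W (\<gamma> + \<delta>)"
proof (rule W_asymptotic_sum[where e = "\<lambda>k. \<beta> k * \<gamma> + 0" and E = "\<lambda>k t. Fk k (scale \<gamma> t *\<^sub>R a)"])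
  fix k :: nat assume k: "k \<ge> 1"
  have hom: "Fk k \<in> pos_homogeneous (\<beta> k)" using F k unfolding hom_expansion_def by blast
  show "(\<lambda>t. Fk k (scale \<gamma> t *\<^sub>R a)) \<in> W (\<beta> k * \<gamma> + 0)"
    using W_U[OF scale_powr_U[of \<gamma> "\<beta> k" "Fk k a"]]
    by (simp add: pos_homogeneous_scale[OF hom scale_pos])
  have "\<beta> 1 \<le> \<beta> k"
    using F k strict_mono_on_leD[of "{1..}" \<beta> 1 k] unfolding hom_expansion_def by auto
  then have "\<beta> 1 * \<gamma> \<le> \<beta> k * \<gamma>" using \<gamma>(1) by simp
  then show "\<gamma> + \<delta> \<le> \<beta> k * \<gamma> + 0" using \<gamma>(2) by linarith
next
  show "filterlim (\<lambda>k. \<beta> k * \<gamma> + 0) at_top sequentially" by (rule hom_expansion_tendsto[OF F \<gamma>(1)])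
  fix B :: real assume "B > 0"
  have "(\<lambda>t. scale \<gamma> t powr 1 *\<^sub>R a) \<in> small (1 * \<gamma>)" by (rule U_small[OF scale_powr_U])
  then have "(\<lambda>t. scale \<gamma> t *\<^sub>R a) \<in> small \<gamma>" using scale_pos by (simp add: less_imp_le)
  from hom_expansion_remainder_small[OF F this \<gamma>(1) \<open>B > 0\<close>]
  show "\<exists>N0. \<forall>N\<ge>N0. (\<lambda>t. F (scale \<gamma> t *\<^sub>R a) - (\<Sum>k=1..N. Fk k (scale \<gamma> t *\<^sub>R a))) \<in> small B" .
qed

lemma scaled_small:
  assumes "u \<in> small \<delta>"
  shows "(\<lambda>t. scale \<gamma> t *\<^sub>R (a + u t)) \<in> small \<gamma>"
proof -
  have "(\<lambda>t. scale \<gamma> t powr 1 *\<^sub>R a) \<in> small (1 * \<gamma>)" by (rule U_small[OF scale_powr_U])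
  moreover have "(\<lambda>t. scale \<gamma> t powr 1 *\<^sub>R u t) \<in> small (1 * \<gamma> + \<delta>)" by (rule small_W_scale[OF assms])
  then have "(\<lambda>t. scale \<gamma> t powr 1 *\<^sub>R u t) \<in> small (1 * \<gamma>)" by (rule small_mono[rotated]) (use \<delta>_pos in simp)
  ultimately have "(\<lambda>t. scale \<gamma> t powr 1 *\<^sub>R a + scale \<gamma> t powr 1 *\<^sub>R u t) \<in> small (1 * \<gamma>)" by (rule small_add)
  then show ?thesis using scale_pos by (simp add: less_imp_le scaleR_add_right)
qed

text \<open>The gain of a correction step: v shifts the argument of F by order \<gamma> + p
  \<delta>, but the value by one \<delta> more. Homogeneity pulls out a factor of order
  \<open>\<beta> k * \<gamma>\<close>, at least \<gamma> + \<delta>, and the remaining difference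
  near a is of order p \<delta>.\<close>

lemma nonlinearity_difference_W:
  assumes F: "hom_expansion F \<beta> Fk" and \<gamma>: "\<gamma> > 0" "\<gamma> + \<delta> \<le> \<beta> 1 * \<gamma>" and a: "a \<noteq> 0"
    and u: "u \<in> W \<delta>" and v: "v \<in> W (real p * \<delta>)" and p: "p \<ge> 1"
  shows "(\<lambda>t. F (scale \<gamma> t *\<^sub>R (a + u t + v t)) - F (scale \<gamma> t *\<^sub>R (a + u t))) \<in> W (\<gamma> + \<delta> + real p * \<delta>)"
proof (rule W_asymptotic_sum[where e = "\<lambda>k. \<beta> k * \<gamma> + real p * \<delta>"
      and E = "\<lambda>k t. Fk k (scale \<gamma> t *\<^sub>R (a + u t + v t)) - Fk k (scale \<gamma> t *\<^sub>R (a + u t))"])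
  fix k :: nat assume k: "k \<ge> 1"
  have hom: "Fk k \<in> pos_homogeneous (\<beta> k)" and sm: "smooth_on (- {0}) (Fk k)"
    using F k unfolding hom_expansion_def by blast+
  have "cball a (norm a / 2) \<subseteq> - {0}" using a by (auto simp: dist_norm)
  then have "(\<lambda>t. Fk k (a + u t + v t) - Fk k (a + u t)) \<in> W (real p * \<delta>)"
    by (rule smooth_difference_W[OF sm _ _ u v p]) (use a in simp)
  from scale_powr_W[OF this, of \<gamma> "\<beta> k"]
  show "(\<lambda>t. Fk k (scale \<gamma> t *\<^sub>R (a + u t + v t)) - Fk k (scale \<gamma> t *\<^sub>R (a + u t))) \<in> W (\<beta> k * \<gamma> + real p * \<delta>)"
    by (simp add: pos_homogeneous_scale[OF hom scale_pos] scaleR_diff_right)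
  have "\<beta> 1 \<le> \<beta> k"
    using F k strict_mono_on_leD[of "{1..}" \<beta> 1 k] unfolding hom_expansion_def by auto
  then have "\<beta> 1 * \<gamma> \<le> \<beta> k * \<gamma>" using \<gamma>(1) by simp
  then show "\<gamma> + \<delta> + real p * \<delta> \<le> \<beta> k * \<gamma> + real p * \<delta>" using \<gamma>(2) by linarith
next
  show "filterlim (\<lambda>k. \<beta> k * \<gamma> + real p * \<delta>) at_top sequentially" by (rule hom_expansion_tendsto[OF F \<gamma>(1)])
  have uv: "(\<lambda>t. u t + v t) \<in> W \<delta>"
    using p \<delta>_pos by (intro W_add[OF u] W_mono[OF v]) simp
  fix B :: real assume B: "B > 0"
  have "(\<lambda>t. scale \<gamma> t *\<^sub>R (a + (u t + v t))) \<in> small \<gamma>" by (rule scaled_small[OF W_small[OF uv]])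
  then have x1: "(\<lambda>t. scale \<gamma> t *\<^sub>R (a + u t + v t)) \<in> small \<gamma>" by (simp add: add.assoc)
  obtain N1 where N1: "\<And>N. N \<ge> N1 \<Longrightarrow> (\<lambda>t. F (scale \<gamma> t *\<^sub>R (a + u t + v t)) -
      (\<Sum>k=1..N. Fk k (scale \<gamma> t *\<^sub>R (a + u t + v t)))) \<in> small B"
    using hom_expansion_remainder_small[OF F x1 \<gamma>(1) B] by blast
  obtain N2 where N2: "\<And>N. N \<ge> N2 \<Longrightarrow> (\<lambda>t. F (scale \<gamma> t *\<^sub>R (a + u t)) -
      (\<Sum>k=1..N. Fk k (scale \<gamma> t *\<^sub>R (a + u t)))) \<in> small B"
    using hom_expansion_remainder_small[OF F scaled_small[OF W_small[OF u]] \<gamma>(1) B] by blast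
  show "\<exists>N0. \<forall>N\<ge>N0. (\<lambda>t. F (scale \<gamma> t *\<^sub>R (a + u t + v t)) - F (scale \<gamma> t *\<^sub>R (a + u t)) -
      (\<Sum>k=1..N. Fk k (scale \<gamma> t *\<^sub>R (a + u t + v t)) - Fk k (scale \<gamma> t *\<^sub>R (a + u t)))) \<in> small B"
  proof (intro exI[of _ "max N1 N2"] allI impI)
    fix N assume N: "N \<ge> max N1 N2"
    have "(\<lambda>t. (F (scale \<gamma> t *\<^sub>R (a + u t + v t)) - (\<Sum>k=1..N. Fk k (scale \<gamma> t *\<^sub>R (a + u t + v t)))) -
      (F (scale \<gamma> t *\<^sub>R (a + u t)) - (\<Sum>k=1..N. Fk k (scale \<gamma> t *\<^sub>R (a + u t))))) \<in> small B"
      using N by (intro small_diff N1 N2) auto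
    then show "(\<lambda>t. F (scale \<gamma> t *\<^sub>R (a + u t + v t)) - F (scale \<gamma> t *\<^sub>R (a + u t)) -
      (\<Sum>k=1..N. Fk k (scale \<gamma> t *\<^sub>R (a + u t + v t)) - Fk k (scale \<gamma> t *\<^sub>R (a + u t)))) \<in> small B"
      by (simp add: sum_subtractf algebra_simps)
  qed
qed

end

section \<open>Approximate and exact solutions\<close>

context log_scale
begin

text \<open>The comparison functions are the powers of L with exponent -b for b < a: their
  logarithmic derivative is -b times \<open>log_weight (int m)\<close> and tends to 0. The constant
  \<epsilon> depends on A alone and so can be fixed before w.\<close>

lemma perturbed_decay_small:
  fixes A :: "real ^ 'n ^ 'n"
  assumes A: "\<And>l. complex_eigenvalue A l \<Longrightarrow> Re l > 0"
  shows "\<exists>\<epsilon>>0. \<forall>w w' h a. eventually (\<lambda>t. (w has_vector_derivative w' t) (at t)) at_top \<longrightarrow>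
      eventually (\<lambda>t. norm (w' t + A *v w t) \<le> \<epsilon> * norm (w t) + norm (h t :: real)) at_top \<longrightarrow>
      h \<in> small a \<longrightarrow> w \<in> small a"
proof (rule perturbed_linear_decay[of A])
  show "Re l > 0" if "complex_eigenvalue A l" for l by (rule A[OF that])
next
  fix \<epsilon> :: real
  assume \<epsilon>: "\<epsilon> > 0" and D: "\<And>w w' \<phi> \<phi>' C. \<lbrakk>eventually (\<lambda>t. (w has_vector_derivative w' t) (at t)) at_top;
      eventually (\<lambda>t. (\<phi> has_real_derivative \<phi>' t) (at t)) at_top;
      eventually (\<lambda>t. \<phi> t > 0) at_top;
      \<And>e. e > 0 \<Longrightarrow> eventually (\<lambda>t. \<bar>\<phi>' t\<bar> \<le> e * \<phi> t) at_top;
      eventually (\<lambda>t. norm (w' t + A *v w t) \<le> \<epsilon> * norm (w t) + C * \<phi> t) at_top\<rbrakk>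
     \<Longrightarrow> \<exists>M. eventually (\<lambda>t. norm (w t) \<le> M * \<phi> t) at_top"
  have "w \<in> small a" if w: "eventually (\<lambda>t. (w has_vector_derivative w' t) (at t)) at_top"
      "eventually (\<lambda>t. norm (w' t + A *v w t) \<le> \<epsilon> * norm (w t) + norm (h t)) at_top"
      "h \<in> small a" for w w' and h :: "real \<Rightarrow> real" and a
    unfolding small_def
  proof (intro CollectI allI impI)
    fix b assume "b < a"
    define \<phi> where "\<phi> t = exp (- b * iter_log (int m + 1) t)" for t
    define \<phi>' where "\<phi>' t = \<phi> t * (- b * log_weight (int m) t)" for t
    obtain C where C: "C > 0" "eventually (\<lambda>t. norm (h t) \<le> C * L t powr (-b)) at_top"
      using smallE[OF w(3) \<open>b < a\<close>] .
    have "\<exists>M. eventually (\<lambda>t. norm (w t) \<le> M * \<phi> t) at_top"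
    proof (rule D[OF w(1)])
      show "eventually (\<lambda>t. (\<phi> has_real_derivative \<phi>' t) (at t)) at_top"
        using iter_log_derivative[of "Suc m"]
      proof eventually_elim
        case (elim t)
        have lw: "(\<Prod>i = 0..<Suc m. 1 / iter_log (int i) t) = log_weight (int m) t"
          by (simp add: log_weight_def nat_add_distrib)
        have "int (Suc m) = int m + 1" by simp
        from elim have "(iter_log (int m + 1) has_real_derivative log_weight (int m) t) (at t)"
          unfolding lw \<open>int (Suc m) = int m + 1\<close> .
        from DERIV_fun_exp[OF DERIV_cmult[OF this, of "- b"]]
        show ?case unfolding \<phi>_def[abs_def] \<phi>'_def by simp
      qed
      show "eventually (\<lambda>t. \<phi> t > 0) at_top" by (simp add: \<phi>_def)
      have l0: "(log_weight (int m) \<longlongrightarrow> 0) at_top"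
        by (rule small_tendsto_zero[OF W_small[OF log_weight_W]]) auto
      show "eventually (\<lambda>t. \<bar>\<phi>' t\<bar> \<le> e * \<phi> t) at_top" if e: "e > 0" for e
      proof -
        have "e / (\<bar>b\<bar> + 1) > 0" using e by simp
        from tendstoD[OF l0 this] show ?thesis
        proof eventually_elim
          case (elim t)
          have "\<bar>b\<bar> * \<bar>log_weight (int m) t\<bar> \<le> (\<bar>b\<bar> + 1) * (e / (\<bar>b\<bar> + 1))"
            using elim by (intro mult_mono) (auto simp: dist_real_def)
          also have "\<dots> = e" by (simp add: add_nonneg_eq_0_iff)
          finally have "\<phi> t * (\<bar>b\<bar> * \<bar>log_weight (int m) t\<bar>) \<le> \<phi> t * e"
            by (intro mult_left_mono) (auto simp: \<phi>_def)
          then show ?case by (simp add: \<phi>'_def abs_mult \<phi>_def mult.commute)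
        qed
      qed
      show "eventually (\<lambda>t. norm (w' t + A *v w t) \<le> \<epsilon> * norm (w t) + C * \<phi> t) at_top"
        using w(2) C(2) L_powr[of "-b"] by eventually_elim (simp add: \<phi>_def)
    qed
    then obtain M where "eventually (\<lambda>t. norm (w t) \<le> M * \<phi> t) at_top" ..
    then have "eventually (\<lambda>t. norm (w t) \<le> M * L t powr (-b)) at_top"
      using L_powr[of "-b"] by eventually_elim (simp add: \<phi>_def)
    then show "\<exists>C. eventually (\<lambda>t. norm (w t) \<le> C * L t powr (-b)) at_top" by blast
  qed
  then show ?thesis using \<epsilon> by blast
qed

text \<open>An approximate solution \<open>Y\<close> with derivative \<open>Y'\<close>: its residual is of the order required at step \<open>n\<close>, and
  it points in the direction \<open>a\<close> up to lower order terms, which keeps it away from the origin, where the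
  homogeneous functions are not smooth.\<close>

definition approx_solution ::
  "real ^ 'n ^ 'n \<Rightarrow> (real ^ 'n \<Rightarrow> real ^ 'n) \<Rightarrow> (real \<Rightarrow> real ^ 'n) \<Rightarrow> real \<Rightarrow> real ^ 'n \<Rightarrow> nat \<Rightarrow>
    (real \<Rightarrow> real ^ 'n) \<times> (real \<Rightarrow> real ^ 'n) \<Rightarrow> bool" where
  "approx_solution A F f \<gamma> a n YY \<longleftrightarrow> (case YY of (Y, Y') \<Rightarrow>
     eventually (\<lambda>t. (Y has_vector_derivative Y' t) (at t)) at_top \<and>
     (\<lambda>t. scale \<gamma> t powr (-1) *\<^sub>R Y t - a) \<in> W \<delta> \<and>
     (\<lambda>t. Y' t + A *v Y t - F (Y t) - f t) \<in> W (\<gamma> + real (Suc n) * \<delta>))"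

text \<open>A a = \<open>\<xi>0\<close> cancels the leading forcing term, which leaves the
  derivative of the scale factor, F at the leading term and the rest of f; each gains
  \<delta>.\<close>

lemma approx_solution_init:
  assumes F: "hom_expansion F \<beta> Fk" and \<gamma>: "\<gamma> > 0" "\<gamma> + \<delta> \<le> \<beta> 1 * \<gamma>"
    and Aa: "A *v a = \<xi>0" and f: "(\<lambda>t. f t - scale \<gamma> t *\<^sub>R \<xi>0) \<in> W (\<gamma> + \<delta>)"
  shows "\<exists>Y'. approx_solution A F f \<gamma> a 0 (\<lambda>t. scale \<gamma> t *\<^sub>R a, Y')"
proof -
  obtain s' where s': "eventually (\<lambda>t. (scale \<gamma> has_real_derivative s' t) (at t)) at_top" "s' \<in> W (\<gamma> + 1)"
    using scale_derivative .
  have d: "eventually (\<lambda>t. ((\<lambda>t. scale \<gamma> t *\<^sub>R a) has_vector_derivative s' t *\<^sub>R a) (at t)) at_top"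
    using s'(1)
  proof eventually_elim
    case (elim t)
    then show ?case
      by (intro bounded_linear.has_vector_derivative[OF bounded_linear_scaleR_left])
         (simp add: has_real_derivative_iff_has_vector_derivative)
  qed
  have "(\<lambda>t. s' t *\<^sub>R a) \<in> W (\<gamma> + 1)" by (rule W_bounded_linear[OF s'(2) bounded_linear_scaleR_left])
  then have 1: "(\<lambda>t. s' t *\<^sub>R a) \<in> W (\<gamma> + \<delta>)" by (rule W_mono) (use \<delta>_le in simp)
  have 2: "(\<lambda>t. F (scale \<gamma> t *\<^sub>R a)) \<in> W (\<gamma> + \<delta>)" by (rule nonlinearity_leading_W[OF F \<gamma>])
  have "(\<lambda>t. s' t *\<^sub>R a - F (scale \<gamma> t *\<^sub>R a) - (f t - scale \<gamma> t *\<^sub>R \<xi>0)) \<in> W (\<gamma> + \<delta>)"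
    by (rule W_diff[OF W_diff[OF 1 2] f])
  then have r: "(\<lambda>t. s' t *\<^sub>R a + A *v (scale \<gamma> t *\<^sub>R a) - F (scale \<gamma> t *\<^sub>R a) - f t) \<in> W (\<gamma> + \<delta>)"
    by (simp add: matrix_vector_mult_scaleR Aa algebra_simps)
  have "scale \<gamma> t powr (-1) * scale \<gamma> t = 1" for t
    using scale_pos[of \<gamma> t] by (simp add: powr_minus)
  then have "(\<lambda>t. scale \<gamma> t powr (-1) *\<^sub>R scale \<gamma> t *\<^sub>R a - a) \<in> W \<delta>" by (simp add: W_zero)
  then show ?thesis using d r by (intro exI[of _ "\<lambda>t. s' t *\<^sub>R a"]) (simp add: approx_solution_def)
qed

lemma approx_solution_step:
  fixes A :: "real ^ 'n ^ 'n"
  assumes A: "\<And>l. complex_eigenvalue A l \<Longrightarrow> Re l > 0"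
    and F: "hom_expansion F \<beta> Fk" and \<gamma>: "\<gamma> > 0" "\<gamma> + \<delta> \<le> \<beta> 1 * \<gamma>" and a: "a \<noteq> 0"
    and Y: "approx_solution A F f \<gamma> a n (Y, Y')"
  shows "\<exists>Q Q'. Q \<in> U (\<gamma> + real (Suc n) * \<delta>) \<and>
    approx_solution A F f \<gamma> a (Suc n) (\<lambda>t. Y t + Q t, \<lambda>t. Y' t + Q' t)"
proof -
  define b where "b = \<gamma> + real (Suc n) * \<delta>"
  have Y: "eventually (\<lambda>t. (Y has_vector_derivative Y' t) (at t)) at_top"
     "(\<lambda>t. scale \<gamma> t powr (-1) *\<^sub>R Y t - a) \<in> W \<delta>"
     "(\<lambda>t. Y' t + A *v Y t - F (Y t) - f t) \<in> W b"
    using Y by (auto simp: approx_solution_def b_def)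
  obtain G where G: "G \<in> U b" "(\<lambda>t. Y' t + A *v Y t - F (Y t) - f t - G t) \<in> W (b + \<delta>)"
    using W_leading_block[OF Y(3)] .
  obtain Q Q' where Q: "Q \<in> U b" "eventually (\<lambda>t. (Q has_vector_derivative Q' t) (at t)) at_top"
    "(\<lambda>t. Q' t + A *v Q t + G t) \<in> W (b + \<delta>)"
    using homological_equation_mod[OF A G(1)] by blast
  \<comment> \<open>Division by the scale factor s: Y is s (a + u) and the corrected function is s
    (a + u + v), the form in which the homogeneous parts can be expanded at a.\<close>
  define u where "u t = scale \<gamma> t powr (-1) *\<^sub>R Y t - a" for t
  define v where "v t = scale \<gamma> t powr (-1) *\<^sub>R Q t" for t
  have u: "u \<in> W \<delta>" using Y(2) by (simp add: u_def[abs_def])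
  have "v \<in> W (-1 * \<gamma> + b)" unfolding v_def[abs_def] by (rule scale_powr_W[OF W_U[OF Q(1)]])
  then have v: "v \<in> W (real (Suc n) * \<delta>)" by (simp add: b_def)
  have sc: "scale \<gamma> t *\<^sub>R (scale \<gamma> t powr (-1) *\<^sub>R x) = x" for t and x :: "real ^ 'n"
    using scale_pos[of \<gamma> t] by (simp add: powr_minus)
  have Yu: "scale \<gamma> t *\<^sub>R (a + u t) = Y t" for t
  proof -
    have "a + u t = scale \<gamma> t powr (-1) *\<^sub>R Y t" by (simp add: u_def)
    then show ?thesis by (simp only: sc)
  qed
  have YQ: "scale \<gamma> t *\<^sub>R (a + u t + v t) = Y t + Q t" for t
    unfolding scaleR_add_right[of _ "a + u t"] Yu by (simp only: v_def sc)
  have "(\<lambda>t. F (scale \<gamma> t *\<^sub>R (a + u t + v t)) - F (scale \<gamma> t *\<^sub>R (a + u t))) \<in> W (\<gamma> + \<delta> + real (Suc n) * \<delta>)"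
    by (rule nonlinearity_difference_W[OF F \<gamma> a u v]) simp
  then have "(\<lambda>t. F (Y t + Q t) - F (Y t)) \<in> W (\<gamma> + \<delta> + real (Suc n) * \<delta>)"
    unfolding YQ Yu .
  then have FD: "(\<lambda>t. F (Y t + Q t) - F (Y t)) \<in> W (b + \<delta>)"
    by (simp add: b_def algebra_simps)
  \<comment> \<open>The new residual: the old one without its leading block, plus the defect of the
    linear equation, minus the change of F.\<close>
  have "(\<lambda>t. (Y' t + A *v Y t - F (Y t) - f t - G t) + (Q' t + A *v Q t + G t) - (F (Y t + Q t) - F (Y t))) \<in> W (b + \<delta>)"
    by (rule W_diff[OF W_add[OF G(2) Q(3)] FD])
  then have r: "(\<lambda>t. Y' t + Q' t + A *v (Y t + Q t) - F (Y t + Q t) - f t) \<in> W (\<gamma> + real (Suc (Suc n)) * \<delta>)"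
    by (simp add: matrix_vector_right_distrib b_def algebra_simps)
  have "v \<in> W \<delta>" by (rule W_mono[OF v]) (use \<delta>_pos in simp)
  then have "(\<lambda>t. u t + v t) \<in> W \<delta>" by (rule W_add[OF u])
  then have uv: "(\<lambda>t. scale \<gamma> t powr (-1) *\<^sub>R (Y t + Q t) - a) \<in> W \<delta>"
    by (simp add: u_def v_def scaleR_add_right algebra_simps)
  have d: "eventually (\<lambda>t. ((\<lambda>t. Y t + Q t) has_vector_derivative Y' t + Q' t) (at t)) at_top"
    using Y(1) Q(2) by eventually_elim (rule has_vector_derivative_add)
  show ?thesis
    by (intro exI[of _ Q] exI[of _ Q']) (use Q(1) d uv r in \<open>simp add: approx_solution_def b_def\<close>)
qed

lemma approx_solutions_exist:
  fixes A :: "real ^ 'n ^ 'n"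
  assumes A: "\<And>l. complex_eigenvalue A l \<Longrightarrow> Re l > 0"
    and F: "hom_expansion F \<beta> Fk" and \<gamma>: "\<gamma> > 0" "\<gamma> + \<delta> \<le> \<beta> 1 * \<gamma>" and a: "a \<noteq> 0"
    and Aa: "A *v a = \<xi>0" and f: "(\<lambda>t. f t - scale \<gamma> t *\<^sub>R \<xi>0) \<in> W (\<gamma> + \<delta>)"
  shows "\<exists>Q. (\<forall>j. Q j \<in> U (\<gamma> + real j * \<delta>)) \<and>
    (\<forall>n. \<exists>Y'. approx_solution A F f \<gamma> a n (\<lambda>t. \<Sum>j<Suc n. Q j t, Y'))"
proof -
  \<comment> \<open>The clause for n = 0 fixes the start; \<open>approx_solution\<close> by itself
    does not say that the first approximation is a finite sum of monomial terms.\<close>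
  have "\<exists>Ys. \<forall>n. approx_solution A F f \<gamma> a n (Ys n) \<and> (n = 0 \<longrightarrow> fst (Ys n) = (\<lambda>t. scale \<gamma> t *\<^sub>R a)) \<and>
    (\<lambda>t. fst (Ys (Suc n)) t - fst (Ys n) t) \<in> U (\<gamma> + real (Suc n) * \<delta>)"
  proof -
    have "\<exists>Ys. \<forall>n. (approx_solution A F f \<gamma> a n (Ys n) \<and> (n = 0 \<longrightarrow> fst (Ys n) = (\<lambda>t. scale \<gamma> t *\<^sub>R a))) \<and>
      (\<lambda>t. fst (Ys (Suc n)) t - fst (Ys n) t) \<in> U (\<gamma> + real (Suc n) * \<delta>)"
    proof (rule dependent_nat_choice)
      show "\<exists>x. approx_solution A F f \<gamma> a 0 x \<and> (0 = 0 \<longrightarrow> fst x = (\<lambda>t. scale \<gamma> t *\<^sub>R a))"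
        using approx_solution_init[OF F \<gamma> Aa f] by force
      fix x n assume "approx_solution A F f \<gamma> a n x \<and> (n = 0 \<longrightarrow> fst x = (\<lambda>t. scale \<gamma> t *\<^sub>R a))"
      then have x: "approx_solution A F f \<gamma> a n (fst x, snd x)" by simp
      obtain Q Q' where Q: "Q \<in> U (\<gamma> + real (Suc n) * \<delta>)"
        "approx_solution A F f \<gamma> a (Suc n) (\<lambda>t. fst x t + Q t, \<lambda>t. snd x t + Q' t)"
        using approx_solution_step[OF A F \<gamma> a x] by blast
      show "\<exists>y. (approx_solution A F f \<gamma> a (Suc n) y \<and> (Suc n = 0 \<longrightarrow> fst y = (\<lambda>t. scale \<gamma> t *\<^sub>R a))) \<and>
          (\<lambda>t. fst y t - fst x t) \<in> U (\<gamma> + real (Suc n) * \<delta>)"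
        using Q by (intro exI[of _ "(\<lambda>t. fst x t + Q t, \<lambda>t. snd x t + Q' t)"]) simp
    qed
    then show ?thesis by blast
  qed
  then obtain Ys where Ys: "\<And>n. approx_solution A F f \<gamma> a n (Ys n)" "fst (Ys 0) = (\<lambda>t. scale \<gamma> t *\<^sub>R a)"
    "\<And>n. (\<lambda>t. fst (Ys (Suc n)) t - fst (Ys n) t) \<in> U (\<gamma> + real (Suc n) * \<delta>)" by blast
  define Q where "Q j = (case j of 0 \<Rightarrow> fst (Ys 0) | Suc n \<Rightarrow> (\<lambda>t. fst (Ys (Suc n)) t - fst (Ys n) t))" for j
  have tel: "(\<lambda>t. \<Sum>j<Suc n. Q j t) = fst (Ys n)" for n
    by (induction n) (auto simp: Q_def fun_eq_iff)
  have "(\<lambda>t. scale \<gamma> t powr 1 *\<^sub>R a) \<in> U (1 * \<gamma>)" by (rule scale_powr_U)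
  then have "(\<lambda>t. scale \<gamma> t *\<^sub>R a) \<in> U \<gamma>" using scale_pos by (simp add: less_imp_le)
  then have "Q j \<in> U (\<gamma> + real j * \<delta>)" for j
    using Ys(3) by (cases j) (auto simp: Q_def Ys(2))
  moreover have "\<exists>Y'. approx_solution A F f \<gamma> a n (\<lambda>t. \<Sum>j<Suc n. Q j t, Y')" for n
    unfolding tel using Ys(1)[of n] by (intro exI[of _ "snd (Ys n)"]) simp
  ultimately show ?thesis by blast
qed

section \<open>Decay of exact solutions\<close>

lemma is_solution_eventually:
  assumes "is_solution A F f T0 y"
  obtains y' where "eventually (\<lambda>t. (y has_vector_derivative y' t) (at t)) at_top"
    "eventually (\<lambda>t. y' t + A *v y t = F (y t) + f t) at_top"
proof -
  obtain y' where y': "\<And>t. t \<ge> T0 \<Longrightarrow> (y has_vector_derivative y' t) (at t within {T0..})"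
    "\<And>t. t > T0 \<Longrightarrow> y' t + A *v y t = F (y t) + f t"
    using assms unfolding is_solution_def by blast
  have "(y has_vector_derivative y' t) (at t)" if "t > T0" for t
  proof -
    have "at t within {T0..} = at t" using that by (intro at_within_interior) simp
    then show ?thesis using y'(1)[of t] that by simp
  qed
  then show ?thesis
    using y'(2) by (intro that[of y'] eventually_mono[OF eventually_gt_at_top[of T0]])
qed

text \<open>F is superlinear at the origin and y tends to 0, so F along y is eventually at most
  \<open>\<epsilon> * norm (y t)\<close> and counts as a perturbation of A; only f remains as
  forcing.\<close>

lemma solution_small:
  fixes A :: "real ^ 'n ^ 'n"
  assumes A: "\<And>l. complex_eigenvalue A l \<Longrightarrow> Re l > 0"
    and F: "hom_expansion F \<beta> Fk" and f: "f \<in> small \<gamma>"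
    and y: "is_solution A F f T0 y" "(y \<longlongrightarrow> 0) at_top"
  shows "y \<in> small \<gamma>"
proof -
  obtain \<epsilon> where \<epsilon>: "\<epsilon> > 0" and dec: "\<And>w w' h a. eventually (\<lambda>t. (w has_vector_derivative w' t) (at t)) at_top \<Longrightarrow>
      eventually (\<lambda>t. norm (w' t + A *v w t) \<le> \<epsilon> * norm (w t) + norm (h t :: real)) at_top \<Longrightarrow>
      h \<in> small a \<Longrightarrow> w \<in> small a"
    using perturbed_decay_small[OF A] by blast
  obtain y' where y': "eventually (\<lambda>t. (y has_vector_derivative y' t) (at t)) at_top"
    "eventually (\<lambda>t. y' t + A *v y t = F (y t) + f t) at_top"
    using is_solution_eventually[OF y(1)] .
  obtain C r where C: "r > 0" "\<And>x. norm x < r \<Longrightarrow> norm (F x) \<le> C * norm x powr (\<beta> 1)"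
    using hom_expansion_bound[OF F] by blast
  have \<beta>1: "\<beta> 1 > 1" using F unfolding hom_expansion_def by simp
  have "((\<lambda>t. norm (y t) powr (\<beta> 1 - 1)) \<longlongrightarrow> 0 powr (\<beta> 1 - 1)) at_top"
    using \<beta>1 tendsto_norm_zero[OF y(2)] by (intro tendsto_powr2 tendsto_const) auto
  then have p0: "((\<lambda>t. norm (y t) powr (\<beta> 1 - 1)) \<longlongrightarrow> 0) at_top" using \<beta>1 by simp
  have "\<epsilon> / (\<bar>C\<bar> + 1) > 0" using \<epsilon> by simp
  from tendstoD[OF p0 this] tendstoD[OF y(2) C(1)]
  have Fy: "eventually (\<lambda>t. norm (F (y t)) \<le> \<epsilon> * norm (y t)) at_top"
  proof eventually_elim
    case (elim t)
    have "norm (F (y t)) \<le> C * norm (y t) powr (\<beta> 1)" using C(2) elim by (simp add: dist_norm)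
    also have "norm (y t) powr (\<beta> 1) = norm (y t) powr (\<beta> 1 - 1) * norm (y t)"
      by (cases "y t = 0") (simp_all add: powr_diff)
    also have "C * \<dots> \<le> (\<bar>C\<bar> + 1) * (\<epsilon> / (\<bar>C\<bar> + 1) * norm (y t))"
      using elim by (intro mult_mono mult_right_mono) auto
    also have "\<dots> = \<epsilon> * norm (y t)" by (simp add: add_nonneg_eq_0_iff)
    finally show ?case .
  qed
  show ?thesis
  proof (rule dec[OF y'(1)])
    show "(\<lambda>t. norm (f t)) \<in> small \<gamma>" by (rule small_dominated[OF f, of _ 1]) simp
    show "eventually (\<lambda>t. norm (y' t + A *v y t) \<le> \<epsilon> * norm (y t) + norm (norm (f t))) at_top"
      using y'(2) Fy
    proof eventually_elim
      case (elim t)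
      then show ?case using norm_triangle_ineq[of "F (y t)" "f t"] by simp
    qed
  qed
qed

lemma hom_expansion_small:
  assumes F: "hom_expansion F \<beta> Fk" and x: "x \<in> small \<gamma>" "\<gamma> > 0"
  shows "(\<lambda>t. F (x t)) \<in> small (\<beta> 1 * \<gamma>)"
proof -
  obtain C r where C: "r > 0" "\<And>x. norm x < r \<Longrightarrow> norm (F x) \<le> C * norm x powr (\<beta> 1)"
    using hom_expansion_bound[OF F] by blast
  have "\<beta> 1 > 1" using F unfolding hom_expansion_def by simp
  then have "(\<lambda>t. norm (x t) powr \<beta> 1) \<in> small (\<beta> 1 * \<gamma>)" by (intro small_powr[OF x(1)]) simp
  moreover have "eventually (\<lambda>t. norm (x t) < r) at_top"
    using tendstoD[OF small_tendsto_zero[OF x] C(1)] by (simp add: dist_norm)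
  then have "eventually (\<lambda>t. norm (F (x t)) \<le> C * norm (norm (x t) powr \<beta> 1)) at_top"
    by eventually_elim (use C(2) in simp)
  ultimately show ?thesis by (rule small_dominated)
qed

text \<open>Once y has order \<gamma>, F has order at least \<gamma> + \<delta> along y and along
  the leading term, so it may be treated as forcing without comparing its two values. The outcome is
  the direction of y, a prerequisite of \<open>nonlinearity_contraction\<close>.\<close>

lemma solution_leading_term:
  fixes A :: "real ^ 'n ^ 'n"
  assumes A: "\<And>l. complex_eigenvalue A l \<Longrightarrow> Re l > 0"
    and F: "hom_expansion F \<beta> Fk" and \<gamma>: "\<gamma> > 0" "\<gamma> + \<delta> \<le> \<beta> 1 * \<gamma>"
    and Aa: "A *v a = \<xi>0" and f: "(\<lambda>t. f t - scale \<gamma> t *\<^sub>R \<xi>0) \<in> W (\<gamma> + \<delta>)"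
    and y: "is_solution A F f T0 y" "(y \<longlongrightarrow> 0) at_top"
  shows "y \<in> small \<gamma>" "(\<lambda>t. y t - scale \<gamma> t *\<^sub>R a) \<in> small (\<gamma> + \<delta>)"
proof -
  obtain \<epsilon> where \<epsilon>: "\<epsilon> > 0" and dec: "\<And>w w' h a. eventually (\<lambda>t. (w has_vector_derivative w' t) (at t)) at_top \<Longrightarrow>
      eventually (\<lambda>t. norm (w' t + A *v w t) \<le> \<epsilon> * norm (w t) + norm (h t :: real)) at_top \<Longrightarrow>
      h \<in> small a \<Longrightarrow> w \<in> small a"
    using perturbed_decay_small[OF A] by blast
  have "(\<lambda>t. scale \<gamma> t powr 1 *\<^sub>R \<xi>0) \<in> small (1 * \<gamma>)" by (rule U_small[OF scale_powr_U])
  then have "(\<lambda>t. scale \<gamma> t *\<^sub>R \<xi>0) \<in> small \<gamma>" using scale_pos by (simp add: less_imp_le)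
  moreover have "(\<lambda>t. f t - scale \<gamma> t *\<^sub>R \<xi>0) \<in> small \<gamma>"
    by (rule small_mono[OF _ W_small[OF f]]) (use \<delta>_pos in simp)
  ultimately have "(\<lambda>t. (f t - scale \<gamma> t *\<^sub>R \<xi>0) + scale \<gamma> t *\<^sub>R \<xi>0) \<in> small \<gamma>"
    by (rule small_add[rotated])
  then have fs: "f \<in> small \<gamma>" by simp
  show ys: "y \<in> small \<gamma>" by (rule solution_small[OF A F fs y])
  obtain y' where y': "eventually (\<lambda>t. (y has_vector_derivative y' t) (at t)) at_top"
    "eventually (\<lambda>t. y' t + A *v y t = F (y t) + f t) at_top"
    using is_solution_eventually[OF y(1)] .
  obtain Y' where Y': "approx_solution A F f \<gamma> a 0 (\<lambda>t. scale \<gamma> t *\<^sub>R a, Y')"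
    using approx_solution_init[OF F \<gamma> Aa f] by blast
  have Fs: "(\<lambda>t. F (x t)) \<in> small (\<gamma> + \<delta>)" if "x \<in> small \<gamma>" for x
    by (rule small_mono[OF \<gamma>(2) hom_expansion_small[OF F that \<gamma>(1)]])
  have "(\<lambda>t. scale \<gamma> t powr 1 *\<^sub>R a) \<in> small (1 * \<gamma>)" by (rule U_small[OF scale_powr_U])
  then have ss: "(\<lambda>t. scale \<gamma> t *\<^sub>R a) \<in> small \<gamma>" using scale_pos by (simp add: less_imp_le)
  define h where "h t = norm (F (y t) - F (scale \<gamma> t *\<^sub>R a) - (Y' t + A *v (scale \<gamma> t *\<^sub>R a) - F (scale \<gamma> t *\<^sub>R a) - f t))" for t
  have "(\<lambda>t. F (y t) - F (scale \<gamma> t *\<^sub>R a) - (Y' t + A *v (scale \<gamma> t *\<^sub>R a) - F (scale \<gamma> t *\<^sub>R a) - f t)) \<in> small (\<gamma> + \<delta>)"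
    using Y' by (intro small_diff Fs ys ss W_small) (simp add: approx_solution_def)
  then have hs: "h \<in> small (\<gamma> + \<delta>)" by (rule small_dominated[of _ _ _ 1]) (simp add: h_def)
  show "(\<lambda>t. y t - scale \<gamma> t *\<^sub>R a) \<in> small (\<gamma> + \<delta>)"
  proof (rule dec[OF _ _ hs])
    have "eventually (\<lambda>t. ((\<lambda>t. scale \<gamma> t *\<^sub>R a) has_vector_derivative Y' t) (at t)) at_top"
      using Y' by (simp add: approx_solution_def)
    with y'(1) show "eventually (\<lambda>t. ((\<lambda>t. y t - scale \<gamma> t *\<^sub>R a) has_vector_derivative y' t - Y' t) (at t)) at_top"
      by eventually_elim (rule has_vector_derivative_diff)
    show "eventually (\<lambda>t. norm (y' t - Y' t + A *v (y t - scale \<gamma> t *\<^sub>R a)) \<le> \<epsilon> * norm (y t - scale \<gamma> t *\<^sub>R a) + norm (h t)) at_top"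
      using y'(2)
    proof eventually_elim
      case (elim t)
      have "y' t - Y' t + A *v (y t - scale \<gamma> t *\<^sub>R a) =
        F (y t) - F (scale \<gamma> t *\<^sub>R a) - (Y' t + A *v (scale \<gamma> t *\<^sub>R a) - F (scale \<gamma> t *\<^sub>R a) - f t)"
        using elim by (simp add: matrix_vector_mult_diff_distrib algebra_simps)
      then have "norm (y' t - Y' t + A *v (y t - scale \<gamma> t *\<^sub>R a)) = h t"
        unfolding h_def by (rule arg_cong)
      moreover have "0 \<le> \<epsilon> * norm (y t - scale \<gamma> t *\<^sub>R a)" using \<epsilon> by simp
      moreover have "h t \<le> norm (h t)" by simp
      ultimately show ?case by linarith
    qed
  qed
qed

text \<open>Both arguments point in the direction \<open>a\<close>, where each homogeneous part is Lipschitz, and the factor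
  \<open>scale\<^sup>\<beta>\<^sup>-\<^sup>1\<close> left over from homogeneity tends to 0.\<close>

lemma nonlinearity_contraction:
  assumes F: "hom_expansion F \<beta> Fk" and \<gamma>: "\<gamma> > 0" and a: "a \<noteq> 0"
    and u: "u \<in> small \<delta>" and v: "v \<in> small \<delta>" and B: "B > 0" and \<epsilon>: "\<epsilon> > 0"
    and x: "\<And>t. x t = scale \<gamma> t *\<^sub>R (a + u t)" and y: "\<And>t. y t = scale \<gamma> t *\<^sub>R (a + v t)"
  shows "\<exists>h \<in> small B. eventually (\<lambda>t. norm (F (x t) - F (y t)) \<le> \<epsilon> * norm (x t - y t) + norm (h t :: real)) at_top"
proof -
  have xs: "x \<in> small \<gamma>" using scaled_small[OF u, of \<gamma> a] by (simp add: x[abs_def, symmetric])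
  have ys: "y \<in> small \<gamma>" using scaled_small[OF v, of \<gamma> a] by (simp add: y[abs_def, symmetric])
  obtain N1 where N1: "\<And>N. N \<ge> N1 \<Longrightarrow> (\<lambda>t. F (x t) - (\<Sum>k=1..N. Fk k (x t))) \<in> small B"
    using hom_expansion_remainder_small[OF F xs \<gamma> B] by blast
  obtain N2 where N2: "\<And>N. N \<ge> N2 \<Longrightarrow> (\<lambda>t. F (y t) - (\<Sum>k=1..N. Fk k (y t))) \<in> small B"
    using hom_expansion_remainder_small[OF F ys \<gamma> B] by blast
  \<comment> \<open>Long enough for both tails to have order B; h collects them, and only N
    homogeneous parts are left to estimate.\<close>
  define N where "N = max N1 N2"
  define h where "h t = norm ((F (x t) - (\<Sum>k=1..N. Fk k (x t))) - (F (y t) - (\<Sum>k=1..N. Fk k (y t))))" for t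
  have "(\<lambda>t. (F (x t) - (\<Sum>k=1..N. Fk k (x t))) - (F (y t) - (\<Sum>k=1..N. Fk k (y t)))) \<in> small B"
    by (intro small_diff N1 N2) (auto simp: N_def)
  then have hs: "h \<in> small B" by (rule small_dominated[of _ _ _ 1]) (simp add: h_def)
  \<comment> \<open>An equal share of \<epsilon> for each of the N parts; the added 1 covers N =
    0.\<close>
  define \<eta> where "\<eta> = \<epsilon> / (real N + 1)"
  have \<eta>: "\<eta> > 0" using \<epsilon> by (simp add: \<eta>_def)
  have one: "eventually (\<lambda>t. norm (Fk k (x t) - Fk k (y t)) \<le> \<eta> * norm (x t - y t)) at_top" if k: "k \<in> {1..N}" for k
  proof -
    have hom: "Fk k \<in> pos_homogeneous (\<beta> k)" and sm: "smooth_on (- {0}) (Fk k)" and bk: "\<beta> k > 1"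
      using F k unfolding hom_expansion_def by auto
    have "cball a (norm a / 2) \<subseteq> - {0}" using a by (auto simp: dist_norm)
    then obtain C where C: "\<And>x y. x \<in> cball a (norm a / 2) \<Longrightarrow> y \<in> cball a (norm a / 2) \<Longrightarrow>
        norm (Fk k x - Fk k y) \<le> C * norm (x - y)"
      using smooth_on_locally_lipschitz[OF sm] by blast
    have n2: "norm a / 2 > 0" using a by simp
    have "(\<lambda>t. scale \<gamma> t powr (\<beta> k - 1) *\<^sub>R (1::real)) \<in> small ((\<beta> k - 1) * \<gamma>)" by (rule U_small[OF scale_powr_U])
    then have "((\<lambda>t. scale \<gamma> t powr (\<beta> k - 1) *\<^sub>R (1::real)) \<longlongrightarrow> 0) at_top"
      by (rule small_tendsto_zero) (use bk \<gamma> in simp)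
    then have s0: "((\<lambda>t. scale \<gamma> t powr (\<beta> k - 1)) \<longlongrightarrow> 0) at_top" by simp
    have "\<eta> / (\<bar>C\<bar> + 1) > 0" using \<eta> by simp
    from tendstoD[OF s0 this] tendstoD[OF small_tendsto_zero[OF u \<delta>_pos] n2]
      tendstoD[OF small_tendsto_zero[OF v \<delta>_pos] n2]
    show ?thesis
    proof eventually_elim
      case (elim t)
      define s where "s = scale \<gamma> t"
      have s: "s > 0" by (simp add: s_def scale_pos)
      have "norm (Fk k (x t) - Fk k (y t)) = s powr \<beta> k * norm (Fk k (a + u t) - Fk k (a + v t))"
        by (simp add: x y s_def[symmetric] pos_homogeneous_scale[OF hom s] scaleR_diff_right[symmetric])
      also have "\<dots> \<le> s powr \<beta> k * (C * norm (u t - v t))"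
        using C[of "a + u t" "a + v t"] elim(2,3) by (intro mult_left_mono) (auto simp: dist_norm)
      also have "s powr \<beta> k = s powr (\<beta> k - 1) * s" using s by (simp add: powr_diff)
      also have "s powr (\<beta> k - 1) * s * (C * norm (u t - v t)) = s powr (\<beta> k - 1) * C * norm (x t - y t)"
        using s by (simp add: x y s_def[symmetric] scaleR_diff_right[symmetric])
      also have "\<dots> \<le> \<eta> * norm (x t - y t)"
      proof (rule mult_right_mono)
        have "s powr (\<beta> k - 1) * C \<le> (\<eta> / (\<bar>C\<bar> + 1)) * (\<bar>C\<bar> + 1)"
        proof -
          have "s powr (\<beta> k - 1) * C \<le> s powr (\<beta> k - 1) * (\<bar>C\<bar> + 1)" by (intro mult_left_mono) auto
          also have "\<dots> \<le> (\<eta> / (\<bar>C\<bar> + 1)) * (\<bar>C\<bar> + 1)" using elim(1) by (intro mult_right_mono) (auto simp: s_def)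
          finally show ?thesis .
        qed
        then show "s powr (\<beta> k - 1) * C \<le> \<eta>" by (simp add: add_nonneg_eq_0_iff)
      qed simp
      finally show ?case .
    qed
  qed
  have "eventually (\<lambda>t. \<forall>k\<in>{1..N}. norm (Fk k (x t) - Fk k (y t)) \<le> \<eta> * norm (x t - y t)) at_top"
    by (intro eventually_ball_finite ballI one) auto
  then have "eventually (\<lambda>t. norm (F (x t) - F (y t)) \<le> \<epsilon> * norm (x t - y t) + norm (h t)) at_top"
  proof eventually_elim
    case (elim t)
    have eq: "F (x t) - F (y t) = (\<Sum>k=1..N. Fk k (x t) - Fk k (y t)) +
        ((F (x t) - (\<Sum>k=1..N. Fk k (x t))) - (F (y t) - (\<Sum>k=1..N. Fk k (y t))))"
      by (simp add: sum_subtractf)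
    have "norm (F (x t) - F (y t)) \<le> norm (\<Sum>k=1..N. Fk k (x t) - Fk k (y t)) + h t"
      unfolding h_def eq by (rule norm_triangle_ineq)
    also have "h t = norm (h t)" by (simp add: h_def)
    also have "norm (\<Sum>k=1..N. Fk k (x t) - Fk k (y t)) \<le> (\<Sum>k=1..N. \<eta> * norm (x t - y t))"
      using elim by (intro sum_norm_le) auto
    also have "\<dots> = real N * \<eta> * norm (x t - y t)" by simp
    also have "\<dots> \<le> \<epsilon> * norm (x t - y t)"
      using \<epsilon> by (intro mult_right_mono) (auto simp: \<eta>_def field_simps)
    finally show ?case by simp
  qed
  then show ?thesis using hs by blast
qed

lemma solution_expansion:
  fixes A :: "real ^ 'n ^ 'n"
  assumes A: "\<And>l. complex_eigenvalue A l \<Longrightarrow> Re l > 0"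
    and F: "hom_expansion F \<beta> Fk" and \<gamma>: "\<gamma> > 0" "\<gamma> + \<delta> \<le> \<beta> 1 * \<gamma>" and a: "a \<noteq> 0"
    and Aa: "A *v a = \<xi>0" and f: "(\<lambda>t. f t - scale \<gamma> t *\<^sub>R \<xi>0) \<in> W (\<gamma> + \<delta>)"
    and y: "is_solution A F f T0 y" "(y \<longlongrightarrow> 0) at_top"
    and Y: "approx_solution A F f \<gamma> a n (Y, Y')"
  shows "(\<lambda>t. y t - Y t) \<in> small (\<gamma> + real (Suc n) * \<delta>)"
proof -
  define b where "b = \<gamma> + real (Suc n) * \<delta>"
  have b: "b > 0" using \<gamma>(1) \<delta>_pos by (simp add: b_def add_pos_nonneg)
  obtain \<epsilon> where \<epsilon>: "\<epsilon> > 0" and dec: "\<And>w w' h a. eventually (\<lambda>t. (w has_vector_derivative w' t) (at t)) at_top \<Longrightarrow>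
      eventually (\<lambda>t. norm (w' t + A *v w t) \<le> \<epsilon> * norm (w t) + norm (h t :: real)) at_top \<Longrightarrow>
      h \<in> small a \<Longrightarrow> w \<in> small a"
    using perturbed_decay_small[OF A] by blast
  have Y: "eventually (\<lambda>t. (Y has_vector_derivative Y' t) (at t)) at_top"
     "(\<lambda>t. scale \<gamma> t powr (-1) *\<^sub>R Y t - a) \<in> W \<delta>"
     "(\<lambda>t. Y' t + A *v Y t - F (Y t) - f t) \<in> W b"
    using Y by (auto simp: approx_solution_def b_def)
  obtain y' where y': "eventually (\<lambda>t. (y has_vector_derivative y' t) (at t)) at_top"
    "eventually (\<lambda>t. y' t + A *v y t = F (y t) + f t) at_top"
    using is_solution_eventually[OF y(1)] .
  have sc: "scale \<gamma> t *\<^sub>R (scale \<gamma> t powr (-1) *\<^sub>R x) = x" "scale \<gamma> t powr (-1) *\<^sub>R (scale \<gamma> t *\<^sub>R x) = x"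
    for t and x :: "real ^ 'n"
    using scale_pos[of \<gamma> t] by (simp_all add: powr_minus)
  \<comment> \<open>The leading-order result for y enters here: it says that u has order \<delta>,
    so y points in the direction a.\<close>
  define u where "u t = scale \<gamma> t powr (-1) *\<^sub>R (y t - scale \<gamma> t *\<^sub>R a)" for t
  define v where "v t = scale \<gamma> t powr (-1) *\<^sub>R Y t - a" for t
  have "u \<in> small (-1 * \<gamma> + (\<gamma> + \<delta>))"
    unfolding u_def[abs_def] by (rule small_W_scale[OF solution_leading_term(2)[OF A F \<gamma> Aa f y]])
  then have u: "u \<in> small \<delta>" by simp
  have v: "v \<in> small \<delta>" using W_small[OF Y(2)] by (simp add: v_def[abs_def])
  have yu: "y t = scale \<gamma> t *\<^sub>R (a + u t)" for t
    unfolding scaleR_add_right u_def sc(1) by simp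
  have Yv: "Y t = scale \<gamma> t *\<^sub>R (a + v t)" for t
  proof -
    have "a + v t = scale \<gamma> t powr (-1) *\<^sub>R Y t" by (simp add: v_def)
    then show ?thesis by (simp only: sc)
  qed
  obtain h where h: "h \<in> small b"
    "eventually (\<lambda>t. norm (F (y t) - F (Y t)) \<le> \<epsilon> * norm (y t - Y t) + norm (h t :: real)) at_top"
    using nonlinearity_contraction[OF F \<gamma>(1) a u v b \<epsilon> yu Yv] by blast
  define g where "g t = norm (h t) + norm (Y' t + A *v Y t - F (Y t) - f t)" for t
  have "(\<lambda>t. norm (h t)) \<in> small b" by (rule small_dominated[OF h(1), of _ 1]) simp
  moreover have "(\<lambda>t. norm (Y' t + A *v Y t - F (Y t) - f t)) \<in> small b"
    by (rule small_dominated[OF W_small[OF Y(3)], of _ 1]) simp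
  ultimately have gs: "g \<in> small b" unfolding g_def[abs_def] by (rule small_add)
  have "(\<lambda>t. y t - Y t) \<in> small b"
  proof (rule dec[OF _ _ gs])
    show "eventually (\<lambda>t. ((\<lambda>t. y t - Y t) has_vector_derivative y' t - Y' t) (at t)) at_top"
      using y'(1) Y(1) by eventually_elim (rule has_vector_derivative_diff)
    show "eventually (\<lambda>t. norm (y' t - Y' t + A *v (y t - Y t)) \<le> \<epsilon> * norm (y t - Y t) + norm (g t)) at_top"
      using y'(2) h(2)
    proof eventually_elim
      case (elim t)
      have "y' t - Y' t + A *v (y t - Y t) = (F (y t) - F (Y t)) - (Y' t + A *v Y t - F (Y t) - f t)"
        using elim by (simp add: matrix_vector_mult_diff_distrib algebra_simps)
      then have "norm (y' t - Y' t + A *v (y t - Y t)) \<le>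
          norm (F (y t) - F (Y t)) + norm (Y' t + A *v Y t - F (Y t) - f t)"
        by (metis norm_triangle_ineq4)
      then show ?case using elim(2) by (simp add: g_def)
    qed
  qed
  then show ?thesis by (simp add: b_def)
qed

theorem common_expansion:
  fixes A :: "real ^ 'n ^ 'n"
  assumes A: "\<And>l. complex_eigenvalue A l \<Longrightarrow> Re l > 0"
    and F: "hom_expansion F \<beta> Fk" and \<gamma>: "\<gamma> > 0" "\<gamma> + \<delta> \<le> \<beta> 1 * \<gamma>" and a: "a \<noteq> 0"
    and Aa: "A *v a = \<xi>0" and f: "(\<lambda>t. f t - scale \<gamma> t *\<^sub>R \<xi>0) \<in> W (\<gamma> + \<delta>)"
  shows "\<exists>Q. (\<forall>j. Q j \<in> U (\<gamma> + real j * \<delta>)) \<and>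
    (\<forall>T0 y. is_solution A F f T0 y \<and> (y \<longlongrightarrow> 0) at_top \<longrightarrow>
      (\<forall>N. (\<lambda>t. y t - (\<Sum>j<N. Q j t)) \<in> small (\<gamma> + real N * \<delta>)))"
proof -
  obtain Q where Q: "\<And>j. Q j \<in> U (\<gamma> + real j * \<delta>)"
    "\<And>n. \<exists>Y'. approx_solution A F f \<gamma> a n (\<lambda>t. \<Sum>j<Suc n. Q j t, Y')"
    using approx_solutions_exist[OF A F \<gamma> a Aa f] by blast
  have "(\<lambda>t. y t - (\<Sum>j<N. Q j t)) \<in> small (\<gamma> + real N * \<delta>)"
    if y: "is_solution A F f T0 y" "(y \<longlongrightarrow> 0) at_top" for T0 y N
  proof (cases N)
    case 0
    then show ?thesis using solution_leading_term(1)[OF A F \<gamma> Aa f y] by simp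
  next
    case (Suc n)
    obtain Y' where "approx_solution A F f \<gamma> a n (\<lambda>t. \<Sum>j<Suc n. Q j t, Y')" using Q(2) by blast
    from solution_expansion[OF A F \<gamma> a Aa f y this] show ?thesis by (simp only: Suc)
  qed
  then show ?thesis using Q(1) by blast
qed

end

section \<open>Regrouping the series by order\<close>

text \<open>Above every real number M has a next element, since it is unbounded with finitely many
  elements below any bound. Iterating from the least element skips none, and it passes every x
  because infinitely many values cannot stay below x.\<close>

lemma locally_finite_enumeration:
  fixes M :: "real set"
  assumes "infinite M" "\<And>B. finite (M \<inter> {..B})"
  obtains f :: "nat \<Rightarrow> real" where "strict_mono f" "range f = M"
proof -
  have next_ex: "\<exists>y\<in>M. x < y \<and> M \<inter> {x<..<y} = {}" for x
  proof -
    have "\<not> M \<subseteq> M \<inter> {..x}" using assms finite_subset by blast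
    then obtain b where b: "b \<in> M" "b > x" by force
    have fin: "finite (M \<inter> {x<..b})" by (rule finite_subset[OF _ assms(2)[of b]]) auto
    have ne: "M \<inter> {x<..b} \<noteq> {}" using b by auto
    define y where "y = Min (M \<inter> {x<..b})"
    have y: "y \<in> M \<inter> {x<..b}" unfolding y_def by (rule Min_in[OF fin ne])
    have "z \<ge> y" if "z \<in> M \<inter> {x<..b}" for z unfolding y_def by (rule Min_le[OF fin that])
    then have "M \<inter> {x<..<y} = {}" using y by force
    then show ?thesis using y by auto
  qed
  have first_ex: "\<exists>y\<in>M. M \<inter> {..<y} = {}"
  proof -
    obtain b where b: "b \<in> M" using assms(1) by (metis ex_in_conv finite.emptyI)
    have ne: "M \<inter> {..b} \<noteq> {}" using b by auto
    define y where "y = Min (M \<inter> {..b})"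
    have y: "y \<in> M \<inter> {..b}" unfolding y_def by (rule Min_in[OF assms(2) ne])
    have "z \<ge> y" if "z \<in> M \<inter> {..b}" for z unfolding y_def by (rule Min_le[OF assms(2) that])
    then have "M \<inter> {..<y} = {}" using y by force
    then show ?thesis using y by auto
  qed
  have "\<exists>f. \<forall>n. (f n \<in> M \<and> (n = 0 \<longrightarrow> M \<inter> {..<f n} = {})) \<and> (f n < f (Suc n) \<and> M \<inter> {f n<..<f (Suc n)} = {})"
  proof (rule dependent_nat_choice)
    show "\<exists>x. x \<in> M \<and> (0 = 0 \<longrightarrow> M \<inter> {..<x} = {})" using first_ex by blast
    show "\<exists>y. (y \<in> M \<and> (Suc n = 0 \<longrightarrow> M \<inter> {..<y} = {})) \<and> x < y \<and> M \<inter> {x<..<y} = {}" for x and n :: nat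
    proof -
      obtain y where "y \<in> M \<and> x < y \<and> M \<inter> {x<..<y} = {}" using next_ex[of x] by blast
      then show ?thesis by (intro exI[of _ y]) simp
    qed
  qed
  then obtain f where F: "\<forall>n. (f n \<in> M \<and> (n = 0 \<longrightarrow> M \<inter> {..<f n} = {})) \<and>
    (f n < f (Suc n) \<and> M \<inter> {f n<..<f (Suc n)} = {})" ..
  have f: "f n \<in> M" "M \<inter> {..<f 0} = {}" "f n < f (Suc n)" "M \<inter> {f n<..<f (Suc n)} = {}" for n
    using spec[OF F, of n] spec[OF F, of 0] by simp_all
  have sm: "strict_mono f" using f(3) by (simp add: strict_mono_Suc_iff)
  have "x \<in> range f" if x: "x \<in> M" for x
  proof -
    have "\<exists>n. x < f n"
    proof (rule ccontr)
      assume "\<not> (\<exists>n. x < f n)"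
      then have "range f \<subseteq> M \<inter> {..x}" using f(1) by (auto simp: not_less)
      then have "finite (range f)" using assms(2) finite_subset by blast
      moreover have "inj f" using sm by (rule strict_mono_imp_inj_on)
      ultimately show False using range_inj_infinite by blast
    qed
    then have ex: "\<exists>n. x < f n" .
    define n where "n = (LEAST n. x < f n)"
    have n: "x < f n" unfolding n_def by (rule LeastI_ex[OF ex])
    have n_min: "\<not> x < f k" if "k < n" for k
      using that unfolding n_def by (rule not_less_Least)
    show ?thesis
    proof (cases n)
      case 0
      then show ?thesis using f(2) x n by auto
    next
      case (Suc k)
      then have "f k \<le> x" using n_min[of k] by simp
      moreover have "\<not> f k < x" using f(4)[of k] x n Suc by auto
      ultimately show ?thesis by auto
    qed
  qed
  then show ?thesis using that[OF sm] f(1) by blast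
qed

lemma cnj_tuple_power:
  assumes "z \<in> pos_tuples k"
  shows "cnj (tuple_power k z \<alpha>) = tuple_power k z (cnj \<circ> \<alpha>)"
  unfolding tuple_power_def cnj_prod
proof (rule prod.cong[OF refl])
  fix j assume "j \<in> {-1..k}"
  then have "z j > 0" using assms by (auto simp: pos_tuples_def)
  then show "cnj (complex_of_real (z j) powr \<alpha> j) = complex_of_real (z j) powr (cnj \<circ> \<alpha>) j"
    by (simp add: powr_def exp_cnj Ln_of_real)
qed

text \<open>Collects terms with equal index: p need not be injective, as different terms may carry
  the same powers.\<close>

lemma sum_deltas:
  fixes h :: "'s \<Rightarrow> complex" and A :: "'x \<Rightarrow> complex ^ 'd"
  assumes "finite S" "finite I" "\<And>x. x \<in> I \<Longrightarrow> p x \<in> S"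
  shows "(\<Sum>s\<in>S. h s *s (\<Sum>x\<in>I. if p x = s then A x else 0)) = (\<Sum>x\<in>I. h (p x) *s A x)"
proof -
  have "(\<Sum>s\<in>S. h s *s (\<Sum>x\<in>I. if p x = s then A x else 0)) =
     (\<Sum>s\<in>S. \<Sum>x\<in>I. if p x = s then h s *s A x else 0)"
    by (intro sum.cong refl) (auto simp: vec.scale_sum_right intro!: sum.cong)
  also have "\<dots> = (\<Sum>x\<in>I. \<Sum>s\<in>S. if p x = s then h s *s A x else 0)" by (rule sum.swap)
  also have "\<dots> = (\<Sum>x\<in>I. h (p x) *s A x)"
    using assms by (intro sum.cong refl) simp
  finally show ?thesis .
qed

text \<open>Adding the conjugate power vectors with conjugate coefficients turns a real part into a sum of powers.\<close>

lemma real_part_sum_in_hatP: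
  fixes c :: "'x \<Rightarrow> complex" and v :: "'x \<Rightarrow> real ^ 'd"
  assumes I: "finite I" and \<alpha>: "\<And>x. x \<in> I \<Longrightarrow> \<alpha> x \<in> power_vectors m k \<mu>"
  shows "(\<lambda>z w. \<Sum>x\<in>I. Re (c x * (tuple_power k z (\<alpha> x) * of_real (w powr \<beta> x))) *\<^sub>R v x) \<in> hatP m k \<mu>"
    (is "?q \<in> _")
proof -
  define p where "p x = (\<alpha> x, \<beta> x)" for x
  define p' where "p' x = (cnj \<circ> \<alpha> x, \<beta> x)" for x
  define A where "A x = (c x / 2) *s complexify (v x)" for x
  define A' where "A' x = (cnj (c x) / 2) *s complexify (v x)" for x
  define S where "S = p ` I \<union> p' ` I"
  \<comment> \<open>Terms may share a power vector, and a real power vector coincides with its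
    conjugate; in all these cases the contributions add up.\<close>
  define \<xi> where "\<xi> s = (\<Sum>x\<in>I. if p x = s then A x else 0) + (\<Sum>x\<in>I. if p' x = s then A' x else 0)" for s
  have cc: "cnj \<circ> (cnj \<circ> a) = a" for a :: "int \<Rightarrow> complex" by (auto simp: fun_eq_iff)
  have cv: "cnj_vec (u + w) = cnj_vec u + cnj_vec w" for u w :: "complex ^ 'd"
    by (simp add: cnj_vec_def vec_eq_iff)
  have cv0: "cnj_vec (0 :: complex ^ 'd) = 0" by (simp add: cnj_vec_def vec_eq_iff)
  have cvs: "cnj_vec (\<Sum>x\<in>J. g x) = (\<Sum>x\<in>J. cnj_vec (g x))" for J :: "'x set" and g :: "'x \<Rightarrow> complex ^ 'd"
    by (induction J rule: infinite_finite_induct) (simp_all add: cv cv0)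
  have cA: "cnj_vec (A x) = A' x" "cnj_vec (A' x) = A x" for x
    by (simp_all add: A_def A'_def cnj_vec_def complexify_def vec_eq_iff)
  have pS: "p x = (cnj \<circ> a, b) \<longleftrightarrow> p' x = (a, b)" "p' x = (cnj \<circ> a, b) \<longleftrightarrow> p x = (a, b)" for x a b
  proof -
    have "u = cnj \<circ> a \<longleftrightarrow> cnj \<circ> u = a" for u
      using cc[of a] cc[of u] by auto
    then show "p x = (cnj \<circ> a, b) \<longleftrightarrow> p' x = (a, b)" by (simp add: p_def p'_def)
    have "cnj \<circ> u = cnj \<circ> a \<longleftrightarrow> u = a" for u by (auto simp: fun_eq_iff)
    then show "p' x = (cnj \<circ> a, b) \<longleftrightarrow> p x = (a, b)" by (simp add: p_def p'_def)
  qed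
  have \<xi>c: "\<xi> (cnj \<circ> a, b) = cnj_vec (\<xi> (a, b))" for a b
  proof -
    have "cnj_vec (\<xi> (a, b)) = (\<Sum>x\<in>I. if p x = (a, b) then A' x else 0) + (\<Sum>x\<in>I. if p' x = (a, b) then A x else 0)"
      unfolding \<xi>_def cv cvs by (simp add: if_distrib[of cnj_vec] cv0 cA cong: if_cong)
    then show ?thesis unfolding \<xi>_def pS by (simp add: add.commute)
  qed
  have fin: "finite S" using I by (simp add: S_def)
  have pv: "a \<in> power_vectors m k \<mu>" if "(a, b) \<in> S" for a b
    using that \<alpha> by (auto simp: S_def p_def p'_def power_vectors_def tuples_def)
  have cl: "(cnj \<circ> a, b) \<in> S" if "(a, b) \<in> S" for a b
  proof -
    from that consider x where "x \<in> I" "p x = (a, b)" | x where "x \<in> I" "p' x = (a, b)"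
      unfolding S_def by force
    then show ?thesis
    proof cases
      case 1
      then have "p' x = (cnj \<circ> a, b)" by (simp add: pS)
      then show ?thesis using 1(1) unfolding S_def by force
    next
      case 2
      then have "p x = (cnj \<circ> a, b)" by (simp add: pS)
      then show ?thesis using 2(1) unfolding S_def by force
    qed
  qed
  have val: "complexify (?q z w) = (\<Sum>(a, b)\<in>S. (tuple_power k z a * complex_of_real (w powr b)) *s \<xi> (a, b))"
    if z: "z \<in> pos_tuples k" for z w
  proof -
    define h where "h s = tuple_power k z (fst s) * complex_of_real (w powr (snd s))" for s :: "(int \<Rightarrow> complex) \<times> real"
    have hp': "h (p' x) = cnj (h (p x))" for x
      by (simp add: h_def p_def p'_def cnj_tuple_power[OF z])
    have "(\<Sum>(a, b)\<in>S. (tuple_power k z a * complex_of_real (w powr b)) *s \<xi> (a, b)) = (\<Sum>s\<in>S. h s *s \<xi> s)"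
      by (rule sum.cong) (auto simp: h_def)
    also have "\<dots> = (\<Sum>s\<in>S. h s *s (\<Sum>x\<in>I. if p x = s then A x else 0)) + (\<Sum>s\<in>S. h s *s (\<Sum>x\<in>I. if p' x = s then A' x else 0))"
      by (simp add: \<xi>_def vector_add_ldistrib sum.distrib)
    also have "\<dots> = (\<Sum>x\<in>I. h (p x) *s A x) + (\<Sum>x\<in>I. h (p' x) *s A' x)"
      using fin I by (intro arg_cong2[of _ _ _ _ "(+)"] sum_deltas) (auto simp: S_def)
    also have "\<dots> = (\<Sum>x\<in>I. h (p x) *s A x + h (p' x) *s A' x)" by (simp add: sum.distrib)
    also have "\<dots> = (\<Sum>x\<in>I. complexify (Re (c x * h (p x)) *\<^sub>R v x))"
    proof (rule sum.cong[OF refl])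
      fix x
      have eq: "h (p x) * (c x / 2) + cnj (h (p x)) * (cnj (c x) / 2) = complex_of_real (Re (c x * h (p x)))"
        by (simp add: complex_eq_iff field_simps)
      have "h (p x) * (c x / 2 * r) + cnj (h (p x)) * (cnj (c x) / 2 * r) = complex_of_real (Re (c x * h (p x))) * r" for r
        using arg_cong[OF eq, of "\<lambda>u. u * r"] by (simp only: distrib_right mult.assoc)
      then show "h (p x) *s A x + h (p' x) *s A' x = complexify (Re (c x * h (p x)) *\<^sub>R v x)"
        by (simp only: hp' A_def A'_def vec_eq_iff vector_add_component vector_smult_component complexify_def
            vec_lambda_beta vector_scaleR_component real_scaleR_def of_real_mult simp_thms)
    qed
    also have "\<dots> = complexify (\<Sum>x\<in>I. Re (c x * h (p x)) *\<^sub>R v x)"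
      by (simp add: complexify_def vec_eq_iff)
    finally show ?thesis by (simp add: h_def p_def)
  qed
  have "hat_power_sum k S \<xi> ?q"
    unfolding hat_power_sum_def
    using fin pv cl \<xi>c val by (auto simp: power_vectors_def)
  then show ?thesis unfolding hatP_def using pv by blast
qed

section \<open>Landau bounds, the forcing term, and sorting of terms by order\<close>

context log_scale
begin

lemma bigo_small:
  assumes "(\<lambda>t. norm (g t)) \<in> O[at_top](\<lambda>t. L t powr (- \<mu>))"
  shows "g \<in> small \<mu>"
  unfolding small_def
proof (intro CollectI allI impI)
  fix b assume b: "b < \<mu>"
  obtain C where C: "C > 0" "eventually (\<lambda>t. norm (norm (g t)) \<le> C * norm (L t powr (- \<mu>))) at_top"
    using landau_o.bigE[OF assms] by blast
  have "eventually (\<lambda>t. norm (g t) \<le> C * L t powr (-b)) at_top"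
    using C(2) iter_log_ge[of 1 "int m"]
  proof eventually_elim
    case (elim t)
    have "L t powr (- \<mu>) \<le> L t powr (-b)" using elim(2) b by (intro powr_mono) auto
    then have "C * L t powr (- \<mu>) \<le> C * L t powr (-b)" using C(1) by simp
    then show ?case using elim(1) by simp
  qed
  then show "\<exists>C. eventually (\<lambda>t. norm (g t) \<le> C * L t powr (-b)) at_top" by blast
qed

lemma small_bigo:
  assumes "g \<in> small \<mu>" "\<nu> < \<mu>"
  shows "(\<lambda>t. norm (g t)) \<in> O[at_top](\<lambda>t. L t powr (- \<nu>))"
proof -
  obtain C where C: "C > 0" "eventually (\<lambda>t. norm (g t) \<le> C * L t powr (- \<nu>)) at_top"
    using smallE[OF assms] .
  show ?thesis by (rule landau_o.bigI[OF C(1)]) (use C(2) in simp)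
qed

lemma vecP_U:
  fixes p :: "(int \<Rightarrow> real) \<Rightarrow> real ^ 'n"
  assumes "p \<in> vecP (int m) k (- g)"
  shows "\<exists>P\<in>U g. eventually (\<lambda>t. p (log_tuple k t) = P t) at_top"
proof -
  obtain S \<xi> where S: "power_sum k S \<xi> p" "S \<subseteq> power_vectors (int m) k (- g)"
    using assms unfolding vecP_def by blast
  have fin: "finite S" "S \<subseteq> tuples k" using S(1) by (auto simp: power_sum_def)
  define \<psi> where "\<psi> \<alpha> x = (\<chi> i. Re (x * \<xi> \<alpha> $ i))" for \<alpha> x
  have lin: "linear (\<psi> \<alpha>)" for \<alpha> by (rule linearI) (auto simp: \<psi>_def vec_eq_iff algebra_simps)
  have "(\<lambda>t. \<Sum>\<alpha>\<in>S. \<psi> \<alpha> (mon \<alpha> 0 t)) \<in> U g"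
  proof (rule U_sum)
    fix \<alpha> assume "\<alpha> \<in> S"
    then have "\<alpha> \<in> exps g" using S(2) by (auto simp: power_vectors_def exps_def)
    then show "(\<lambda>t. \<psi> \<alpha> (mon \<alpha> 0 t)) \<in> U g" by (rule U_linear[OF mon_U lin])
  qed
  moreover have "eventually (\<lambda>t. \<forall>\<alpha>\<in>S. tuple_power k (log_tuple k t) \<alpha> = log_power \<alpha> t) at_top"
    using fin by (intro eventually_ball_finite) (auto intro: tuple_power_log_tuple)
  then have "eventually (\<lambda>t. p (log_tuple k t) = (\<Sum>\<alpha>\<in>S. \<psi> \<alpha> (mon \<alpha> 0 t))) at_top"
    using log_tuple_pos[of k]
  proof eventually_elim
    case (elim t)
    have "complexify (p (log_tuple k t)) = (\<Sum>\<alpha>\<in>S. log_power \<alpha> t *s \<xi> \<alpha>)"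
      using S(1) elim unfolding power_sum_def by auto
    then have "complexify (p (log_tuple k t)) $ i = (\<Sum>\<alpha>\<in>S. log_power \<alpha> t *s \<xi> \<alpha>) $ i" for i by simp
    then have "complex_of_real (p (log_tuple k t) $ i) = (\<Sum>\<alpha>\<in>S. log_power \<alpha> t * \<xi> \<alpha> $ i)" for i
      by (simp add: complexify_def)
    then have "p (log_tuple k t) $ i = Re (\<Sum>\<alpha>\<in>S. log_power \<alpha> t * \<xi> \<alpha> $ i)" for i
      by (metis Re_complex_of_real)
    then show ?case by (simp add: vec_eq_iff \<psi>_def mon_def)
  qed
  ultimately show ?thesis by - (rule bexI; assumption)
qed

lemma vecP_W:
  fixes p :: "(int \<Rightarrow> real) \<Rightarrow> real ^ 'n"
  assumes "p \<in> vecP (int m) k (- g)"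
  shows "(\<lambda>t. p (log_tuple k t)) \<in> W g"
proof -
  obtain P where "P \<in> U g" "eventually (\<lambda>t. p (log_tuple k t) = P t) at_top"
    using vecP_U[OF assms] ..
  then show ?thesis by (intro W_cong[OF W_U])
qed

lemma forcing_f1_W:
  assumes f: "forcing_f1 f m \<gamma> nt p" and \<delta>: "\<gamma> 1 + \<delta> \<le> \<gamma> 2"
  shows "(\<lambda>t. f t - p 1 (log_tuple (int (nt 1)) t)) \<in> W (\<gamma> 1 + \<delta>)"
\<comment> \<open>Shifted by one because the leading term \<open>p 1\<close> has been
  subtracted.\<close>
proof (rule W_asymptotic_sum[where e = "\<lambda>k. \<gamma> (Suc k)" and E = "\<lambda>k t. p (Suc k) (log_tuple (int (nt (Suc k))) t)"])
  fix k :: nat assume k: "k \<ge> 1"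
  show "(\<lambda>t. p (Suc k) (log_tuple (int (nt (Suc k))) t)) \<in> W (\<gamma> (Suc k))"
    by (rule vecP_W) (use f in \<open>simp add: forcing_f1_def\<close>)
  have "strict_mono_on {1..} \<gamma>" using f by (simp add: forcing_f1_def)
  then have "\<gamma> 2 \<le> \<gamma> (Suc k)" by (rule strict_mono_on_leD) (use k in auto)
  then show "\<gamma> 1 + \<delta> \<le> \<gamma> (Suc k)" using \<delta> by linarith
next
  have lim: "filterlim \<gamma> at_top sequentially" using f unfolding forcing_f1_def by blast
  then show "filterlim (\<lambda>k. \<gamma> (Suc k)) at_top sequentially" by (simp add: filterlim_sequentially_Suc)
  fix B :: real assume "B > 0"
  obtain N0 where N0: "\<And>N. N \<ge> N0 \<Longrightarrow> \<gamma> N \<ge> B"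
    using lim unfolding filterlim_at_top eventually_sequentially by blast
  show "\<exists>N0. \<forall>N\<ge>N0. (\<lambda>t. f t - p 1 (log_tuple (int (nt 1)) t) -
      (\<Sum>k=1..N. p (Suc k) (log_tuple (int (nt (Suc k))) t))) \<in> small B"
  proof (intro exI[of _ N0] allI impI)
    fix N assume N: "N \<ge> N0"
    have "Suc N \<ge> 1" by simp
    then obtain \<mu> where \<mu>: "\<mu> > \<gamma> (Suc N)"
      "(\<lambda>t. norm (f t - (\<Sum>k=1..Suc N. p k (log_tuple (int (nt k)) t)))) \<in> O[at_top](\<lambda>t. L t powr (- \<mu>))"
      using f unfolding forcing_f1_def by blast
    have "B \<le> \<mu>" using \<mu>(1) N0[of "Suc N"] N by simp
    then have "(\<lambda>t. f t - (\<Sum>k=1..Suc N. p k (log_tuple (int (nt k)) t))) \<in> small B"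
      by (rule small_mono[OF _ bigo_small[OF \<mu>(2)]])
    moreover have "(\<Sum>k=1..Suc N. p k (log_tuple (int (nt k)) t)) =
      p 1 (log_tuple (int (nt 1)) t) + (\<Sum>k=1..N. p (Suc k) (log_tuple (int (nt (Suc k))) t))" for t
      by (induction N) (simp_all add: add.assoc)
    ultimately show "(\<lambda>t. f t - p 1 (log_tuple (int (nt 1)) t) -
      (\<Sum>k=1..N. p (Suc k) (log_tuple (int (nt (Suc k))) t))) \<in> small B"
      by (simp add: diff_diff_eq)
  qed
qed

lemma forcing_f2_W:
  assumes f: "forcing_f2 f m K \<gamma> ns p" and \<delta>: "K \<ge> 2 \<Longrightarrow> \<gamma> 1 + \<delta> \<le> \<gamma> 2"
  shows "(\<lambda>t. f t - p 1 (log_tuple (int ns) t)) \<in> W (\<gamma> 1 + \<delta>)"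
proof -
  have "(\<lambda>t. f t - (\<Sum>k=1..K. p k (log_tuple (int ns) t))) \<in> small b" for b
  proof -
    \<comment> \<open>The finite case bounds the remainder at exponents above
      \<open>\<gamma> K\<close>; the maximum reaches every order b.\<close>
    have "(\<lambda>t. f t - (\<Sum>k=1..K. p k (log_tuple (int ns) t))) \<in> small (max b (\<gamma> K + 1))"
      using f by (intro bigo_small) (auto simp: forcing_f2_def less_max_iff_disj)
    then show ?thesis by (rule small_mono[rotated]) simp
  qed
  then have 1: "(\<lambda>t. f t - (\<Sum>k=1..K. p k (log_tuple (int ns) t))) \<in> W (\<gamma> 1 + \<delta>)" by (rule W_negligible)
  have 2: "(\<lambda>t. \<Sum>k=2..K. p k (log_tuple (int ns) t)) \<in> W (\<gamma> 1 + \<delta>)"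
  proof (rule W_sum)
    fix k assume k: "k \<in> {2..K}"
    have "p k \<in> vecP (int m) (int ns) (- \<gamma> k)" using f k by (simp add: forcing_f2_def)
    then have "(\<lambda>t. p k (log_tuple (int ns) t)) \<in> W (\<gamma> k)" by (rule vecP_W)
    moreover have "strict_mono_on {1..K} \<gamma>" using f by (simp add: forcing_f2_def)
    then have "\<gamma> 2 \<le> \<gamma> k" by (rule strict_mono_on_leD) (use k in auto)
    then have "\<gamma> 1 + \<delta> \<le> \<gamma> k" using \<delta> k by simp
    ultimately show "(\<lambda>t. p k (log_tuple (int ns) t)) \<in> W (\<gamma> 1 + \<delta>)"
      by (rule W_mono)
  qed
  have "K \<ge> 1" using f by (simp add: forcing_f2_def)
  then have "(\<Sum>k=1..K. p k (log_tuple (int ns) t)) = p 1 (log_tuple (int ns) t) + (\<Sum>k=2..K. p k (log_tuple (int ns) t))" for t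
    by (subst sum.atLeast_Suc_atMost) (simp_all add: numeral_2_eq_2)
  then show ?thesis using W_add[OF 1 2] by (simp add: algebra_simps)
qed

text \<open>A generator of \<open>U\<close> given by its data. Membership in \<open>U\<close>
  forgets the exponents, but sorting by order has to inspect them.\<close>

definition term_fun :: "complex \<times> (int \<Rightarrow> complex) \<times> real \<times> 'b \<Rightarrow> real \<Rightarrow> 'b::real_vector" where
  "term_fun d t = (case d of (c, \<alpha>, \<beta>, v) \<Rightarrow> Re (c * mon \<alpha> \<beta> t) *\<^sub>R v)"

lemma U_terms:
  "g \<in> U a \<Longrightarrow> \<exists>ds. (\<forall>d\<in>set ds. fst (snd d) \<in> exps a) \<and> (\<forall>t. g t = (\<Sum>i<length ds. term_fun (ds ! i) t))"
proof (induction rule: U.induct)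
  case (gen \<alpha> c \<beta> v)
  then show ?case by (intro exI[of _ "[(c, \<alpha>, \<beta>, v)]"]) (simp add: term_fun_def)
next
  case zero
  show ?case by (intro exI[of _ "[]"]) simp
next
  case (add g h)
  then obtain ds es where ds: "\<forall>d\<in>set ds. fst (snd d) \<in> exps a" "\<forall>t. g t = (\<Sum>i<length ds. term_fun (ds ! i) t)"
    and es: "\<forall>d\<in>set es. fst (snd d) \<in> exps a" "\<forall>t. h t = (\<Sum>i<length es. term_fun (es ! i) t)" by blast
  have conv: "(\<Sum>i<length xs. term_fun (xs ! i) t) = sum_list (map (\<lambda>d. term_fun d t) xs)" for xs t
    by (simp add: sum_list_sum_nth atLeast0LessThan)
  have "(\<Sum>i<length (ds @ es). term_fun ((ds @ es) ! i) t) = g t + h t" for t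
    unfolding conv using ds(2) es(2) by (simp add: conv)
  then show ?case
    by (intro exI[of _ "ds @ es"]) (use ds(1) es(1) in auto)
qed

lemma term_fun_small:
  assumes "fst (snd d) \<in> exps a"
  shows "(term_fun d :: real \<Rightarrow> 'b::real_normed_vector) \<in> small a"
proof -
  obtain c \<alpha> \<beta> v where d: "d = (c, \<alpha>, \<beta>, v)" by (cases d)
  have "(\<lambda>t. Re (c * mon \<alpha> \<beta> t) *\<^sub>R v) \<in> small a" by (rule U_small[OF U.gen]) (use assms d in simp)
  then show ?thesis by (simp add: d term_fun_def[abs_def])
qed


text \<open>The terms of all blocks are pooled and sorted by their true order, the negative real
  part of the exponent of L. A term of block j has order at least \<gamma> + j \<delta>, so only
  finitely many terms lie below any bound; each class of equal order becomes one
  \<open>q k\<close>.\<close>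

lemma regroup_by_order:
  fixes Q :: "nat \<Rightarrow> real \<Rightarrow> real ^ 'n"
  assumes Q: "\<And>j. Q j \<in> U (\<gamma> + real j * \<delta>)" and \<gamma>: "\<gamma> > 0"
  shows "\<exists>(\<mu> :: nat \<Rightarrow> real) (n :: nat \<Rightarrow> nat) (q :: nat \<Rightarrow> (int \<Rightarrow> real) \<Rightarrow> real \<Rightarrow> real ^ 'n).
    (\<forall>k\<ge>1. \<mu> k > 0) \<and> strict_mono_on {1..} \<mu> \<and> filterlim \<mu> at_top sequentially \<and>
    mono n \<and> n 0 = n1 \<and> (\<forall>k\<ge>1. q k \<in> hatP (int m) (int (n k)) (- \<mu> k)) \<and>
    (\<forall>y. (\<forall>N. (\<lambda>t. y t - (\<Sum>j<N. Q j t)) \<in> small (\<gamma> + real N * \<delta>)) \<longrightarrow>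
      (\<forall>N\<ge>1. \<exists>\<nu>>\<mu> N. (\<lambda>t. norm (y t - (\<Sum>k=1..N. q k (log_tuple (int (n k)) t) (\<zeta> t))))
        \<in> O[at_top](\<lambda>t. L t powr (- \<nu>))))"
proof -
  have "\<forall>j. \<exists>ds. (\<forall>d\<in>set ds. fst (snd d) \<in> exps (\<gamma> + real j * \<delta>)) \<and>
      (\<forall>t. Q j t = (\<Sum>i<length ds. term_fun (ds ! i) t))"
    using U_terms[OF Q] by blast
  from choice[OF this] obtain ds where ds0: "\<forall>j. (\<forall>d\<in>set (ds j). fst (snd d) \<in> exps (\<gamma> + real j * \<delta>)) \<and>
      (\<forall>t. Q j t = (\<Sum>i<length (ds j). term_fun (ds j ! i) t))" ..
  define D where "D x = ds (fst x) ! snd x" for x :: "nat \<times> nat"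
  define I where "I = {x. snd x < length (ds (fst x))}"
  define \<alpha> where "\<alpha> x = fst (snd (D x))" for x
  define ord where "ord x = - Re (\<alpha> x (int m))" for x
  have Qsum: "Q j t = (\<Sum>i<length (ds j). term_fun (D (j, i)) t)" for j t
    using ds0 by (simp add: D_def)
  have \<alpha>: "\<alpha> x \<in> exps (\<gamma> + real (fst x) * \<delta>)" if "x \<in> I" for x
    using ds0 that by (simp add: \<alpha>_def D_def I_def)
  have ord_ge: "\<gamma> + real (fst x) * \<delta> \<le> ord x" if "x \<in> I" for x
    using \<alpha>[OF that] by (simp add: exps_def ord_def)
  have \<alpha>_ord: "\<alpha> x \<in> exps (ord x)" if "x \<in> I" for x
    using \<alpha>[OF that] by (simp add: exps_def ord_def)
  have arch: "\<exists>J. \<gamma> + real J * \<delta> > B" for B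
  proof -
    obtain J where "real J * \<delta> > B - \<gamma>" using reals_Archimedean3[OF \<delta>_pos] by blast
    then show ?thesis by (intro exI[of _ J]) simp
  qed
  have step_le: "\<gamma> + real i * \<delta> \<le> \<gamma> + real j * \<delta>" if "i \<le> j" for i j
    using that \<delta>_pos by (simp add: mult_right_mono)
  have finB: "finite {x \<in> I. fst x < J}" for J
  proof (rule finite_subset)
    show "{x \<in> I. fst x < J} \<subseteq> Sigma {..<J} (\<lambda>j. {..<length (ds j)})" by (auto simp: I_def)
  qed simp
  have finO: "finite {x \<in> I. ord x \<le> B}" for B
  proof -
    obtain J where J: "\<gamma> + real J * \<delta> > B" using arch by blast
    have "{x \<in> I. ord x \<le> B} \<subseteq> {x \<in> I. fst x < J}"
    proof
      fix x assume x: "x \<in> {x \<in> I. ord x \<le> B}"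
      then have "\<gamma> + real (fst x) * \<delta> < \<gamma> + real J * \<delta>" using ord_ge[of x] J by auto
      then have "\<not> J \<le> fst x" using step_le[of J "fst x"] by linarith
      then show "x \<in> {x \<in> I. fst x < J}" using x by simp
    qed
    then show ?thesis using finB finite_subset by blast
  qed
  \<comment> \<open>The grid points are added so that there are infinitely many orders even if only
    finitely many terms exist; an order without terms gives a zero \<open>q k\<close>.\<close>
  define M where "M = ord ` I \<union> range (\<lambda>j. \<gamma> + real j * \<delta>)"
  have "inj (\<lambda>j. \<gamma> + real j * \<delta>)" using \<delta>_pos by (auto simp: inj_def)
  then have "infinite M" unfolding M_def using range_inj_infinite by blast
  moreover have "finite (M \<inter> {..B})" for B
  proof -
    obtain J where J: "\<gamma> + real J * \<delta> > B" using arch by blast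
    have "M \<inter> {..B} \<subseteq> ord ` {x \<in> I. ord x \<le> B} \<union> (\<lambda>j. \<gamma> + real j * \<delta>) ` {..<J}"
    proof
      fix b assume b: "b \<in> M \<inter> {..B}"
      then consider x where "x \<in> I" "b = ord x" | j where "b = \<gamma> + real j * \<delta>" unfolding M_def by blast
      then show "b \<in> ord ` {x \<in> I. ord x \<le> B} \<union> (\<lambda>j. \<gamma> + real j * \<delta>) ` {..<J}"
      proof cases
        case 1
        then show ?thesis using b by auto
      next
        case 2
        then have "\<gamma> + real j * \<delta> < \<gamma> + real J * \<delta>" using b J by auto
        then have "j < J" using step_le[of J j] by (meson leI not_le)
        then show ?thesis using 2 by blast
      qed
    qed
    then show ?thesis using finO finite_subset by blast
  qed
  ultimately obtain f :: "nat \<Rightarrow> real" where f: "strict_mono f" "range f = M"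
    by (rule locally_finite_enumeration)
  \<comment> \<open>The enumeration f starts at 0, the expansion at 1; thus the order following
    \<open>\<mu> N\<close> is \<open>f N\<close>.\<close>
  define \<mu> where "\<mu> k = f (k - 1)" for k :: nat
  define Ik where "Ik k = {x \<in> I. ord x = \<mu> k}" for k
  have finI: "finite (Ik k)" for k
    by (rule finite_subset[OF _ finO[of "\<mu> k"]]) (auto simp: Ik_def)
  have Mge: "b \<ge> \<gamma>" if b: "b \<in> M" for b
  proof -
    from b consider x where "x \<in> I" "b = ord x" | j where "b = \<gamma> + real j * \<delta>" unfolding M_def by blast
    then show ?thesis
    proof cases
      case 1
      then show ?thesis using ord_ge[of x] step_le[of 0 "fst x"] by simp
    next
      case 2
      then show ?thesis using step_le[of 0 j] by simp
    qed
  qed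
  have fM: "f i \<in> M" for i using f(2) by blast
  have \<mu>_pos: "\<mu> k > 0" for k using Mge[OF fM] \<gamma> by (auto simp: \<mu>_def intro: less_le_trans)
  have \<mu>_mono: "strict_mono_on {1..} \<mu>"
    by (rule strict_mono_onI) (auto simp: \<mu>_def intro!: strict_monoD[OF f(1)])
  have f_lim: "filterlim f at_top sequentially"
    unfolding filterlim_at_top eventually_sequentially
  proof
    fix B
    obtain J where J: "\<gamma> + real J * \<delta> > B" using arch by blast
    have "\<gamma> + real J * \<delta> \<in> range f" unfolding f(2) M_def by blast
    then obtain i where "f i > B" using J by auto
    then have "\<forall>n\<ge>i. B \<le> f n" using strict_mono_mono[OF f(1)] by (meson less_imp_le monoD order_trans)
    then show "\<exists>N. \<forall>n\<ge>N. B \<le> f n" ..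
  qed
  then have "filterlim (\<lambda>k. \<mu> (Suc k)) at_top sequentially" by (simp add: \<mu>_def)
  then have \<mu>_lim: "filterlim \<mu> at_top sequentially" by (simp only: filterlim_sequentially_Suc)
  define \<kappa> where "\<kappa> x = (SOME l. \<alpha> x \<in> tuples (int l))" for x
  have \<kappa>: "\<alpha> x \<in> tuples (int (\<kappa> x))" if x: "x \<in> I" for x
  proof -
    obtain k where "\<alpha> x \<in> tuples k" using \<alpha>[OF x] by (auto simp: exps_def)
    then have "\<alpha> x \<in> tuples (int (nat k))" using tuples_mono[of k "int (nat k)"] by auto
    then show ?thesis unfolding \<kappa>_def by (rule someI)
  qed
  \<comment> \<open>The running sum is monotone in k, starts at n1 and dominates the length
    \<open>\<kappa> x\<close> of every tuple used in \<open>q k\<close>.\<close>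
  define n where "n k = n1 + (\<Sum>l=1..k. \<Sum>x\<in>Ik l. \<kappa> x)" for k
  have n_mono: "mono n" by (rule monoI) (auto simp: n_def intro!: sum_mono2)
  have \<kappa>n: "\<kappa> x \<le> n k" if k: "k \<ge> 1" and x: "x \<in> Ik k" for x k
  proof -
    have "\<kappa> x \<le> (\<Sum>x\<in>Ik k. \<kappa> x)" by (rule member_le_sum[OF x]) (auto simp: finI)
    also have "\<dots> \<le> (\<Sum>l=1..k. \<Sum>x\<in>Ik l. \<kappa> x)"
      using k by (intro member_le_sum[of k "{1..k}" "\<lambda>l. \<Sum>x\<in>Ik l. \<kappa> x"]) auto
    finally show ?thesis by (simp add: n_def)
  qed
  have \<alpha>n: "\<alpha> x \<in> tuples (int (n k))" if "k \<ge> 1" "x \<in> Ik k" for x k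
    using \<kappa>[of x] \<kappa>n[OF that] that(2) tuples_mono[of "int (\<kappa> x)" "int (n k)"] by (auto simp: Ik_def)
  define q :: "nat \<Rightarrow> (int \<Rightarrow> real) \<Rightarrow> real \<Rightarrow> real ^ 'n" where
    "q k = (\<lambda>z w. \<Sum>x\<in>Ik k. Re (fst (D x) * (tuple_power (int (n k)) z (\<alpha> x) *
       of_real (w powr fst (snd (snd (D x)))))) *\<^sub>R snd (snd (snd (D x))))" for k
  have q_hat: "q k \<in> hatP (int m) (int (n k)) (- \<mu> k)" if k: "k \<ge> 1" for k
    unfolding q_def
  proof (rule real_part_sum_in_hatP[OF finI])
    fix x assume x: "x \<in> Ik k"
    then have xI: "x \<in> I" "ord x = \<mu> k" by (auto simp: Ik_def)
    have "Re (\<alpha> x (int m)) = - \<mu> k" using xI(2) by (simp add: ord_def)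
    moreover have "\<forall>j\<in>{-1..<int m}. Re (\<alpha> x j) = 0" using \<alpha>[OF xI(1)] by (simp add: exps_def)
    ultimately show "\<alpha> x \<in> power_vectors (int m) (int (n k)) (- \<mu> k)"
      using \<alpha>n[OF k x] by (simp add: power_vectors_def)
  qed
  have q_val: "eventually (\<lambda>t. q k (log_tuple (int (n k)) t) (\<zeta> t) = (\<Sum>x\<in>Ik k. term_fun (D x) t)) at_top"
    if k: "k \<ge> 1" for k
  proof -
    have "eventually (\<lambda>t. \<forall>x\<in>Ik k. tuple_power (int (n k)) (log_tuple (int (n k)) t) (\<alpha> x) = log_power (\<alpha> x) t) at_top"
      using \<alpha>n[OF k] by (intro eventually_ball_finite finI ballI tuple_power_log_tuple)
    then show ?thesis using \<zeta>_pos
    proof eventually_elim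
      case (elim t)
      show ?case unfolding q_def
      proof (rule sum.cong[OF refl])
        fix x assume x: "x \<in> Ik k"
        obtain c a b v where Dx: "D x = (c, a, b, v)" by (cases "D x")
        show "Re (fst (D x) * (tuple_power (int (n k)) (log_tuple (int (n k)) t) (\<alpha> x) *
            of_real (\<zeta> t powr fst (snd (snd (D x)))))) *\<^sub>R snd (snd (snd (D x))) = term_fun (D x) t"
          using elim(2) bspec[OF elim(1) x] by (simp add: Dx term_fun_def mon_def \<alpha>_def powr_def)
      qed
    qed
  qed
  have expansion: "\<exists>\<nu>>\<mu> N. (\<lambda>t. norm (y t - (\<Sum>k=1..N. q k (log_tuple (int (n k)) t) (\<zeta> t)))) \<in> O[at_top](\<lambda>t. L t powr (- \<nu>))"
    if y: "\<And>N. (\<lambda>t. y t - (\<Sum>j<N. Q j t)) \<in> small (\<gamma> + real N * \<delta>)" and N: "N \<ge> 1" for y N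
  proof -
    \<comment> \<open>After J blocks the error has order above \<open>f N\<close>. Among the terms S
      of these blocks, those of order at most \<open>\<mu> N\<close>, collected in A, make up the
      first N functions q, and all others have order at least \<open>f N\<close>.\<close>
    obtain J where J: "\<gamma> + real J * \<delta> > f N" using arch by blast
    define S where "S = {x \<in> I. fst x < J}"
    define A where "A = {x \<in> I. ord x \<le> \<mu> N}"
    have fN: "\<mu> N < f N" using N strict_monoD[OF f(1), of "N - 1" N] by (simp add: \<mu>_def)
    have ordM: "\<exists>i. ord x = f i" if "x \<in> I" for x
    proof -
      have "ord x \<in> range f" unfolding f(2) M_def using that by blast
      then show ?thesis by auto
    qed
    have AS: "A \<subseteq> S"
    proof
      fix x assume x: "x \<in> A"
      then have "\<gamma> + real (fst x) * \<delta> < \<gamma> + real J * \<delta>" using ord_ge[of x] J fN by (auto simp: A_def)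
      then have "\<not> J \<le> fst x" using step_le[of J "fst x"] by linarith
      then show "x \<in> S" using x by (simp add: A_def S_def)
    qed
    have SQ: "(\<Sum>j<J. Q j t) = (\<Sum>x\<in>S. term_fun (D x) t)" for t
    proof -
      have "S = Sigma {..<J} (\<lambda>j. {..<length (ds j)})" by (auto simp: S_def I_def)
      then show ?thesis by (simp add: Qsum sum.Sigma)
    qed
    have AU: "A = (\<Union>k\<in>{1..N}. Ik k)"
    proof (intro equalityI subsetI)
      fix x assume x: "x \<in> A"
      then have "x \<in> I" by (simp add: A_def)
      then obtain i where i: "ord x = f i" using ordM by blast
      then have "f i \<le> f (N - 1)" using x by (simp add: A_def \<mu>_def)
      then have "i \<le> N - 1" using strict_mono_less_eq[OF f(1)] by blast
      then have "Suc i \<in> {1..N}" "x \<in> Ik (Suc i)" using N x i by (auto simp: Ik_def \<mu>_def A_def)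
      then show "x \<in> (\<Union>k\<in>{1..N}. Ik k)" by blast
    next
      fix x assume "x \<in> (\<Union>k\<in>{1..N}. Ik k)"
      then obtain k where k: "k \<in> {1..N}" "x \<in> I" "ord x = \<mu> k" by (auto simp: Ik_def)
      have "k - 1 \<le> N - 1" using k(1) by (intro diff_le_mono) simp
      then have "f (k - 1) \<le> f (N - 1)" by (simp only: strict_mono_less_eq[OF f(1)])
      then show "x \<in> A" using k by (simp add: A_def \<mu>_def)
    qed
    have Asum: "(\<Sum>k=1..N. \<Sum>x\<in>Ik k. term_fun (D x) t) = (\<Sum>x\<in>A. term_fun (D x) t)" for t
      unfolding AU
    proof (rule sum.UNION_disjoint[symmetric])
      show "\<forall>i\<in>{1..N}. \<forall>j\<in>{1..N}. i \<noteq> j \<longrightarrow> Ik i \<inter> Ik j = {}"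
      proof (intro ballI impI)
        fix i j assume ij: "i \<in> {1..N}" "j \<in> {1..N}" "i \<noteq> j"
        then have "i - 1 \<noteq> j - 1" unfolding atLeastAtMost_iff by linarith
        then have "\<mu> i \<noteq> \<mu> j" using strict_mono_eq[OF f(1)] by (simp add: \<mu>_def)
        then show "Ik i \<inter> Ik j = {}" by (auto simp: Ik_def)
      qed
    qed (auto simp: finI)
    have rest: "(term_fun (D x) :: real \<Rightarrow> real ^ 'n) \<in> small (f N)" if x: "x \<in> S - A" for x
    proof -
      have xI: "x \<in> I" "ord x > f (N - 1)" using x by (auto simp: S_def A_def \<mu>_def)
      obtain i where i: "ord x = f i" using ordM[OF xI(1)] by blast
      have "N - 1 < i" using xI(2) i strict_mono_less[OF f(1)] by simp
      then have "f N \<le> ord x" using i strict_mono_less_eq[OF f(1), of N i] by simp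
      moreover have "(term_fun (D x) :: real \<Rightarrow> real ^ 'n) \<in> small (ord x)"
        using \<alpha>_ord[OF xI(1)] by (intro term_fun_small) (simp add: \<alpha>_def)
      ultimately show ?thesis by (rule small_mono)
    qed
    have "(\<lambda>t. y t - (\<Sum>j<J. Q j t)) \<in> small (f N)" by (rule small_mono[OF _ y]) (use J in simp)
    moreover have "(\<lambda>t. \<Sum>x\<in>S - A. term_fun (D x) t) \<in> small (f N)" by (rule small_sum) (rule rest)
    ultimately have "(\<lambda>t. (y t - (\<Sum>j<J. Q j t)) + (\<Sum>x\<in>S - A. term_fun (D x) t)) \<in> small (f N)" by (rule small_add)
    moreover have "(\<Sum>x\<in>S. term_fun (D x) t) = (\<Sum>x\<in>S - A. term_fun (D x) t) + (\<Sum>x\<in>A. term_fun (D x) t)" for t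
      using sum.subset_diff[OF AS] finB by (simp add: S_def)
    ultimately have "(\<lambda>t. y t - (\<Sum>x\<in>A. term_fun (D x) t)) \<in> small (f N)"
      by (simp add: SQ)
    moreover have "eventually (\<lambda>t. \<forall>k\<in>{1..N}. q k (log_tuple (int (n k)) t) (\<zeta> t) = (\<Sum>x\<in>Ik k. term_fun (D x) t)) at_top"
      by (intro eventually_ball_finite ballI q_val) auto
    then have "eventually (\<lambda>t. y t - (\<Sum>k=1..N. q k (log_tuple (int (n k)) t) (\<zeta> t)) = y t - (\<Sum>x\<in>A. term_fun (D x) t)) at_top"
      by eventually_elim (simp flip: Asum)
    ultimately have "(\<lambda>t. y t - (\<Sum>k=1..N. q k (log_tuple (int (n k)) t) (\<zeta> t))) \<in> small (f N)"
      by (rule small_cong)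
    \<comment> \<open>\<open>small (f N)\<close> yields bounds only for exponents below
      \<open>f N\<close>, so one strictly between the two orders is chosen.\<close>
    moreover obtain \<nu> where \<nu>: "\<mu> N < \<nu>" "\<nu> < f N" using dense[OF fN] by blast
    ultimately show ?thesis using small_bigo by blast
  qed
  have "n 0 = n1" by (simp add: n_def)
  then show ?thesis
    using \<mu>_pos \<mu>_mono \<mu>_lim n_mono q_hat expansion
    by (intro exI[of _ \<mu>] exI[of _ n] exI[of _ q]) simp
qed

end

theorem theorem3p6:
  fixes A :: "real ^ 'n ^ 'n"
    and F :: "real ^ 'n \<Rightarrow> real ^ 'n"
    and f :: "real \<Rightarrow> real ^ 'n"
    and T :: real
    and m n1 :: nat
    and \<gamma> :: "nat \<Rightarrow> real"
    and p :: "nat \<Rightarrow> (int \<Rightarrow> real) \<Rightarrow> real ^ 'n"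
    and p0 :: "(int \<Rightarrow> real) \<Rightarrow> real"
    and \<xi>0 :: "real ^ 'n"
  assumes "\<And>l. complex_eigenvalue A l \<Longrightarrow> Re l > 0"
    and "local_lipschitz (UNIV :: real set) UNIV (\<lambda>_. F)"
    and "F 0 = 0"
    and "nonlin_H1 F \<or> nonlin_H2 F"
    and "T \<ge> 0"
    and "continuous_on {T..} f"
    and "(\<exists>nt. forcing_f1 f m \<gamma> nt p \<and> n1 = nt 1) \<or> (\<exists>K. forcing_f2 f m K \<gamma> n1 p)"
    and "p0 \<in> Pplus_at (int m) (int n1)"
    and "\<xi>0 \<noteq> 0"
    and "\<And>z. z \<in> pos_tuples (int n1) \<Longrightarrow> p 1 z = (p0 z * z (int m) powr (- \<gamma> 1)) *\<^sub>R \<xi>0"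
  shows "\<exists>(\<mu> :: nat \<Rightarrow> real) (n :: nat \<Rightarrow> nat) (\<zeta> :: (int \<Rightarrow> real) \<Rightarrow> real)
            (q :: nat \<Rightarrow> (int \<Rightarrow> real) \<Rightarrow> real \<Rightarrow> real ^ 'n).
      (\<forall>k\<ge>1. \<mu> k > 0) \<and> strict_mono_on {1..} \<mu> \<and> filterlim \<mu> at_top sequentially \<and>
      mono n \<and> (\<forall>k. n k \<ge> m) \<and>
      \<zeta> \<in> Pplus_at (int m) (int (n 0)) \<and>
      (\<forall>k\<ge>1. q k \<in> hatP (int m) (int (n k)) (- \<mu> k)) \<and>
      (\<forall>T0 y. T0 > 0 \<and> T0 \<ge> T \<and> is_solution A F f T0 y \<and> (y \<longlongrightarrow> 0) at_top \<longrightarrow>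
        (\<forall>N\<ge>1. \<exists>\<nu>>\<mu> N.
          (\<lambda>t. norm (y t - (\<Sum>k=1..N.
                 q k (log_tuple (int (n k)) t) (\<zeta> (log_tuple (int (n 0)) t)))))
            \<in> O[at_top](\<lambda>t. iter_log (int m) t powr (- \<nu>))))"
proof -
  have eig: "\<And>l. complex_eigenvalue A l \<Longrightarrow> Re l > 0" by (rule assms(1))
  obtain \<beta> Fk where F: "hom_expansion F \<beta> Fk"
    using assms(3,4) nonlin_H1_hom_expansion[of F] nonlin_H2_hom_expansion[of F] by blast
  then have \<beta>1: "\<beta> 1 > 1" by (simp add: hom_expansion_def)
  have mn: "m \<le> n1" using assms(7) by (auto simp: forcing_f1_def forcing_f2_def)
  have \<gamma>1: "\<gamma> 1 > 0" using assms(7) by (auto simp: forcing_f1_def forcing_f2_def)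
  \<comment> \<open>In the finite case with a single forcing term \<open>\<gamma> 2\<close> is
    arbitrary, so the gap is taken only if it is positive, with default 1.\<close>
  define d where "d = (if \<gamma> 1 < \<gamma> 2 then \<gamma> 2 - \<gamma> 1 else 1)"
  \<comment> \<open>The three gains: 1 from differentiating a logarithmic factor,
    \<open>(\<beta> 1 - 1) * \<gamma> 1\<close> from the superlinearity of F, and d from the next
    forcing term.\<close>
  define \<delta> where "\<delta> = min 1 (min ((\<beta> 1 - 1) * \<gamma> 1) d)"
  have \<delta>: "\<delta> > 0" "\<delta> \<le> 1" "\<delta> \<le> (\<beta> 1 - 1) * \<gamma> 1" "\<delta> \<le> d"
    using \<beta>1 \<gamma>1 by (auto simp: \<delta>_def d_def)
  have \<beta>\<delta>: "\<gamma> 1 + \<delta> \<le> \<beta> 1 * \<gamma> 1" using \<delta>(3) by (simp add: algebra_simps)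
  define \<zeta> where "\<zeta> t = p0 (log_tuple (int n1) t)" for t
  interpret log_scale m \<zeta> \<delta>
  proof
    show "eventually (\<lambda>t. \<zeta> t > 0) at_top"
      unfolding \<zeta>_def by (rule Pplus_at_log_tuple(1)[OF assms(8) mn])
    show "eventually (\<lambda>t. \<bar>ln (\<zeta> t)\<bar> \<le> e * iter_log (int m + 1) t) at_top" if "e > 0" for e
      unfolding \<zeta>_def by (rule Pplus_at_log_tuple(2)[OF assms(8) mn that])
    show "\<exists>k S \<xi>. finite S \<and> S \<subseteq> power_vectors (int m) k 0 \<and> (\<forall>\<alpha>\<in>S. \<alpha> (-1) = 0) \<and>
      eventually (\<lambda>t. complex_of_real (\<zeta> t) = (\<Sum>\<alpha>\<in>S. \<xi> \<alpha> * log_power \<alpha> t)) at_top"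
      unfolding \<zeta>_def by (rule exI[of _ "int n1"]) (rule Pplus_at_log_tuple(3)[OF assms(8) mn])
  qed (use \<delta> in auto)
  have lin: "linear ((*v) A)" by (rule matrix_vector_mul_linear)
  have "inj ((*v) A)"
    unfolding linear_injective_0[OF lin]
  proof (intro allI impI, rule ccontr)
    fix x assume x: "A *v x = 0" "x \<noteq> 0"
    have "map_matrix complex_of_real A *v complexify x = 0 *s complexify x"
      using cmul_complexify[of A x] x(1) by (simp add: cmul_def complexify_def vec_eq_iff)
    moreover have "complexify x \<noteq> 0" using x(2) by (simp add: complexify_def vec_eq_iff)
    ultimately have "complex_eigenvalue A 0" unfolding complex_eigenvalue_def by blast
    then show False using eig[of 0] by simp
  qed
  then have "surj ((*v) A)" by (rule linear_inj_imp_surj[OF lin])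
  then obtain a where a: "\<xi>0 = A *v a" by (rule surjE)
  have a0: "a \<noteq> 0" using a assms(9) by auto
  have f1: "(\<lambda>t. f t - p 1 (log_tuple (int n1) t)) \<in> W (\<gamma> 1 + \<delta>)"
    using assms(7)
  proof (elim disjE exE conjE)
    fix nt assume nt: "forcing_f1 f m \<gamma> nt p" "n1 = nt 1"
    have "strict_mono_on {1..} \<gamma>" using nt(1) by (simp add: forcing_f1_def)
    then have "\<gamma> 1 < \<gamma> 2" by (rule strict_mono_onD) auto
    then have "\<gamma> 1 + \<delta> \<le> \<gamma> 2" using \<delta>(4) by (simp add: d_def)
    from forcing_f1_W[OF nt(1) this] show ?thesis by (simp add: nt(2))
  next
    fix K assume K: "forcing_f2 f m K \<gamma> n1 p"
    show ?thesis
    proof (rule forcing_f2_W[OF K])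
      assume "K \<ge> 2"
      have "strict_mono_on {1..K} \<gamma>" using K by (simp add: forcing_f2_def)
      then have "\<gamma> 1 < \<gamma> 2" by (rule strict_mono_onD) (use \<open>K \<ge> 2\<close> in auto)
      then show "\<gamma> 1 + \<delta> \<le> \<gamma> 2" using \<delta>(4) by (simp add: d_def)
    qed
  qed
  have f: "(\<lambda>t. f t - scale (\<gamma> 1) t *\<^sub>R \<xi>0) \<in> W (\<gamma> 1 + \<delta>)"
  proof (rule W_cong[OF f1])
    show "eventually (\<lambda>t. f t - scale (\<gamma> 1) t *\<^sub>R \<xi>0 = f t - p 1 (log_tuple (int n1) t)) at_top"
      using scale_eq[of "\<gamma> 1"] log_tuple_pos[of "int n1"]
    proof eventually_elim
      case (elim t)
      have "log_tuple (int n1) t (int m) = L t" using mn by (simp add: log_tuple_def)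
      then show ?case using elim assms(10)[OF elim(2)] by (simp add: \<zeta>_def)
    qed
  qed
  obtain Q where Q: "\<And>j. Q j \<in> U (\<gamma> 1 + real j * \<delta>)"
    "\<And>T0 y N. is_solution A F f T0 y \<Longrightarrow> (y \<longlongrightarrow> 0) at_top \<Longrightarrow>
      (\<lambda>t. y t - (\<Sum>j<N. Q j t)) \<in> small (\<gamma> 1 + real N * \<delta>)"
    using common_expansion[OF eig F \<gamma>1 \<beta>\<delta> a0 a[symmetric] f] by blast
  obtain \<mu> n and q :: "nat \<Rightarrow> (int \<Rightarrow> real) \<Rightarrow> real \<Rightarrow> real ^ 'n" where R:
    "\<forall>k\<ge>1. \<mu> k > 0" "strict_mono_on {1..} \<mu>" "filterlim \<mu> at_top sequentially"
    "mono n" "n 0 = n1" "\<forall>k\<ge>1. q k \<in> hatP (int m) (int (n k)) (- \<mu> k)"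
    "\<forall>y. (\<forall>N. (\<lambda>t. y t - (\<Sum>j<N. Q j t)) \<in> small (\<gamma> 1 + real N * \<delta>)) \<longrightarrow>
      (\<forall>N\<ge>1. \<exists>\<nu>>\<mu> N. (\<lambda>t. norm (y t - (\<Sum>k=1..N. q k (log_tuple (int (n k)) t) (\<zeta> t))))
        \<in> O[at_top](\<lambda>t. L t powr (- \<nu>)))"
    using regroup_by_order[OF Q(1) \<gamma>1, of n1] by (elim exE conjE) (rule that)
  have nm: "n k \<ge> m" for k
    using monoD[OF R(4), of 0 k] R(5) mn by simp
  show ?thesis
  \<comment> \<open>The extra variable is p0 itself; \<open>n 0 = n1\<close> ensures that it is
    evaluated on the tuple for which it was given.\<close>
  proof (rule exI[of _ \<mu>], rule exI[of _ n], rule exI[of _ p0], rule exI[of _ q], intro conjI R(1-4) R(6))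
    show "\<forall>k. n k \<ge> m" using nm by blast
    show "p0 \<in> Pplus_at (int m) (int (n 0))" using assms(8) by (simp add: R(5))
    show "\<forall>T0 y. T0 > 0 \<and> T0 \<ge> T \<and> is_solution A F f T0 y \<and> (y \<longlongrightarrow> 0) at_top \<longrightarrow>
        (\<forall>N\<ge>1. \<exists>\<nu>>\<mu> N.
          (\<lambda>t. norm (y t - (\<Sum>k=1..N.
                 q k (log_tuple (int (n k)) t) (p0 (log_tuple (int (n 0)) t)))))
            \<in> O[at_top](\<lambda>t. iter_log (int m) t powr (- \<nu>)))"
    proof (intro allI impI)
      fix T0 y N assume y: "T0 > 0 \<and> T0 \<ge> T \<and> is_solution A F f T0 y \<and> (y \<longlongrightarrow> 0) at_top" and N: "(1::nat) \<le> N"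
      then have "\<forall>N. (\<lambda>t. y t - (\<Sum>j<N. Q j t)) \<in> small (\<gamma> 1 + real N * \<delta>)" using Q(2) by blast
      then show "\<exists>\<nu>>\<mu> N.
          (\<lambda>t. norm (y t - (\<Sum>k=1..N.
                 q k (log_tuple (int (n k)) t) (p0 (log_tuple (int (n 0)) t)))))
            \<in> O[at_top](\<lambda>t. iter_log (int m) t powr (- \<nu>))"
        using R(7) N by (simp add: \<zeta>_def R(5))
    qed
  qed
qed

end
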